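(* Let $p$ be an $r$-bit prime, let $g$ be an integer with $p\nmid g$, let $u_0\in\{1,\ldots,p-1\}$, and let $k$ be an integer with $1\le k\le r$. Let $\ell$ be the trajectory length of the sequence $\{u_n\}$, and let $\nu_k(N)$ be the number of distinct values among $\xi^{(k)}_n$, $n=0,\ldots,N-1$. Then for all positive integers $N\le \ell$, $$ \nu_k(N) \ge N^{1/2} p^{o(1)}\cdot \left\{\begin{array}{ll} (2^k/p)^{1/6}, & \text{if } 1\ge k/r \ge 17/20,\\ 2^{7k/12} p^{-25/48}, & \text{if } 17/20 > k/r \ge 13/16,\\ (2^k/p)^{1/4}, & \text{if } 13/16 > k/r \ge 3/5,\\ 2^{2k/3} p^{-1/2}, & \text{if } 3/5 > k/r. \end{array}\right. $$
   Context: An $r$-bit prime is a prime $p$ with $2^{r-1}\le p<2^r$. Given a prime $p$, an integer $g$ with $p\nmid g$ and $u_0\in\{1,\ldots,p-1\}$, the sequence $\{u_n\}_{n\ge 0}$ is defined recursively by $u_n\equiv g^{u_{n-1}} \pmod p$, $1\le u_n\le p-1$, for $n=1,2,\ldots$ (the exponent $u_{n-1}$ is taken as an integer). It is eventually periodic: let $t\ge 1$ and then $s\ge 0$ be the smallest possible integers such that $u_n=u_{n+t}$ for all $n\ge s$. The trajectory length is $\ell=s+t$. For an integer $k\ge1$, $\xi^{(k)}_n\in\{0,\ldots,2^k-1\}$ denotes the integer formed by the $k$ least significant bits of $u_n$ (that is, $u_n$ reduced modulo $2^k$). The notation $p^{o(1)}$ is understood as $p\to\infty$, uniformly in $g$,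 $u_0$, $k$ and $N$: for every $\varepsilon>0$ there is $p_0(\varepsilon)$ such that for all $p\ge p_0(\varepsilon)$ the inequality holds with $p^{o(1)}$ replaced by $p^{-\varepsilon}$. *)

theory Defs
  imports Complex_Main "HOL-Computational_Algebra.Primes"
begin

definition bit_prime :: "nat \<Rightarrow> nat \<Rightarrow> bool" where
  "bit_prime r p \<longleftrightarrow> prime p \<and> 2 ^ (r - 1) \<le> p \<and> p < 2 ^ r"

text \<open>For a prime \<open>p\<close> not dividing \<open>g\<close> the residue below lies in \<open>{1..p - 1}\<close>, so it is the
  unique representative of \<open>g\<close> to the power \<open>u\<^sub>n\<close> in that range.\<close>

primrec exp_seq :: "nat \<Rightarrow> int \<Rightarrow> nat \<Rightarrow> nat \<Rightarrow> nat" where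
  "exp_seq p g u0 0 = u0"
| "exp_seq p g u0 (Suc n) = nat (g ^ exp_seq p g u0 n mod int p)"

definition seq_period :: "(nat \<Rightarrow> 'a) \<Rightarrow> nat" where
  "seq_period u = (LEAST t. 1 \<le> t \<and> (\<exists>s. \<forall>n\<ge>s. u n = u (n + t)))"

definition seq_preperiod :: "(nat \<Rightarrow> 'a) \<Rightarrow> nat" where
  "seq_preperiod u = (LEAST s. \<forall>n\<ge>s. u n = u (n + seq_period u))"

definition trajectory_length :: "(nat \<Rightarrow> 'a) \<Rightarrow> nat" where
  "trajectory_length u = seq_preperiod u + seq_period u"

definition low_bits :: "nat \<Rightarrow> (nat \<Rightarrow> nat) \<Rightarrow> nat \<Rightarrow> nat" where
  "low_bits k u n = u n mod 2 ^ k"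

definition num_low_bits :: "nat \<Rightarrow> (nat \<Rightarrow> nat) \<Rightarrow> nat \<Rightarrow> nat" where
  "num_low_bits k u N = card (low_bits k u ` {..<N})"

end

theory Submission
  imports Defs "HOL-Analysis.Convex" "HOL-Number_Theory.Cong"
begin

text \<open>The terms \<open>u\<^sub>n\<close> with \<open>n < \<ell>\<close> are distinct, so by the pigeonhole principle some pair of \<open>k\<close>-bit
  residues is shared by at least \<open>(N - 1) / \<nu>\<^sup>2\<close> consecutive pairs \<open>(u\<^sub>n, u\<^sub>n\<^sub>+\<^sub>1)\<close>. Writing
  \<open>u\<^sub>n = 2\<^sup>k x + a\<close> and \<open>u\<^sub>n\<^sub>+\<^sub>1 = 2\<^sup>k y + b\<close>, these are \<open>R\<close> points of an exponential curve in a box of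
  side \<open>M = 2 ^ (r - k)\<close>, and it remains to bound \<open>R\<close> from above. A product of \<open>m\<close> of the shifted
  ordinates depends only on the sum of the abscissae, which takes at most \<open>m M\<close> values; by
  Cauchy--Schwarz \<open>R ^ (2 m) \<le> m M E\<close>, where \<open>E\<close> counts the solutions of
  \<open>w\<^sub>1 \<cdots> w\<^sub>m \<equiv> w\<^sub>1' \<cdots> w\<^sub>m'\<close> modulo \<open>p\<close>. The cases \<open>m = 2\<close> and \<open>m = 3\<close> are used.

  To bound \<open>E\<close>, fix one variable \<open>s\<close> and write the others as \<open>s + x\<close> with \<open>\<bar>x\<bar> \<le> M\<close>. The congruence
  says that the coefficient vector of a polynomial vanishing at \<open>s\<close> modulo \<open>p\<close> is a lattice point of a
  small box, and by the divisor bound each lattice point comes from \<open>p ^ o(1)\<close> solutions. If all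
  these polynomials have a common factor over the rationals, the congruence becomes a multiplicative
  equation over the integers and the divisor bound applies again. Otherwise a determinant (two
  factors) or a resultant (three factors) is a nonzero multiple of \<open>p\<close>, so there are few lattice
  points. This gives \<open>R\<^sup>3 \<le> M (R + M\<^sup>3 / p) p ^ o(1)\<close> for all \<open>M\<close> and, when the ordinates lie in an
  interval of length \<open>H\<close> with \<open>120 H\<^sup>6 < p\<close>, \<open>R\<^sup>5 \<le> M (R\<^sup>2 + H\<^sup>4 / sqrt p) p ^ o(1)\<close>. The first bound
  yields the last two ranges; the second one, after cutting the ordinates into intervals of length
  \<open>H \<approx> min M (p ^ (1/6))\<close>, yields the first two.\<close>

subsection \<open>Counting and the divisor bound\<close>

lemma card_le_image_times_fiber:
  assumes "finite A" and "\<And>y. y \<in> f ` A \<Longrightarrow> card {x \<in> A. f x = y} \<le> n"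
  shows "card A \<le> card (f ` A) * n"
proof -
  have "card A = card (\<Union>y\<in>f ` A. {x \<in> A. f x = y})"
    by (rule arg_cong[where f = card]) auto
  also have "\<dots> \<le> (\<Sum>y\<in>f ` A. card {x \<in> A. f x = y})"
    using assms(1) by (intro card_UN_le) auto
  also have "\<dots> \<le> (\<Sum>y\<in>f ` A. n)"
    using assms(2) by (intro sum_mono) auto
  finally show ?thesis by simp
qed

lemma card_le_fiber_bound:
  assumes "finite A" "finite B" "f ` A \<subseteq> B"
    and "\<And>y. y \<in> B \<Longrightarrow> card {x \<in> A. f x = y} \<le> n"
  shows "card A \<le> card B * n"
proof -
  have "card A \<le> card (f ` A) * n"
    using assms by (intro card_le_image_times_fiber) auto
  also have "\<dots> \<le> card B * n"
    using assms by (intro mult_right_mono card_mono) auto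
  finally show ?thesis .
qed

text \<open>Cells of length \<open>d\<close> starting at \<open>- A\<close> contain at most one
  point each, and at most \<open>1 + 2 * A / d\<close> cells meet the interval.\<close>

lemma card_separated_le:
  fixes S :: "real set"
  assumes "finite S" "0 < d" "0 \<le> A" "\<And>x. x \<in> S \<Longrightarrow> \<bar>x\<bar> \<le> A"
    and sep: "\<And>x y. x \<in> S \<Longrightarrow> y \<in> S \<Longrightarrow> x \<noteq> y \<Longrightarrow> d \<le> \<bar>x - y\<bar>"
  shows "real (card S) \<le> 1 + 2 * A / d"
proof -
  define f where "f x = \<lfloor>(x + A) / d\<rfloor>" for x
  have "inj_on f S"
  proof (rule inj_onI, rule ccontr)
    fix x y assume xy: "x \<in> S" "y \<in> S" "f x = f y" "x \<noteq> y"
    have "\<bar>(x + A) / d - (y + A) / d\<bar> < 1"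
      using xy(3) unfolding f_def by linarith
    moreover have "(x + A) / d - (y + A) / d = (x - y) / d"
      by (simp add: diff_divide_distrib[symmetric])
    ultimately have "\<bar>x - y\<bar> < d"
      using \<open>0 < d\<close> by (simp add: abs_divide)
    with sep[OF xy(1,2,4)] show False by simp
  qed
  moreover have "f ` S \<subseteq> {0..\<lfloor>2 * A / d\<rfloor>}"
  proof
    fix z assume "z \<in> f ` S"
    then obtain x where x: "x \<in> S" "z = f x" by auto
    with assms(4)[OF x(1)] have "0 \<le> x + A" "x + A \<le> 2 * A" by auto
    hence "0 \<le> (x + A) / d" "(x + A) / d \<le> 2 * A / d"
      using \<open>0 < d\<close> by (auto intro: divide_right_mono)
    thus "z \<in> {0..\<lfloor>2 * A / d\<rfloor>}"
      unfolding x f_def by (auto intro: floor_mono)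
  qed
  ultimately have "card S \<le> card {0..\<lfloor>2 * A / d\<rfloor>}"
    by (intro card_inj_on_le) auto
  moreover have "0 \<le> \<lfloor>2 * A / d\<rfloor>" using assms by simp
  ultimately have "real (card S) \<le> real_of_int (\<lfloor>2 * A / d\<rfloor> + 1)"
    by (simp add: le_nat_iff nat_le_eq_zle)
  also have "\<dots> \<le> 1 + 2 * A / d" by linarith
  finally show ?thesis .
qed

text \<open>Here \<open>\<tau>\<close> labels parallel lines and \<open>\<sigma>\<close> is a
  position along a line, so the bound is the number of labels times the number of positions on one
  line.\<close>

lemma card_le_separated_lines:
  fixes \<tau> \<sigma> :: "'a \<Rightarrow> real"
  assumes "finite G" "0 < d" "0 < d'" "0 \<le> A" "0 \<le> A'"
    and "\<And>w. w \<in> G \<Longrightarrow> \<bar>\<tau> w\<bar> \<le> A" "\<And>w. w \<in> G \<Longrightarrow> \<bar>\<sigma> w\<bar> \<le> A'"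
    and "\<And>w w'. w \<in> G \<Longrightarrow> w' \<in> G \<Longrightarrow> \<tau> w \<noteq> \<tau> w' \<Longrightarrow> d \<le> \<bar>\<tau> w - \<tau> w'\<bar>"
    and "\<And>w w'. w \<in> G \<Longrightarrow> w' \<in> G \<Longrightarrow> \<tau> w = \<tau> w' \<Longrightarrow> w \<noteq> w' \<Longrightarrow> d' \<le> \<bar>\<sigma> w - \<sigma> w'\<bar>"
  shows "real (card G) \<le> (1 + 2 * A / d) * (1 + 2 * A' / d')"
proof -
  define n where "n = nat \<lfloor>1 + 2 * A' / d'\<rfloor>"
  have fib: "card {w \<in> G. \<tau> w = y} \<le> n" for y
  proof -
    let ?F = "{w \<in> G. \<tau> w = y}"
    have "inj_on \<sigma> ?F"
    proof (rule inj_onI, rule ccontr)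
      fix w w' assume "w \<in> ?F" "w' \<in> ?F" "\<sigma> w = \<sigma> w'" "w \<noteq> w'"
      with assms(9)[of w w'] \<open>0 < d'\<close> show False by simp
    qed
    hence "real (card ?F) = real (card (\<sigma> ` ?F))" by (simp add: card_image)
    also have "\<dots> \<le> 1 + 2 * A' / d'"
      using assms by (intro card_separated_le) (auto, metis)
    finally show ?thesis unfolding n_def by linarith
  qed
  have "real (card G) \<le> real (card (\<tau> ` G)) * real n"
    using card_le_image_times_fiber[OF \<open>finite G\<close>, of \<tau> n] fib
    by (metis of_nat_le_iff of_nat_mult)
  also have "\<dots> \<le> (1 + 2 * A / d) * (1 + 2 * A' / d')"
  proof (intro mult_mono)
    show "real (card (\<tau> ` G)) \<le> 1 + 2 * A / d"
      using assms by (intro card_separated_le) auto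
    have "0 \<le> 1 + 2 * A' / d'" using assms by simp
    thus "real n \<le> 1 + 2 * A' / d'" unfolding n_def by linarith
  qed (use assms in auto)
  finally show ?thesis .
qed

text \<open>Collisions are counted by the sum of the squared fibre sizes; Cauchy--Schwarz compares
  it with the square of the sum of the fibre sizes.\<close>

lemma card_squared_le_collisions:
  assumes "finite A"
  shows "card A ^ 2 \<le> card (f ` A) * card {(x, y) \<in> A \<times> A. f x = f y}"
proof -
  let ?c = "\<lambda>z. card {x \<in> A. f x = z}"
  have 1: "card A = (\<Sum>z\<in>f ` A. ?c z)"
    using assms sum.image_gen[of A "\<lambda>_. 1::nat" f] by simp
  have "{(x, y) \<in> A \<times> A. f x = f y} = (\<Union>z\<in>f ` A. {x \<in> A. f x = z} \<times> {x \<in> A. f x = z})"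
    by auto
  also have "card \<dots> = (\<Sum>z\<in>f ` A. ?c z * ?c z)"
    using assms by (subst card_UN_disjoint) (auto simp: card_cartesian_product)
  finally have 2: "card {(x, y) \<in> A \<times> A. f x = f y} = (\<Sum>z\<in>f ` A. (?c z)\<^sup>2)"
    by (simp add: power2_eq_square)
  have "(\<Sum>z\<in>f ` A. real (?c z))\<^sup>2 \<le> (\<Sum>z\<in>f ` A. (real (?c z))\<^sup>2) * real (card (f ` A))"
    by (rule sum_squared_le_sum_of_squares)
  hence "real ((\<Sum>z\<in>f ` A. ?c z)\<^sup>2) \<le> real (card (f ` A) * (\<Sum>z\<in>f ` A. (?c z)\<^sup>2))"
    by (simp add: mult.commute)
  thus ?thesis unfolding 1[symmetric] 2[symmetric] of_nat_le_iff .
qed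

text \<open>Only the primes below \<open>2 powr (1 / \<delta>)\<close> cost more than \<open>q powr (a * \<delta>)\<close>, each of them
  at most a factor \<open>K\<close>.\<close>

lemma divisor_bound_nat:
  fixes \<delta> :: real
  assumes "0 < \<delta>"
  obtains C where "0 < C" "\<And>n::nat. 0 < n \<Longrightarrow> real (card {d. d dvd n}) \<le> C * real n powr \<delta>"
proof -
  \<comment> \<open>From \<open>Q\<close> on a prime satisfies
    \<open>q powr \<delta> \<ge> 2\<close>, so its own power already pays for
    \<open>a + 1 \<le> 2 ^ a\<close>.\<close>
  define Q where "Q = nat \<lceil>2 powr (1 / \<delta>)\<rceil>"
  \<comment> \<open>Chosen so that \<open>a + 1 \<le> K * (1 + a * (\<delta> * ln 2))\<close>; by
    Bernoulli the bracket is at most \<open>(q powr \<delta>) ^ a\<close>.\<close>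
  define K where "K = 1 + 1 / (\<delta> * ln 2)"
  have K1: "1 \<le> K" using assms by (simp add: K_def)
  define small where "small n = {q. prime q \<and> q < Q \<and> q dvd n}" for n :: nat
  have fin: "finite (small n)" for n unfolding small_def by simp
  have main: "0 < n \<Longrightarrow> real (card {d. d dvd n}) \<le> K ^ card (small n) * real n powr \<delta>" for n :: nat
  proof (induction n rule: less_induct)
    case (less n)
    show ?case
    proof (cases "n = 1")
      case True
      have "{d::nat. d dvd 1} = {1}" by auto
      thus ?thesis using True K1 by (simp add: one_le_power)
    next
      case False
      then obtain q where q: "prime q" "q dvd n" using prime_factor_nat by blast
      \<comment> \<open>The full power of \<open>q\<close> is split off, so \<open>q\<close> does
        not divide \<open>m\<close> and costs the factor \<open>K\<close> only once.\<close>
      define a where "a = multiplicity q n"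
      obtain m where m: "n = q ^ a * m" "\<not> q dvd m"
        using less.prems q multiplicity_decompose'[of n q]
        unfolding a_def by (metis not_prime_unit not_gr_zero)
      have a: "0 < a" using q less.prems unfolding a_def
        by (simp add: prime_multiplicity_gt_zero_iff)
      have m0: "0 < m" using less.prems m by (auto intro: gr0I)
      have q2: "2 \<le> q" using q prime_ge_2_nat by blast
      have "1 < q ^ a" using q2 a by (intro one_less_power) auto
      hence mn: "m < n" using m m0 by simp
      have "card {d. d dvd n} \<le> card ({0..a} \<times> {d. d dvd m})"
      proof -
        have "{d. d dvd n} \<subseteq> (\<lambda>(i, d). q ^ i * d) ` ({0..a} \<times> {d. d dvd m})"
        proof
          fix d assume "d \<in> {d. d dvd n}"
          hence "d dvd q ^ a * m" using m by simp
          then obtain b c where bc: "d = b * c" "b dvd q ^ a" "c dvd m"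
            using division_decomp by blast
          from bc(2) obtain i where "i \<le> a" "b = q ^ i"
            using q by (auto simp: divides_primepow_nat)
          with bc show "d \<in> (\<lambda>(i, d). q ^ i * d) ` ({0..a} \<times> {d. d dvd m})" by force
        qed
        moreover have "finite {d. d dvd m}" using m0 by simp
        ultimately show ?thesis
          by (meson card_image_le card_mono finite_SigmaI finite_atLeastAtMost finite_imageI le_trans)
      qed
      hence "real (card {d. d dvd n}) \<le> (real a + 1) * real (card {d. d dvd m})"
        by (simp add: card_cartesian_product flip: of_nat_mult of_nat_Suc add: add.commute)
      also have "\<dots> \<le> (real a + 1) * (K ^ card (small m) * real m powr \<delta>)"
        using less.IH[OF mn m0] by (intro mult_left_mono) auto
      also have "\<dots> \<le> K ^ card (small n) * real n powr \<delta>"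
      proof -
        have np: "real n powr \<delta> = (real q powr \<delta>) ^ a * real m powr \<delta>"
          using q2 m0 by (simp add: m powr_mult powr_power mult.commute flip: powr_realpow)
             (simp add: powr_powr mult.commute)
        have sub: "small m \<subseteq> small n" unfolding small_def m by auto
        show ?thesis
        proof (cases "q < Q")
          case True
          have "q \<in> small n" "q \<notin> small m" using True q m unfolding small_def by auto
          hence "Suc (card (small m)) \<le> card (small n)"
            using psubset_card_mono[OF fin, of "small m" n] sub by (metis Suc_leI psubsetI)
          hence "K ^ Suc (card (small m)) \<le> K ^ card (small n)"
            using K1 by (rule power_increasing)
          moreover have "real a + 1 \<le> K * (real q powr \<delta>) ^ a"
          proof -
            have "1 + real a * (\<delta> * ln 2) \<le> (1 + \<delta> * ln 2) ^ a"
            proof (rule Bernoulli_inequality)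
              have "0 < \<delta> * ln 2" using assms by simp
              thus "- 1 \<le> \<delta> * ln 2" by linarith
            qed
            also have "\<dots> \<le> (real q powr \<delta>) ^ a"
            proof (intro power_mono)
              have "1 + \<delta> * ln 2 \<le> exp (\<delta> * ln 2)" by (rule exp_ge_add_one_self)
              also have "\<dots> = 2 powr \<delta>" by (simp add: powr_def)
              also have "\<dots> \<le> real q powr \<delta>" using q2 assms by (intro powr_mono2) auto
              finally show "1 + \<delta> * ln 2 \<le> real q powr \<delta>" .
            qed (use assms in auto)
            finally have B: "1 + real a * (\<delta> * ln 2) \<le> (real q powr \<delta>) ^ a" .
            have "real a + 1 \<le> K * (1 + real a * (\<delta> * ln 2))"
              using assms unfolding K_def by (simp add: field_simps)
            also have "\<dots> \<le> K * (real q powr \<delta>) ^ a"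
              using B K1 by (intro mult_left_mono) auto
            finally show ?thesis .
          qed
          ultimately have "(real a + 1) * K ^ card (small m) \<le> (K * (real q powr \<delta>) ^ a) * K ^ card (small m)"
            using K1 by (intro mult_right_mono) auto
          also have "\<dots> = K ^ Suc (card (small m)) * (real q powr \<delta>) ^ a" by simp
          also have "\<dots> \<le> K ^ card (small n) * (real q powr \<delta>) ^ a"
            using \<open>K ^ Suc (card (small m)) \<le> K ^ card (small n)\<close> by (intro mult_right_mono) auto
          finally have "(real a + 1) * K ^ card (small m) * real m powr \<delta>
              \<le> K ^ card (small n) * (real q powr \<delta>) ^ a * real m powr \<delta>"
            by (intro mult_right_mono) auto
          thus ?thesis unfolding np by (simp add: mult_ac)
        next
          case False
          have "2 powr (1 / \<delta>) \<le> real q" using False unfolding Q_def by linarith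
          hence "(2 powr (1 / \<delta>)) powr \<delta> \<le> real q powr \<delta>"
            using assms by (intro powr_mono2) auto
          hence "2 \<le> real q powr \<delta>" using assms by (simp add: powr_powr)
          hence "2 ^ a \<le> (real q powr \<delta>) ^ a" by (intro power_mono) auto
          moreover have "real a + 1 \<le> 2 ^ a"
            using Bernoulli_inequality[of "1::real" a] by (simp add: add.commute)
          ultimately have "real a + 1 \<le> (real q powr \<delta>) ^ a" by linarith
          moreover have "K ^ card (small m) \<le> K ^ card (small n)"
            using K1 card_mono[OF fin sub] by (intro power_increasing) auto
          ultimately have "(real a + 1) * K ^ card (small m) \<le> (real q powr \<delta>) ^ a * K ^ card (small n)"
            using K1 by (intro mult_mono) auto
          hence "(real a + 1) * K ^ card (small m) * real m powr \<delta>
              \<le> (real q powr \<delta>) ^ a * K ^ card (small n) * real m powr \<delta>"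
            by (intro mult_right_mono) auto
          thus ?thesis unfolding np by (simp add: mult_ac)
        qed
      qed
      finally show ?thesis .
    qed
  qed
  show ?thesis
  proof (rule that[of "K ^ Q"])
    show "0 < K ^ Q" using K1 by simp
    fix n :: nat assume n: "0 < n"
    have "card (small n) \<le> card {..<Q}" unfolding small_def by (intro card_mono) auto
    hence "K ^ card (small n) \<le> K ^ Q" using K1 by (intro power_increasing) auto
    hence "K ^ card (small n) * real n powr \<delta> \<le> K ^ Q * real n powr \<delta>"
      by (intro mult_right_mono) auto
    with main[OF n] show "real (card {d. d dvd n}) \<le> K ^ Q * real n powr \<delta>" by linarith
  qed
qed

lemma divisor_bound_int:
  fixes \<delta> :: real
  assumes "0 < \<delta>"
  obtains C where "0 < C"
    "\<And>n::int. n \<noteq> 0 \<Longrightarrow> real (card {d. d dvd n}) \<le> C * \<bar>real_of_int n\<bar> powr \<delta>"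
proof -
  obtain C where C: "0 < C" "\<And>n::nat. 0 < n \<Longrightarrow> real (card {d. d dvd n}) \<le> C * real n powr \<delta>"
    using divisor_bound_nat[OF assms] by metis
  show ?thesis
  proof (rule that[of "2 * C"])
    show "0 < 2 * C" using C by simp
    fix n :: int assume n: "n \<noteq> 0"
    let ?N = "{d. d dvd nat \<bar>n\<bar>}"
    have fin: "finite ?N" using n by (intro finite_divisors_nat) simp
    have "{d. d dvd n} \<subseteq> int ` ?N \<union> (\<lambda>d. - int d) ` ?N"
    proof
      fix d assume d: "d \<in> {d. d dvd n}"
      hence m: "nat \<bar>d\<bar> \<in> ?N" by (simp add: nat_dvd_iff)
      show "d \<in> int ` ?N \<union> (\<lambda>d. - int d) ` ?N"
      proof (cases "0 \<le> d")
        case True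
        hence "d = int (nat \<bar>d\<bar>)" by simp
        thus ?thesis using m by blast
      next
        case False
        hence "d = - int (nat \<bar>d\<bar>)" by simp
        thus ?thesis using m by blast
      qed
    qed
    hence "card {d. d dvd n} \<le> card (int ` ?N \<union> (\<lambda>d. - int d) ` ?N)"
      using fin by (intro card_mono) auto
    also have "\<dots> \<le> card (int ` ?N) + card ((\<lambda>d. - int d) ` ?N)" by (rule card_Un_le)
    also have "\<dots> \<le> card ?N + card ?N" using fin by (intro add_mono card_image_le)
    finally have "real (card {d. d dvd n}) \<le> 2 * real (card ?N)" by simp
    also have "\<dots> \<le> 2 * (C * real (nat \<bar>n\<bar>) powr \<delta>)" using C(2)[of "nat \<bar>n\<bar>"] n by simp
    finally show "real (card {d. d dvd n}) \<le> 2 * C * \<bar>real_of_int n\<bar> powr \<delta>" by simp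
  qed
qed

subsection \<open>Lattice points in boxes\<close>

text \<open>The coordinates of parallel vectors are in a fixed ratio. Hence a vector that is shorter
  than a parallel one in one coordinate is shorter in every coordinate, except where both
  vanish.\<close>

lemma abs_parallel_less:
  fixes x x' y y' :: int
  assumes "y' * x = x' * y" "\<bar>x'\<bar> < \<bar>y'\<bar>"
  shows "x = 0 \<and> y = 0 \<or> \<bar>x\<bar> < \<bar>y\<bar>"
proof (cases "y = 0")
  case True
  thus ?thesis using assms by auto
next
  case False
  have "\<bar>y'\<bar> * \<bar>x\<bar> = \<bar>x'\<bar> * \<bar>y\<bar>" using assms(1) by (metis abs_mult)
  also have "\<dots> < \<bar>y'\<bar> * \<bar>y\<bar>" using assms(2) False by (intro mult_strict_right_mono) auto
  finally have "\<bar>y'\<bar> * \<bar>x\<bar> < \<bar>y'\<bar> * \<bar>y\<bar>" .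
  moreover have "0 < \<bar>y'\<bar>" using assms(2) by linarith
  ultimately show ?thesis by (metis mult_less_cancel_left_pos)
qed

text \<open>The count is stated for every labelling \<open>\<tau>\<close> of the lines parallel to
  \<open>v\<close>, so that each application can choose its own. The bound is free of
  \<open>\<mu>\<close>: about \<open>\<mu> * A / d\<close> lines carry about
  \<open>1 / \<mu>\<close> points each. The last premise demands at least two lines.\<close>

definition lines_bound :: "(int \<times> int \<times> int) set \<Rightarrow> int \<Rightarrow> int \<Rightarrow> int \<Rightarrow> real \<Rightarrow> bool" where
  "lines_bound G v1 v2 v3 \<mu> \<longleftrightarrow> (\<forall>(\<tau> :: int \<times> int \<times> int \<Rightarrow> real) A d.
     0 \<le> A \<longrightarrow> 0 < d \<longrightarrow> (\<forall>w\<in>G. \<bar>\<tau> w\<bar> \<le> \<mu> * A) \<longrightarrow>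
     (\<forall>w\<in>G. \<forall>w'\<in>G. \<tau> w \<noteq> \<tau> w' \<longrightarrow> d \<le> \<bar>\<tau> w - \<tau> w'\<bar>) \<longrightarrow>
     (\<forall>a b c a' b' c'. (a, b, c) \<in> G \<longrightarrow> (a', b', c') \<in> G \<longrightarrow> \<tau> (a, b, c) = \<tau> (a', b', c') \<longrightarrow>
        v1 * (b - b') = (a - a') * v2 \<and> v1 * (c - c') = (a - a') * v3 \<and> v2 * (c - c') = (b - b') * v3) \<longrightarrow>
     (\<exists>w\<in>G. \<exists>w'\<in>G. \<tau> w \<noteq> \<tau> w') \<longrightarrow> real (card G) \<le> 12 * A / d)"

lemma lines_boundD:
  fixes \<tau> :: "int \<times> int \<times> int \<Rightarrow> real"
  assumes "lines_bound G v1 v2 v3 \<mu>" "0 \<le> A" "0 < d"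
    "\<And>w. w \<in> G \<Longrightarrow> \<bar>\<tau> w\<bar> \<le> \<mu> * A"
    "\<And>w w'. w \<in> G \<Longrightarrow> w' \<in> G \<Longrightarrow> \<tau> w \<noteq> \<tau> w' \<Longrightarrow> d \<le> \<bar>\<tau> w - \<tau> w'\<bar>"
    "\<And>a b c a' b' c'. (a, b, c) \<in> G \<Longrightarrow> (a', b', c') \<in> G \<Longrightarrow> \<tau> (a, b, c) = \<tau> (a', b', c') \<Longrightarrow>
       v1 * (b - b') = (a - a') * v2 \<and> v1 * (c - c') = (a - a') * v3 \<and> v2 * (c - c') = (b - b') * v3"
    "\<exists>w\<in>G. \<exists>w'\<in>G. \<tau> w \<noteq> \<tau> w'"
  shows "real (card G) \<le> 12 * A / d"
  using assms(1)[unfolded lines_bound_def, rule_format, of A d \<tau>] assms(2-) by blast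

text \<open>The lattice points in a box lie on lines parallel to a shortest vector \<open>v\<close> (measured by the
  gauge of the box). If \<open>v\<close> has gauge \<open>\<mu>\<close>, each line carries at most \<open>1 + 2 / \<mu>\<close> points, and
  \<open>\<tau>\<close> tells the lines apart.\<close>

lemma shortest_vector_count:
  fixes L :: "(int \<times> int \<times> int) set" and \<alpha> \<beta> \<gamma> :: int
  defines "G \<equiv> {(a, b, c) \<in> L. \<bar>a\<bar> \<le> \<alpha> \<and> \<bar>b\<bar> \<le> \<beta> \<and> \<bar>c\<bar> \<le> \<gamma>}"
  assumes pos: "0 < \<alpha>" "0 < \<beta>" "0 < \<gamma>"
    and diff: "\<forall>a b c a' b' c'. (a, b, c) \<in> L \<longrightarrow> (a', b', c') \<in> L \<longrightarrow> (a - a', b - b', c - c') \<in> L"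
    and nz: "G - {(0, 0, 0)} \<noteq> {}"
  obtains v1 v2 v3 :: int and \<mu> :: real where "(v1, v2, v3) \<in> G" "(v1, v2, v3) \<noteq> (0, 0, 0)" "0 < \<mu>" "\<mu> \<le> 1"
    "\<bar>real_of_int v1\<bar> \<le> \<mu> * \<alpha>" "\<bar>real_of_int v2\<bar> \<le> \<mu> * \<beta>" "\<bar>real_of_int v3\<bar> \<le> \<mu> * \<gamma>"
    "lines_bound G v1 v2 v3 \<mu>"
proof -
  have "G \<subseteq> {-\<alpha>..\<alpha>} \<times> {-\<beta>..\<beta>} \<times> {-\<gamma>..\<gamma>}" unfolding G_def by auto
  hence fin: "finite G" by (rule finite_subset) auto
  \<comment> \<open>The gauge of the box: its unit ball is the box itself.\<close>
  define g where "g w = (case w of (a, b, c) \<Rightarrow>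
    max (\<bar>real_of_int a\<bar> / \<alpha>) (max (\<bar>real_of_int b\<bar> / \<beta>) (\<bar>real_of_int c\<bar> / \<gamma>)))" for w
  obtain v where "is_arg_min g (\<lambda>x. x \<in> G - {(0, 0, 0)}) v"
    using ex_is_arg_min_if_finite[of "G - {(0, 0, 0)}" g] fin nz by auto
  hence v: "v \<in> G" "v \<noteq> (0, 0, 0)" and min: "\<And>w. w \<in> G \<Longrightarrow> w \<noteq> (0, 0, 0) \<Longrightarrow> g v \<le> g w"
    unfolding is_arg_min_linorder by auto
  obtain v1 v2 v3 where v_eq: "v = (v1, v2, v3)" by (cases v)
  define \<mu> where "\<mu> = g v"
  have vL: "(v1, v2, v3) \<in> L" and vb: "\<bar>v1\<bar> \<le> \<alpha>" "\<bar>v2\<bar> \<le> \<beta>" "\<bar>v3\<bar> \<le> \<gamma>"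
    using v(1) unfolding v_eq G_def by auto
  have "\<bar>real_of_int v1\<bar> \<le> real_of_int \<alpha>" "\<bar>real_of_int v2\<bar> \<le> real_of_int \<beta>"
    "\<bar>real_of_int v3\<bar> \<le> real_of_int \<gamma>"
    using vb by linarith+
  hence l1: "\<mu> \<le> 1" unfolding \<mu>_def g_def v_eq using pos by simp
  have l0: "0 < \<mu>" unfolding \<mu>_def g_def v_eq using pos v(2) v_eq
    by (auto simp: less_max_iff_disj)
  have bnd: "\<bar>real_of_int v1\<bar> \<le> \<mu> * \<alpha>" "\<bar>real_of_int v2\<bar> \<le> \<mu> * \<beta>" "\<bar>real_of_int v3\<bar> \<le> \<mu> * \<gamma>"
    unfolding \<mu>_def g_def v_eq using pos by (auto simp flip: pos_divide_le_eq)
  have small: "\<bar>real_of_int t\<bar> / \<eta> < \<mu>"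
    if "t = 0 \<and> u = 0 \<or> \<bar>t\<bar> < \<bar>u\<bar>" "\<bar>real_of_int u\<bar> \<le> \<mu> * \<eta>" "0 < \<eta>" for t u \<eta> :: int
  proof -
    have "0 < \<mu> * \<eta>" using l0 that by simp
    moreover have "t = 0 \<or> \<bar>real_of_int t\<bar> < \<bar>real_of_int u\<bar>" using that(1) by linarith
    ultimately have "\<bar>real_of_int t\<bar> < \<mu> * \<eta>" using that(2) by auto
    thus ?thesis using that(3) by (simp add: pos_divide_less_eq)
  qed
  \<comment> \<open>The position along a line is read off in a coordinate where \<open>v\<close>
    attains its gauge.\<close>
  define \<sigma> where "\<sigma> w = (case w of (a, b, c) \<Rightarrow>
     if \<bar>real_of_int v1\<bar> / \<alpha> = \<mu> then real_of_int a / \<alpha> else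
     if \<bar>real_of_int v2\<bar> / \<beta> = \<mu> then real_of_int b / \<beta> else real_of_int c / \<gamma>)" for w
  have \<sigma>1: "\<bar>\<sigma> w\<bar> \<le> 1" if "w \<in> G" for w
    using that pos unfolding G_def \<sigma>_def by (auto simp: abs_divide)
  have spacing: "\<mu> \<le> \<bar>\<sigma> (a, b, c) - \<sigma> (a', b', c')\<bar>"
    if G: "(a, b, c) \<in> G" "(a', b', c') \<in> G" "(a, b, c) \<noteq> (a', b', c')"
      and par: "v1 * (b - b') = (a - a') * v2" "v1 * (c - c') = (a - a') * v3"
        "v2 * (c - c') = (b - b') * v3" for a b c a' b' c'
  proof -
    define x y z where xyz: "x = a - a'" "y = b - b'" "z = c - c'"
    have L: "(x, y, z) \<in> L" "(x, y, z) \<noteq> (0, 0, 0)"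
      using G diff unfolding xyz G_def by auto
    \<comment> \<open>Otherwise the difference of the two points would be a nonzero lattice vector
      of smaller gauge than \<open>v\<close>.\<close>
    have notless: False if less: "x = 0 \<and> v1 = 0 \<or> \<bar>x\<bar> < \<bar>v1\<bar>" "y = 0 \<and> v2 = 0 \<or> \<bar>y\<bar> < \<bar>v2\<bar>"
      "z = 0 \<and> v3 = 0 \<or> \<bar>z\<bar> < \<bar>v3\<bar>"
    proof -
      have "(x, y, z) \<in> G" using L less vb unfolding G_def by auto
      hence "\<mu> \<le> g (x, y, z)" unfolding \<mu>_def using min L by blast
      moreover have "\<bar>real_of_int x\<bar> / \<alpha> < \<mu>" "\<bar>real_of_int y\<bar> / \<beta> < \<mu>" "\<bar>real_of_int z\<bar> / \<gamma> < \<mu>"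
        using small less bnd pos by blast+
      ultimately show False unfolding g_def by auto
    qed
    have attained: "\<bar>real_of_int v1\<bar> / \<alpha> = \<mu> \<or> \<bar>real_of_int v2\<bar> / \<beta> = \<mu> \<or> \<bar>real_of_int v3\<bar> / \<gamma> = \<mu>"
      unfolding \<mu>_def g_def v_eq by (simp add: max_def)
    show ?thesis
    proof (cases "\<bar>real_of_int v1\<bar> / \<alpha> = \<mu>")
      case True
      have "\<bar>v1\<bar> \<le> \<bar>x\<bar>"
      proof (rule ccontr)
        assume *: "\<not> \<bar>v1\<bar> \<le> \<bar>x\<bar>"
        show False using notless abs_parallel_less[of v1 y x v2] abs_parallel_less[of v1 z x v3] par *
          unfolding xyz by auto
      qed
      hence "\<bar>real_of_int v1\<bar> \<le> \<bar>real_of_int x\<bar>" by linarith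
      hence "\<bar>real_of_int v1\<bar> / \<alpha> \<le> \<bar>real_of_int x\<bar> / \<alpha>" using pos by (intro divide_right_mono) auto
      also have "\<dots> = \<bar>\<sigma> (a, b, c) - \<sigma> (a', b', c')\<bar>"
        using True pos unfolding \<sigma>_def xyz by (simp add: abs_divide flip: diff_divide_distrib)
      finally show ?thesis using True by simp
    next
      case F1: False
      show ?thesis
      proof (cases "\<bar>real_of_int v2\<bar> / \<beta> = \<mu>")
        case True
        have "\<bar>v2\<bar> \<le> \<bar>y\<bar>"
        proof (rule ccontr)
          assume *: "\<not> \<bar>v2\<bar> \<le> \<bar>y\<bar>"
          show False using notless abs_parallel_less[of v2 x y v1] abs_parallel_less[of v2 z y v3] par *
            unfolding xyz by (auto simp: mult.commute)
        qed
        hence "\<bar>real_of_int v2\<bar> \<le> \<bar>real_of_int y\<bar>" by linarith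
        hence "\<bar>real_of_int v2\<bar> / \<beta> \<le> \<bar>real_of_int y\<bar> / \<beta>" using pos by (intro divide_right_mono) auto
        also have "\<dots> = \<bar>\<sigma> (a, b, c) - \<sigma> (a', b', c')\<bar>"
          using True F1 pos unfolding \<sigma>_def xyz by (simp add: abs_divide flip: diff_divide_distrib)
        finally show ?thesis using True by simp
      next
        case F2: False
        hence True: "\<bar>real_of_int v3\<bar> / \<gamma> = \<mu>" using attained F1 by blast
        have "\<bar>v3\<bar> \<le> \<bar>z\<bar>"
        proof (rule ccontr)
          assume *: "\<not> \<bar>v3\<bar> \<le> \<bar>z\<bar>"
          show False using notless abs_parallel_less[of v3 x z v1] abs_parallel_less[of v3 y z v2] par *
            unfolding xyz by (auto simp: mult.commute)
        qed
        hence "\<bar>real_of_int v3\<bar> \<le> \<bar>real_of_int z\<bar>" by linarith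
        hence "\<bar>real_of_int v3\<bar> / \<gamma> \<le> \<bar>real_of_int z\<bar> / \<gamma>" using pos by (intro divide_right_mono) auto
        also have "\<dots> = \<bar>\<sigma> (a, b, c) - \<sigma> (a', b', c')\<bar>"
          using F2 F1 pos unfolding \<sigma>_def xyz by (simp add: abs_divide flip: diff_divide_distrib)
        finally show ?thesis using True by simp
      qed
    qed
  qed
  have count: "real (card G) \<le> 12 * A / d"
    if A: "0 \<le> A" "0 < d" "\<And>w. w \<in> G \<Longrightarrow> \<bar>\<tau> w\<bar> \<le> \<mu> * A"
      and sep: "\<And>w w'. w \<in> G \<Longrightarrow> w' \<in> G \<Longrightarrow> \<tau> w \<noteq> \<tau> w' \<Longrightarrow> d \<le> \<bar>\<tau> w - \<tau> w'\<bar>"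
      and par: "\<And>a b c a' b' c'. (a, b, c) \<in> G \<Longrightarrow> (a', b', c') \<in> G \<Longrightarrow> \<tau> (a, b, c) = \<tau> (a', b', c') \<Longrightarrow>
         v1 * (b - b') = (a - a') * v2 \<and> v1 * (c - c') = (a - a') * v3 \<and> v2 * (c - c') = (b - b') * v3"
      and two: "\<exists>w\<in>G. \<exists>w'\<in>G. \<tau> w \<noteq> \<tau> w'" for \<tau> A d
  proof -
    have "real (card G) \<le> (1 + 2 * (\<mu> * A) / d) * (1 + 2 * 1 / \<mu>)"
    proof (rule card_le_separated_lines[where \<tau> = \<tau> and \<sigma> = \<sigma>])
      fix w w' assume w: "w \<in> G" "w' \<in> G" "\<tau> w = \<tau> w'" "w \<noteq> w'"
      obtain a b c a' b' c' where "w = (a, b, c)" "w' = (a', b', c')" by (cases w, cases w') blast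
      thus "\<mu> \<le> \<bar>\<sigma> w - \<sigma> w'\<bar>" using spacing par w by metis
    qed (use fin A sep l0 \<sigma>1 in auto)
    also have "\<dots> \<le> (4 * (\<mu> * A) / d) * (3 / \<mu>)"
    proof (intro mult_mono)
      \<comment> \<open>Two different labels force \<open>d \<le> 2 * (\<mu> * A)\<close>, which
        absorbs the summand 1; afterwards \<open>\<mu>\<close> cancels in the product.\<close>
      obtain w w' where w: "w \<in> G" "w' \<in> G" "\<tau> w \<noteq> \<tau> w'" using two by blast
      have "d \<le> 2 * (\<mu> * A)" using sep[OF w] A(3)[OF w(1)] A(3)[OF w(2)] by linarith
      hence "1 \<le> 2 * (\<mu> * A) / d" using A(2) by simp
      thus "1 + 2 * (\<mu> * A) / d \<le> 4 * (\<mu> * A) / d" using A(2) by (simp add: field_simps)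
      show "1 + 2 * 1 / \<mu> \<le> 3 / \<mu>" using l0 l1 by (simp add: field_simps)
    qed (use A l0 in auto)
    also have "\<dots> = 12 * A / d" using l0 by simp
    finally show ?thesis .
  qed
  have "lines_bound G v1 v2 v3 \<mu>"
    unfolding lines_bound_def by (intro allI impI, rule count) blast+
  with v l0 l1 bnd show ?thesis
    unfolding v_eq by (intro that[of v1 v2 v3 \<mu>])
qed

text \<open>Determinants of two lattice points are multiples of \<open>p\<close>, so the determinant
  against the shortest vector separates the lines by \<open>p\<close>. The planar lattice is
  embedded with third coordinate zero, and the two independent points guarantee a second
  line.\<close>

lemma lattice_points_count_2d:
  fixes p s \<alpha> \<beta> :: int
  defines "G \<equiv> {(a, b). \<bar>a\<bar> \<le> \<alpha> \<and> \<bar>b\<bar> \<le> \<beta> \<and> p dvd a + b * s}"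
  assumes pos: "0 < p" "0 < \<alpha>" "0 < \<beta>"
    and ind: "(a1, b1) \<in> G" "(a2, b2) \<in> G" "a1 * b2 \<noteq> a2 * b1"
  shows "real (card G) \<le> 24 * \<alpha> * \<beta> / p"
proof -
  define L :: "(int \<times> int \<times> int) set" where "L = {(a, b, c). c = 0 \<and> p dvd a + b * s}"
  define G' where "G' = {(a, b, c) \<in> L. \<bar>a\<bar> \<le> \<alpha> \<and> \<bar>b\<bar> \<le> \<beta> \<and> \<bar>c\<bar> \<le> 1}"
  have G': "G' = (\<lambda>(a, b). (a, b, 0)) ` G" unfolding G'_def G_def L_def by auto
  have card: "card G' = card G" unfolding G' by (intro card_image) (auto simp: inj_on_def)
  have diff: "\<forall>a b c a' b' c'. (a, b, c) \<in> L \<longrightarrow> (a', b', c') \<in> L \<longrightarrow> (a - a', b - b', c - c') \<in> L"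
  proof (intro allI impI)
    fix a b c a' b' c' assume "(a, b, c) \<in> L" "(a', b', c') \<in> L"
    thus "(a - a', b - b', c - c') \<in> L"
      using dvd_diff[of p "a + b * s" "a' + b' * s"] unfolding L_def by (simp add: algebra_simps)
  qed
  have "G' - {(0, 0, 0)} \<noteq> {}"
  proof
    assume "G' - {(0, 0, 0)} = {}"
    moreover have "(a1, b1, 0) \<in> G'" using ind(1) unfolding G' by auto
    ultimately show False using ind(3) ind(2) unfolding G' by auto
  qed
  then obtain v1 v2 v3 and \<mu> :: real where v: "(v1, v2, v3) \<in> G'" "(v1, v2, v3) \<noteq> (0, 0, 0)" and l: "0 < \<mu>" "\<mu> \<le> 1"
    and b: "\<bar>real_of_int v1\<bar> \<le> \<mu> * \<alpha>" "\<bar>real_of_int v2\<bar> \<le> \<mu> * \<beta>"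
      "\<bar>real_of_int v3\<bar> \<le> \<mu> * real_of_int 1"
    and count: "lines_bound G' v1 v2 v3 \<mu>"
    by (rule shortest_vector_count[of \<alpha> \<beta> 1 L, folded G'_def, OF pos(2,3) zero_less_one diff]) blast
  have v3: "v3 = 0" and vp: "p dvd v1 + v2 * s" using v(1) unfolding G'_def L_def by auto
  define t where "t w = (case w of (a, b, c) \<Rightarrow> v1 * b - a * v2)" for w :: "int \<times> int \<times> int"
  have "real (card G') \<le> 12 * real_of_int (2 * \<alpha> * \<beta>) / real_of_int p"
  proof (rule lines_boundD[OF count, where \<tau> = "\<lambda>w. real_of_int (t w)"])
    show "0 \<le> real_of_int (2 * \<alpha> * \<beta>)" using pos by simp
    show "0 < real_of_int p" using pos by simp
  next
    fix w assume "w \<in> G'"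
    then obtain x y z where w: "w = (x, y, z)" "\<bar>x\<bar> \<le> \<alpha>" "\<bar>y\<bar> \<le> \<beta>" unfolding G'_def by auto
    have "\<bar>real_of_int v1 * y\<bar> \<le> (\<mu> * \<alpha>) * \<beta>"
      unfolding abs_mult using b w l pos by (intro mult_mono) auto
    moreover have "\<bar>x * real_of_int v2\<bar> \<le> \<alpha> * (\<mu> * \<beta>)"
      unfolding abs_mult using b w l pos by (intro mult_mono) auto
    ultimately show "\<bar>real_of_int (t w)\<bar> \<le> \<mu> * real_of_int (2 * \<alpha> * \<beta>)"
      unfolding w t_def by (simp add: algebra_simps)
  next
    fix w w' assume "w \<in> G'" "w' \<in> G'" and ne: "real_of_int (t w) \<noteq> real_of_int (t w')"
    then obtain x y x' y' where w: "w = (x, y, 0)" "w' = (x', y', 0)" "p dvd x + y * s" "p dvd x' + y' * s"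
      unfolding G'_def L_def by auto
    have "p dvd (v1 + v2 * s) * (y - y') - ((x + y * s) - (x' + y' * s)) * v2"
      using vp w by (intro dvd_diff dvd_mult2)
    also have "\<dots> = t w - t w'" unfolding w t_def by (simp add: algebra_simps)
    finally have "\<bar>p\<bar> \<le> \<bar>t w - t w'\<bar>" using ne by (intro dvd_imp_le_int) auto
    thus "real_of_int p \<le> \<bar>real_of_int (t w) - real_of_int (t w')\<bar>" using pos by linarith
  next
    fix a b c a' b' c' assume "(a, b, c) \<in> G'" "(a', b', c') \<in> G'"
      and "real_of_int (t (a, b, c)) = real_of_int (t (a', b', c'))"
    moreover from this(3) have "t (a, b, c) = t (a', b', c')" by (simp only: of_int_eq_iff)
    ultimately show "v1 * (b - b') = (a - a') * v2 \<and> v1 * (c - c') = (a - a') * v3 \<and> v2 * (c - c') = (b - b') * v3"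
      unfolding t_def v3 G'_def L_def by (auto simp: algebra_simps)
  next
    have g: "(0, 0, 0) \<in> G'" "(a1, b1, 0) \<in> G'" "(a2, b2, 0) \<in> G'"
      using ind pos unfolding G'_def L_def G_def by auto
    have "t (a1, b1, 0) \<noteq> 0 \<or> t (a2, b2, 0) \<noteq> 0"
    proof (rule ccontr)
      assume "\<not> ?thesis"
      hence e: "v1 * b1 = a1 * v2" "v1 * b2 = a2 * v2" unfolding t_def by auto
      have "v1 * (a1 * b2 - a2 * b1) = 0" "v2 * (a1 * b2 - a2 * b1) = 0"
        using e by algebra+
      thus False using ind(3) v(2) v3 by auto
    qed
    moreover have "t (0, 0, 0) = 0" unfolding t_def by simp
    ultimately show "\<exists>w\<in>G'. \<exists>w'\<in>G'. real_of_int (t w) \<noteq> real_of_int (t w')" using g by (metis of_int_eq_iff)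
  qed
  thus ?thesis unfolding card by simp
qed

text \<open>Triples \<open>(a, b, c)\<close> encode polynomials \<open>a + b X + c X\<^sup>2\<close>.\<close>

lemma lattice_minors_cong:
  fixes p s :: int
  assumes "p dvd v1 + v2 * s + v3 * s\<^sup>2" "p dvd w1 + w2 * s + w3 * s\<^sup>2"
  shows "p dvd (v1 * w3 - w1 * v3) + (v2 * w3 - w2 * v3) * s"
    and "p dvd ((v1 * w2 - w1 * v2) + (v1 * w3 - w1 * v3) * s) * s"
    and "p dvd (v1 * w3 - w1 * v3)\<^sup>2 - (v1 * w2 - w1 * v2) * (v2 * w3 - w2 * v3)"
proof -
  let ?f = "v1 + v2 * s + v3 * s\<^sup>2" and ?h = "w1 + w2 * s + w3 * s\<^sup>2"
  \<comment> \<open>The multipliers used below eliminate in turn the quadratic, the constant and the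
    linear coefficient.\<close>
  have comb: "p dvd ?f * x - ?h * y" for x y using assms by (intro dvd_diff dvd_mult2)
  show 1: "p dvd (v1 * w3 - w1 * v3) + (v2 * w3 - w2 * v3) * s"
    using comb[of w3 v3] by (simp add: algebra_simps)
  show "p dvd ((v1 * w2 - w1 * v2) + (v1 * w3 - w1 * v3) * s) * s"
    using comb[of "- w1" "- v1"] by (simp add: algebra_simps power2_eq_square)
  have 3: "p dvd (v1 * w2 - w1 * v2) - (v2 * w3 - w2 * v3) * s\<^sup>2"
    using comb[of w2 v2] by (simp add: algebra_simps power2_eq_square)
  \<comment> \<open>In the difference of these products all terms with \<open>s\<close> cancel, and
    the resultant of the two polynomials remains.\<close>
  have "p dvd ((v1 * w3 - w1 * v3) + (v2 * w3 - w2 * v3) * s) * ((v1 * w3 - w1 * v3) - (v2 * w3 - w2 * v3) * s)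
     - ((v1 * w2 - w1 * v2) - (v2 * w3 - w2 * v3) * s\<^sup>2) * (v2 * w3 - w2 * v3)"
    by (rule dvd_diff[OF dvd_mult2[OF 1] dvd_mult2[OF 3]])
  thus "p dvd (v1 * w3 - w1 * v3)\<^sup>2 - (v1 * w2 - w1 * v2) * (v2 * w3 - w2 * v3)"
    by (simp add: algebra_simps power2_eq_square)
qed

text \<open>Expanding with cofactors eliminates \<open>s\<close>, so the determinant is a multiple
  of \<open>p\<close>. Its six terms are at most \<open>\<alpha> * \<beta> * \<gamma>\<close> each,
  so it vanishes: the lattice points of the box are coplanar.\<close>

lemma lattice_det_zero:
  fixes p s \<alpha> \<beta> \<gamma> :: int
  assumes "0 < \<alpha>" "0 < \<beta>" "0 < \<gamma>" "6 * \<alpha> * \<beta> * \<gamma> < p"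
    and "\<bar>u1\<bar> \<le> \<alpha>" "\<bar>u2\<bar> \<le> \<beta>" "\<bar>u3\<bar> \<le> \<gamma>" "p dvd u1 + u2 * s + u3 * s\<^sup>2"
    and "\<bar>v1\<bar> \<le> \<alpha>" "\<bar>v2\<bar> \<le> \<beta>" "\<bar>v3\<bar> \<le> \<gamma>" "p dvd v1 + v2 * s + v3 * s\<^sup>2"
    and "\<bar>w1\<bar> \<le> \<alpha>" "\<bar>w2\<bar> \<le> \<beta>" "\<bar>w3\<bar> \<le> \<gamma>" "p dvd w1 + w2 * s + w3 * s\<^sup>2"
  shows "u1 * (v2 * w3 - w2 * v3) - u2 * (v1 * w3 - w1 * v3) + u3 * (v1 * w2 - w1 * v2) = 0"
proof -
  let ?D = "u1 * (v2 * w3 - w2 * v3) - u2 * (v1 * w3 - w1 * v3) + u3 * (v1 * w2 - w1 * v2)"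
  have "p dvd (u1 + u2 * s + u3 * s\<^sup>2) * (v2 * w3 - w2 * v3) + (v1 + v2 * s + v3 * s\<^sup>2) * (w2 * u3 - u2 * w3)
     + (w1 + w2 * s + w3 * s\<^sup>2) * (u2 * v3 - v2 * u3)"
    by (rule dvd_add[OF dvd_add[OF dvd_mult2[OF assms(8)] dvd_mult2[OF assms(12)]] dvd_mult2[OF assms(16)]])
  also have "\<dots> = ?D" by (simp add: algebra_simps power2_eq_square)
  finally have dvd: "p dvd ?D" .
  have m: "\<bar>x * y * z\<bar> \<le> \<alpha> * \<beta> * \<gamma>" if "\<bar>x\<bar> \<le> \<alpha>" "\<bar>y\<bar> \<le> \<beta>" "\<bar>z\<bar> \<le> \<gamma>" for x y z
    unfolding abs_mult using that assms(1-3) by (intro mult_mono) auto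
  have "?D = u1 * v2 * w3 - u1 * w2 * v3 - v1 * u2 * w3 + w1 * u2 * v3 + v1 * w2 * u3 - w1 * v2 * u3"
    by (simp add: algebra_simps)
  moreover have "\<bar>u1 * v2 * w3\<bar> \<le> \<alpha> * \<beta> * \<gamma>" "\<bar>u1 * w2 * v3\<bar> \<le> \<alpha> * \<beta> * \<gamma>" "\<bar>v1 * u2 * w3\<bar> \<le> \<alpha> * \<beta> * \<gamma>"
    "\<bar>w1 * u2 * v3\<bar> \<le> \<alpha> * \<beta> * \<gamma>" "\<bar>v1 * w2 * u3\<bar> \<le> \<alpha> * \<beta> * \<gamma>" "\<bar>w1 * v2 * u3\<bar> \<le> \<alpha> * \<beta> * \<gamma>"
    using assms by (auto intro!: m)
  ultimately have "\<bar>?D\<bar> < p" using assms(4) by linarith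
  with dvd show ?thesis using zdvd_not_zless[of "\<bar>?D\<bar>" p] by auto
qed

text \<open>If all lattice points of the box lie in a plane, then either they are multiples of one
  polynomial, or two independent ones have a common root, or the resultant, a nonzero multiple of
  \<open>p\<close> that is quadratic along the plane, keeps the lines apart.\<close>

lemma lattice_points_cases_3d:
  fixes p s \<alpha> \<beta> \<gamma> :: int
  defines "G \<equiv> {(a, b, c). \<bar>a\<bar> \<le> \<alpha> \<and> \<bar>b\<bar> \<le> \<beta> \<and> \<bar>c\<bar> \<le> \<gamma> \<and> p dvd a + b * s + c * s\<^sup>2}"
  assumes pos: "0 < \<alpha>" "0 < \<beta>" "0 < \<gamma>" and small: "6 * \<alpha> * \<beta> * \<gamma> < p"
    and nz: "G - {(0, 0, 0)} \<noteq> {}"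
  obtains (line) v1 v2 v3 where "(v1, v2, v3) \<in> G" "(v1, v2, v3) \<noteq> (0, 0, 0)"
      "\<And>a b c. (a, b, c) \<in> G \<Longrightarrow> v1 * b = a * v2 \<and> v1 * c = a * v3 \<and> v2 * c = b * v3"
    | (root) v1 v2 v3 w1 w2 w3 where "(v1, v2, v3) \<in> G" "(w1, w2, w3) \<in> G"
      "\<not> (v1 * w2 = w1 * v2 \<and> v1 * w3 = w1 * v3 \<and> v2 * w3 = w2 * v3)"
      "(v1 * w3 - w1 * v3)\<^sup>2 = (v1 * w2 - w1 * v2) * (v2 * w3 - w2 * v3)"
    | (few) "real (card G) \<le> 12 * sqrt (real_of_int (4 * \<alpha>\<^sup>2 * \<gamma>\<^sup>2 + 4 * \<alpha> * \<beta>\<^sup>2 * \<gamma>) / p)"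
proof -
  define L where "L = {(a, b, c). p dvd a + b * s + c * s\<^sup>2}"
  have GL: "G = {(a, b, c) \<in> L. \<bar>a\<bar> \<le> \<alpha> \<and> \<bar>b\<bar> \<le> \<beta> \<and> \<bar>c\<bar> \<le> \<gamma>}"
    unfolding G_def L_def by auto
  have "0 < \<alpha> * \<beta> * \<gamma>" using pos by simp
  hence p0: "0 < p" using small by linarith
  have diff: "\<forall>a b c a' b' c'. (a, b, c) \<in> L \<longrightarrow> (a', b', c') \<in> L \<longrightarrow> (a - a', b - b', c - c') \<in> L"
  proof (intro allI impI)
    fix a b c a' b' c' assume "(a, b, c) \<in> L" "(a', b', c') \<in> L"
    thus "(a - a', b - b', c - c') \<in> L"
      using dvd_diff[of p "a + b * s + c * s\<^sup>2" "a' + b' * s + c' * s\<^sup>2"] unfolding L_def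
      by (simp add: algebra_simps)
  qed
  obtain v1 v2 v3 and \<mu> :: real where v: "(v1, v2, v3) \<in> G" "(v1, v2, v3) \<noteq> (0, 0, 0)"
    and l: "0 < \<mu>" "\<mu> \<le> 1"
    and b: "\<bar>real_of_int v1\<bar> \<le> \<mu> * \<alpha>" "\<bar>real_of_int v2\<bar> \<le> \<mu> * \<beta>" "\<bar>real_of_int v3\<bar> \<le> \<mu> * \<gamma>"
    and count: "lines_bound G v1 v2 v3 \<mu>"
    by (rule shortest_vector_count[of \<alpha> \<beta> \<gamma> L, folded GL, OF pos diff nz]) blast
  have vL: "p dvd v1 + v2 * s + v3 * s\<^sup>2" using v(1) unfolding G_def by auto
  define m12 where "m12 w = (case w of (a, b, c) \<Rightarrow> v1 * b - a * v2)" for w :: "int \<times> int \<times> int"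
  define m13 where "m13 w = (case w of (a, b, c) \<Rightarrow> v1 * c - a * v3)" for w :: "int \<times> int \<times> int"
  define m23 where "m23 w = (case w of (a, b, c) \<Rightarrow> v2 * c - b * v3)" for w :: "int \<times> int \<times> int"
  define Res where "Res w = (m13 w)\<^sup>2 - m12 w * m23 w" for w
  note m_defs = m12_def m13_def m23_def
  show ?thesis
  proof (cases "\<forall>w\<in>G. m12 w = 0 \<and> m13 w = 0 \<and> m23 w = 0")
    case True
    show ?thesis
    proof (rule line[OF v])
      fix a b c assume "(a, b, c) \<in> G"
      with True show "v1 * b = a * v2 \<and> v1 * c = a * v3 \<and> v2 * c = b * v3"
        unfolding m_defs by fastforce
    qed
  next
    case False
    then obtain w0 where w0: "w0 \<in> G" "\<not> (m12 w0 = 0 \<and> m13 w0 = 0 \<and> m23 w0 = 0)" by blast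
    obtain w1 w2 w3 where w0_eq: "w0 = (w1, w2, w3)" by (cases w0)
    show ?thesis
    proof (cases "Res w0 = 0")
      case True
      show ?thesis
        by (rule root[OF v(1), of w1 w2 w3]) (use w0 True in \<open>auto simp: w0_eq m_defs Res_def\<close>)
    next
      case nonzero: False
      define R2 where "R2 = 4 * \<alpha>\<^sup>2 * \<gamma>\<^sup>2 + 4 * \<alpha> * \<beta>\<^sup>2 * \<gamma>"
      \<comment> \<open>By the vanishing determinant every point of the box lies in the rational
        plane of \<open>v\<close> and \<open>w0\<close>, so its minors against \<open>v\<close> are
        proportional to those of \<open>w0\<close>.\<close>
      have coplanar: "m12 w * m13 w0 = m13 w * m12 w0" "m12 w * m23 w0 = m23 w * m12 w0"
        "m13 w * m23 w0 = m23 w * m13 w0" if "w \<in> G" for w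
      proof -
        obtain a b c where w: "w = (a, b, c)" by (cases w)
        have D: "a * (v2 * w3 - w2 * v3) - b * (v1 * w3 - w1 * v3) + c * (v1 * w2 - w1 * v2) = 0"
          by (rule lattice_det_zero[OF pos small, of _ _ _ s])
            (use that v(1) w0(1) in \<open>auto simp: w w0_eq G_def\<close>)
        show "m12 w * m13 w0 = m13 w * m12 w0" "m12 w * m23 w0 = m23 w * m12 w0"
          "m13 w * m23 w0 = m23 w * m13 w0"
          using D unfolding w w0_eq m_defs prod.case by algebra+
      qed
      obtain m where m: "m \<in> {m12, m13, m23}" "m w0 \<noteq> 0" using w0(2) by blast
      have par: "m12 w * m w0 = m w * m12 w0" "m13 w * m w0 = m w * m13 w0" "m23 w * m w0 = m w * m23 w0"
        if "w \<in> G" for w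
        using m(1) coplanar[OF that] by (auto simp: mult.commute)
      \<comment> \<open>The resultant is quadratic in the minors, hence on the plane it is a
        constant multiple of the square of \<open>m\<close>.\<close>
      have res_m: "Res w * (m w0)\<^sup>2 = (m w)\<^sup>2 * Res w0" if "w \<in> G" for w
        using par[OF that] unfolding Res_def by algebra
      have m_diff: "m (a - a', b - b', c - c') = m (a, b, c) - m (a', b', c')" for a b c a' b' c'
        using m(1) unfolding m_defs by (auto simp: algebra_simps)
      \<comment> \<open>On the plane \<open>\<bar>m w / m w0\<bar>\<close> is the square root of
        \<open>\<bar>Res w / Res w0\<bar>\<close>. A nonzero resultant is at least \<open>p\<close>
        in absolute value, and on the box it is at most \<open>\<mu>\<^sup>2 * R2\<close>; this
        yields the spacing \<open>d\<close> and the range \<open>\<mu> * A\<close>.\<close>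
      define d where "d = sqrt (p / \<bar>Res w0\<bar>)"
      define A where "A = sqrt (R2 / \<bar>Res w0\<bar>)"
      have R2: "0 \<le> R2" unfolding R2_def using pos by simp
      have res_bound: "\<bar>real_of_int (Res w)\<bar> \<le> \<mu>\<^sup>2 * R2" if "w \<in> G" for w
      proof -
        obtain x y z where w: "w = (x, y, z)" "\<bar>x\<bar> \<le> \<alpha>" "\<bar>y\<bar> \<le> \<beta>" "\<bar>z\<bar> \<le> \<gamma>"
          using \<open>w \<in> G\<close> unfolding G_def by auto
        \<comment> \<open>Every product in a minor has one factor from \<open>v\<close>, which
          supplies \<open>\<mu>\<close>; the resultant therefore gains
          \<open>\<mu>\<^sup>2\<close>.\<close>
        have prod: "\<bar>real_of_int u * real_of_int t\<bar> \<le> \<mu> * (real_of_int \<eta> * real_of_int \<theta>)"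
          if "\<bar>real_of_int u\<bar> \<le> \<mu> * \<eta>" "\<bar>t\<bar> \<le> \<theta>" "0 < \<eta>" for u t \<eta> \<theta> :: int
        proof -
          have "\<bar>real_of_int u * real_of_int t\<bar> \<le> (\<mu> * \<eta>) * \<theta>"
            unfolding abs_mult using that l by (intro mult_mono) auto
          thus ?thesis by (simp add: mult.assoc)
        qed
        have "\<bar>real_of_int (m12 w)\<bar> \<le> 2 * \<mu> * (\<alpha> * \<beta>)"
          using prod[OF b(1) w(3) pos(1)] prod[OF b(2) w(2) pos(2)] unfolding w m_defs
          by (simp add: algebra_simps)
        moreover have "\<bar>real_of_int (m23 w)\<bar> \<le> 2 * \<mu> * (\<beta> * \<gamma>)"
          using prod[OF b(2) w(4) pos(2)] prod[OF b(3) w(3) pos(3)] unfolding w m_defs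
          by (simp add: algebra_simps)
        ultimately have "\<bar>real_of_int (m12 w) * m23 w\<bar> \<le> (2 * \<mu> * (\<alpha> * \<beta>)) * (2 * \<mu> * (\<beta> * \<gamma>))"
          unfolding abs_mult using l pos by (intro mult_mono) auto
        moreover have "\<bar>real_of_int (m13 w)\<bar> \<le> 2 * \<mu> * (\<alpha> * \<gamma>)"
          using prod[OF b(1) w(4) pos(1)] prod[OF b(3) w(2) pos(3)] unfolding w m_defs
          by (simp add: algebra_simps)
        hence "\<bar>real_of_int (m13 w)\<bar>\<^sup>2 \<le> (2 * \<mu> * (\<alpha> * \<gamma>))\<^sup>2" by (intro power_mono) auto
        hence "\<bar>(real_of_int (m13 w))\<^sup>2\<bar> \<le> (2 * \<mu> * (\<alpha> * \<gamma>))\<^sup>2" by (simp only: power_abs)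
        ultimately have "\<bar>real_of_int (Res w)\<bar> \<le> (2 * \<mu> * (\<alpha> * \<gamma>))\<^sup>2 + (2 * \<mu> * (\<alpha> * \<beta>)) * (2 * \<mu> * (\<beta> * \<gamma>))"
          unfolding Res_def of_int_diff of_int_mult of_int_power by linarith
        also have "\<dots> = \<mu>\<^sup>2 * R2" unfolding R2_def by (simp add: algebra_simps power2_eq_square)
        finally show ?thesis .
      qed
      have sqrt_res: "\<bar>real_of_int (m w) / m w0\<bar> = sqrt (\<bar>real_of_int (Res w)\<bar> / \<bar>real_of_int (Res w0)\<bar>)"
        if "Res w * (m w0)\<^sup>2 = (m w)\<^sup>2 * Res w0" for w
      proof -
        have "real_of_int (Res w) * (real_of_int (m w0))\<^sup>2 = (real_of_int (m w))\<^sup>2 * real_of_int (Res w0)"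
          using that by (metis of_int_mult of_int_power)
        hence "real_of_int (Res w) / real_of_int (Res w0) = (real_of_int (m w) / m w0)\<^sup>2"
          using m(2) nonzero by (simp add: field_simps)
        hence "\<bar>real_of_int (Res w)\<bar> / \<bar>real_of_int (Res w0)\<bar> = (real_of_int (m w) / m w0)\<^sup>2"
          by (metis abs_divide abs_power2)
        thus ?thesis by simp
      qed
      have "real (card G) \<le> 12 * A / d"
      proof (rule lines_boundD[OF count, where \<tau> = "\<lambda>w. real_of_int (m w) / m w0"])
        show "0 \<le> A" unfolding A_def using R2 by simp
        show "0 < d" unfolding d_def using p0 nonzero by simp
      next
        fix w assume w: "w \<in> G"
        have "\<bar>real_of_int (m w) / m w0\<bar> = sqrt (\<bar>real_of_int (Res w)\<bar> / \<bar>real_of_int (Res w0)\<bar>)"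
          using sqrt_res[OF res_m[OF w]] .
        also have "\<dots> \<le> sqrt (\<mu>\<^sup>2 * R2 / \<bar>real_of_int (Res w0)\<bar>)"
          using res_bound[OF w] by (intro real_sqrt_le_mono divide_right_mono) auto
        also have "\<dots> = \<mu> * A" unfolding A_def using l by (simp add: real_sqrt_mult real_sqrt_divide)
        finally show "\<bar>real_of_int (m w) / m w0\<bar> \<le> \<mu> * A" .
      next
        fix w w' assume w: "w \<in> G" "w' \<in> G" "real_of_int (m w) / m w0 \<noteq> real_of_int (m w') / m w0"
        obtain a b c a' b' c' where ww: "w = (a, b, c)" "w' = (a', b', c')" by (cases w, cases w') blast
        define u where "u = (a - a', b - b', c - c')"
        have mu: "m u = m w - m w'" unfolding u_def ww by (rule m_diff)
        have "m12 u = m12 w - m12 w'" "m13 u = m13 w - m13 w'" "m23 u = m23 w - m23 w'"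
          unfolding u_def ww m_defs by (simp_all add: algebra_simps)
        hence "m12 u * m w0 = m u * m12 w0" "m13 u * m w0 = m u * m13 w0" "m23 u * m w0 = m u * m23 w0"
          using par[OF w(1)] par[OF w(2)] mu by (simp_all add: left_diff_distrib)
        hence ru: "Res u * (m w0)\<^sup>2 = (m u)\<^sup>2 * Res w0" unfolding Res_def by algebra
        have "m u \<noteq> 0" using w(3) mu by auto
        hence "Res u \<noteq> 0" using ru nonzero by auto
        moreover have "p dvd Res u"
          using lattice_minors_cong(3)[OF vL, of "a - a'" "b - b'" "c - c'"] w diff
          unfolding Res_def u_def m_defs ww G_def L_def by (auto simp: algebra_simps)
        ultimately have "p \<le> \<bar>Res u\<bar>" using dvd_imp_le_int[of "Res u" p] by linarith
        hence "real_of_int p \<le> \<bar>real_of_int (Res u)\<bar>" by linarith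
        hence "d \<le> sqrt (\<bar>real_of_int (Res u)\<bar> / \<bar>real_of_int (Res w0)\<bar>)"
          unfolding d_def using nonzero by (intro real_sqrt_le_mono) (simp add: divide_right_mono)
        also have "\<dots> = \<bar>real_of_int (m u) / m w0\<bar>" using sqrt_res[OF ru] by simp
        finally show "d \<le> \<bar>real_of_int (m w) / m w0 - real_of_int (m w') / m w0\<bar>"
          unfolding mu by (simp add: diff_divide_distrib)
      next
        fix a b c a' b' c'
        assume w: "(a, b, c) \<in> G" "(a', b', c') \<in> G"
          "real_of_int (m (a, b, c)) / m w0 = real_of_int (m (a', b', c')) / m w0"
        hence e: "m (a, b, c) = m (a', b', c')" using m(2) by simp
        have "m12 (a, b, c) = m12 (a', b', c')" "m13 (a, b, c) = m13 (a', b', c')"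
          "m23 (a, b, c) = m23 (a', b', c')"
          using par[OF w(1)] par[OF w(2)] m(2) unfolding e by (metis mult_right_cancel)+
        thus "v1 * (b - b') = (a - a') * v2 \<and> v1 * (c - c') = (a - a') * v3 \<and> v2 * (c - c') = (b - b') * v3"
          unfolding m_defs by (simp add: algebra_simps)
      next
        \<comment> \<open>The vector \<open>v\<close> has label 0 and \<open>w0\<close> has label 1,
          so there are two lines.\<close>
        have "m (v1, v2, v3) = 0" using m(1) unfolding m_defs by auto
        hence "real_of_int (m (v1, v2, v3)) / m w0 \<noteq> real_of_int (m w0) / m w0" using m(2) by simp
        thus "\<exists>w\<in>G. \<exists>w'\<in>G. real_of_int (m w) / m w0 \<noteq> real_of_int (m w') / m w0"
          using v(1) w0(1) by blast
      qed
      also have "12 * A / d = 12 * sqrt (real_of_int R2 / p)"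
        unfolding A_def d_def using nonzero by (simp add: real_sqrt_divide)
      finally show ?thesis unfolding R2_def by (rule few)
    qed
  qed
qed

subsection \<open>Products of two and of three residues\<close>

lemma dvd_small_zero:
  fixes x p :: int
  assumes "p dvd x" "\<bar>x\<bar> < p"
  shows "x = 0"
  using assms dvd_imp_le_int[of x p] by linarith

definition energy2 :: "int \<Rightarrow> int set \<Rightarrow> nat" where
  "energy2 p U = card {(a, b, c, d). a \<in> U \<and> b \<in> U \<and> c \<in> U \<and> d \<in> U \<and> p dvd a * b - c * d}"

lemma abs_mult_le:
  fixes x y a b :: int
  assumes "\<bar>x\<bar> \<le> a" "\<bar>y\<bar> \<le> b"
  shows "\<bar>x * y\<bar> \<le> a * b"
  unfolding abs_mult using assms by (intro mult_mono) auto

lemma card_fiber_divisors: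
  fixes f :: "'a \<Rightarrow> int"
  assumes "n \<noteq> 0" "\<bar>n\<bar> \<le> M" "\<And>x. x \<in> F \<Longrightarrow> f x dvd n" "inj_on f F"
    and "\<And>n::int. n \<noteq> 0 \<Longrightarrow> \<bar>n\<bar> \<le> M \<Longrightarrow> card {d. d dvd n} \<le> T"
  shows "card F \<le> T"
proof -
  have "card F \<le> card {d. d dvd n}"
    using assms by (intro card_inj_on_le[of f]) auto
  also have "\<dots> \<le> T" using assms by blast
  finally show ?thesis .
qed

text \<open>Every solution gives a linear polynomial in a small box that vanishes at
  \<open>s\<close> modulo \<open>p\<close>. If two of these lattice points are independent, there
  are few of them, and each has at most \<open>T\<close> preimages. If all are proportional, the
  congruence becomes an equation between integer products, and \<open>T\<close> bounds the solutions
  for each \<open>b\<close>.\<close>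

lemma products_eq_fixed_count:
  fixes p H s :: int and U :: "int set" and T :: nat
  assumes p: "prime p" and U: "finite U" "\<And>u. u \<in> U \<Longrightarrow> \<not> p dvd u" "s \<in> U"
    and H: "0 < H" "H \<le> p" "\<And>u u'. u \<in> U \<Longrightarrow> u' \<in> U \<Longrightarrow> \<bar>u - u'\<bar> < H"
    and T: "\<And>n::int. n \<noteq> 0 \<Longrightarrow> \<bar>n\<bar> \<le> p ^ 20 \<Longrightarrow> card {d. d dvd n} \<le> T"
  shows "real (card {(b, c, d). b \<in> U \<and> c \<in> U \<and> d \<in> U \<and> p dvd s * b - c * d})
    \<le> 2 * real (card U) + T * (real (card U) + 72 * real_of_int H ^ 3 / p)"
proof -
  define S where "S = {(b, c, d). b \<in> U \<and> c \<in> U \<and> d \<in> U \<and> p dvd s * b - c * d}"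
  \<comment> \<open>These solutions have constant coefficient zero, where divisors say nothing;
    cancelling \<open>s\<close> shows that there are at most two per element of
    \<open>U\<close>.\<close>
  define S0 where "S0 = {(b, c, d) \<in> S. c = s \<or> d = s}"
  define S1 where "S1 = {(b, c, d) \<in> S. c \<noteq> s \<and> d \<noteq> s}"
  have p2: "2 \<le> p" using p prime_ge_2_int by blast
  have "S \<subseteq> U \<times> U \<times> U" unfolding S_def by auto
  hence finS: "finite S" using U(1) by (meson finite_SigmaI finite_subset)
  have fin: "finite S0" "finite S1" unfolding S0_def S1_def using finS by (auto intro: finite_subset[of _ S])
  have SU: "S = S0 \<union> S1" unfolding S0_def S1_def by auto
  have cancel: "b = d" if "b \<in> U" "d \<in> U" "p dvd s * (b - d)" for b d
  proof -
    have "p dvd b - d" using that(3) p U(2,3) prime_dvd_mult_iff by blast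
    thus ?thesis using dvd_small_zero[of p "b - d"] H(2) H(3)[OF that(1,2)] by linarith
  qed
  have "S0 \<subseteq> (\<lambda>d. (d, s, d)) ` U \<union> (\<lambda>c. (c, c, s)) ` U"
  proof
    fix x assume "x \<in> S0"
    then obtain b c d where x: "x = (b, c, d)" "b \<in> U" "c \<in> U" "d \<in> U" "p dvd s * b - c * d" "c = s \<or> d = s"
      unfolding S0_def S_def by auto
    have "c = s \<Longrightarrow> b = d" using cancel[of b d] x by (simp add: right_diff_distrib)
    moreover have "d = s \<Longrightarrow> b = c" using cancel[of b c] x by (simp add: right_diff_distrib mult.commute)
    ultimately show "x \<in> (\<lambda>d. (d, s, d)) ` U \<union> (\<lambda>c. (c, c, s)) ` U" using x by auto
  qed
  hence "card S0 \<le> card ((\<lambda>d. (d, s, d)) ` U \<union> (\<lambda>c. (c, c, s)) ` U)"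
    using U(1) by (intro card_mono) auto
  also have "\<dots> \<le> card ((\<lambda>d. (d, s, d)) ` U) + card ((\<lambda>c. (c, c, s)) ` U)" by (rule card_Un_le)
  also have "\<dots> \<le> card U + card U" using U(1) by (intro add_mono card_image_le)
  finally have S0: "card S0 \<le> 2 * card U" by simp
  \<comment> \<open>The coefficients of
    \<open>(X + (c - s)) * (X + (d - s)) - X * (X + (b - s))\<close>, which takes the value
    \<open>c * d - s * b\<close> at \<open>X = s\<close>.\<close>
  define f where "f x = (case x of (b, c, d) \<Rightarrow> ((c - s) * (d - s), c + d - b - s))" for x
  define G where "G = {(a, b). \<bar>a\<bar> \<le> H\<^sup>2 \<and> \<bar>b\<bar> \<le> 3 * H \<and> p dvd a + b * s}"
  have dist: "\<bar>u - s\<bar> \<le> H" if "u \<in> U" for u using H(3)[OF that U(3)] by linarith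
  have fS: "f x \<in> G" "fst (f x) \<noteq> 0" "\<not> p dvd fst (f x)" if x: "x \<in> S1" for x
  proof -
    obtain b c d where e: "x = (b, c, d)" "b \<in> U" "c \<in> U" "d \<in> U" "p dvd s * b - c * d" "c \<noteq> s" "d \<noteq> s"
      using x unfolding S1_def S_def by auto
    have "\<bar>(c - s) * (d - s)\<bar> \<le> H\<^sup>2"
      unfolding power2_eq_square by (intro abs_mult_le dist e)
    moreover have "\<bar>c + d - b - s\<bar> \<le> 3 * H" using dist[OF e(2)] dist[OF e(3)] dist[OF e(4)] by linarith
    moreover have "p dvd (c - s) * (d - s) + (c + d - b - s) * s"
    proof -
      have "(c - s) * (d - s) + (c + d - b - s) * s = - (s * b - c * d)" by (simp add: algebra_simps)
      thus ?thesis using e(5) by (metis dvd_minus_iff)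
    qed
    ultimately show "f x \<in> G" unfolding G_def f_def e by simp
    show "fst (f x) \<noteq> 0" unfolding f_def e using e by simp
    have "\<not> p dvd c - s" "\<not> p dvd d - s"
      using dvd_small_zero[of p "c - s"] dvd_small_zero[of p "d - s"] H(2) H(3)[OF e(3) U(3)] H(3)[OF e(4) U(3)] e
      by auto
    thus "\<not> p dvd fst (f x)" unfolding f_def e using p by (simp add: prime_dvd_mult_iff)
  qed
  have H2p: "H\<^sup>2 \<le> p\<^sup>2" using H by (intro power_mono) auto
  have pp: "p ^ i \<le> p ^ j" if "i \<le> j" for i j using that p2 by (intro power_increasing) auto
  have "G \<subseteq> {-H\<^sup>2..H\<^sup>2} \<times> {-(3*H)..3*H}" unfolding G_def by auto
  hence finG: "finite G" by (rule finite_subset) auto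
  have S1: "real (card S1) \<le> T * (real (card U) + 72 * real_of_int H ^ 3 / p)"
  proof (cases "\<exists>x\<in>G. \<exists>y\<in>G. fst x * snd y \<noteq> fst y * snd x")
    case True
    then obtain a1 b1 a2 b2 where ind: "(a1, b1) \<in> G" "(a2, b2) \<in> G" "a1 * b2 \<noteq> a2 * b1" by auto
    have "real (card G) \<le> real_of_int (24 * H\<^sup>2 * (3 * H)) / p"
      unfolding G_def by (rule lattice_points_count_2d) (use ind H p2 in \<open>auto simp: G_def\<close>)
    hence G: "real (card G) \<le> 72 * real_of_int H ^ 3 / p" by (simp add: power2_eq_square power3_eq_cube)
    have "card S1 \<le> card G * T"
    proof (rule card_le_fiber_bound[of S1 G f])
      fix y assume y: "y \<in> G"
      let ?F = "{x \<in> S1. f x = y}"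
      show "card ?F \<le> T"
      proof (cases "fst y = 0")
        case True
        hence "?F = {}" using fS(2) by blast
        thus ?thesis by (metis card.empty le0)
      next
        case False
        show ?thesis
        proof (rule card_fiber_divisors[of "fst y" "p ^ 20" _ "\<lambda>(b, c, d). c - s"])
          have "\<bar>fst y\<bar> \<le> H\<^sup>2" using y unfolding G_def by auto
          thus "\<bar>fst y\<bar> \<le> p ^ 20" using H2p pp[of 2 20] by linarith
        next
          fix x assume "x \<in> ?F"
          thus "(case x of (b, c, d) \<Rightarrow> c - s) dvd fst y" by (cases x) (auto simp: f_def)
        next
          show "inj_on (\<lambda>(b, c, d). c - s) ?F"
            using False unfolding f_def inj_on_def by auto
        qed (use False T in auto)
      qed
    qed (use fin finG fS in auto)
    hence "real (card S1) \<le> real (card G) * real T" by (metis of_nat_le_iff of_nat_mult)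
    also have "\<dots> \<le> (72 * real_of_int H ^ 3 / p) * real T" using G by (intro mult_right_mono) auto
    also have "\<dots> \<le> T * (real (card U) + 72 * real_of_int H ^ 3 / p)" by (simp add: algebra_simps)
    finally show ?thesis .
  next
    case dep: False
    show ?thesis
    proof (cases "S1 = {}")
      case True
      thus ?thesis using H p2 by simp
    next
      case False
      then obtain x0 where x0: "x0 \<in> S1" by blast
      obtain a0 b0 where f0: "f x0 = (a0, b0)" by (cases "f x0")
      have a0: "a0 \<noteq> 0" "\<not> p dvd a0" "(a0, b0) \<in> G" using fS[OF x0] f0 by auto
      hence g0: "\<bar>a0\<bar> \<le> H\<^sup>2" "\<bar>b0\<bar> \<le> 3 * H" "p dvd a0 + b0 * s" unfolding G_def by auto
      have b0: "\<not> p dvd b0"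
      proof
        assume "p dvd b0"
        hence "p dvd (a0 + b0 * s) - b0 * s" using g0(3) by (intro dvd_diff dvd_mult2)
        with a0(2) show False by simp
      qed
      hence b0': "b0 \<noteq> 0" by auto
      have "card S1 \<le> card U * T"
      proof (rule card_le_fiber_bound[of S1 U fst])
        fix b assume b: "b \<in> U"
        let ?F = "{x \<in> S1. fst x = b}"
        \<comment> \<open>The value of the polynomial identity at the common root
          \<open>- a0 / b0\<close>, cleared of denominators. It depends only on \<open>b\<close>,
          and it is nonzero since \<open>a0 - b0 * (b - s)\<close> is congruent to
          \<open>- b0 * b\<close> modulo \<open>p\<close>.\<close>
        define n where "n = a0 * (a0 - b0 * (b - s))"
        have "\<not> p dvd a0 - b0 * (b - s)"
        proof
          assume "p dvd a0 - b0 * (b - s)"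
          from dvd_diff[OF g0(3) this]
          have "p dvd b0 * b" by (simp add: algebra_simps)
          with b0 U(2)[OF b] p show False by (simp add: prime_dvd_mult_iff)
        qed
        hence n0: "n \<noteq> 0" unfolding n_def using a0 by auto
        have id: "(b0 * (c - s) - a0) * (b0 * (d - s) - a0) = n" if "(b, c, d) \<in> S1" for c d
        proof -
          have "a0 * snd (f (b, c, d)) = fst (f (b, c, d)) * b0"
            using dep fS(1)[OF that] a0(3) by (metis fst_conv snd_conv)
          hence "a0 * (c + d - b - s) = (c - s) * (d - s) * b0" unfolding f_def by simp
          thus ?thesis unfolding n_def by algebra
        qed
        have "\<bar>b0 * (b - s)\<bar> \<le> 3 * H * H" by (intro abs_mult_le g0 dist b)
        hence "\<bar>a0 - b0 * (b - s)\<bar> \<le> 4 * H\<^sup>2" using g0(1) unfolding power2_eq_square by linarith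
        hence "\<bar>n\<bar> \<le> H\<^sup>2 * (4 * H\<^sup>2)" unfolding n_def by (intro abs_mult_le g0)
        also have "\<dots> \<le> p\<^sup>2 * (4 * p\<^sup>2)" using H2p by (intro mult_mono) auto
        also have "\<dots> \<le> p\<^sup>2 * (p\<^sup>2 * p\<^sup>2)"
          using p2 power_mono[of 2 p 2] by (intro mult_left_mono mult_right_mono) auto
        also have "\<dots> \<le> p ^ 20" using pp[of 6 20] by (simp flip: power_add)
        finally have nb: "\<bar>n\<bar> \<le> p ^ 20" .
        show "card ?F \<le> T"
        proof (rule card_fiber_divisors[of n "p ^ 20" _ "\<lambda>(b, c, d). b0 * (c - s) - a0"])
          fix x assume "x \<in> ?F"
          thus "(case x of (b, c, d) \<Rightarrow> b0 * (c - s) - a0) dvd n"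
            using id by (cases x) (auto intro: dvdI[OF sym])
        next
          show "inj_on (\<lambda>(b, c, d). b0 * (c - s) - a0) ?F"
          proof (rule inj_onI)
            fix x y assume xy: "x \<in> ?F" "y \<in> ?F"
              "(case x of (b, c, d) \<Rightarrow> b0 * (c - s) - a0) = (case y of (b, c, d) \<Rightarrow> b0 * (c - s) - a0)"
            obtain c d c' d' where e: "x = (b, c, d)" "y = (b, c', d')" using xy by (cases x, cases y) auto
            have c: "c = c'" using xy(3) b0' unfolding e by simp
            have "(b0 * (c - s) - a0) * (b0 * (d - s) - a0) = (b0 * (c - s) - a0) * (b0 * (d' - s) - a0)"
              using id[of c d] id[of c' d'] xy(1,2) unfolding e c by simp
            moreover have "b0 * (c - s) - a0 \<noteq> 0" using id[of c d] xy(1) n0 unfolding e by auto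
            ultimately have "d = d'" using b0' by simp
            thus "x = y" using e c by simp
          qed
        qed (use n0 nb T in auto)
      qed (use fin U in \<open>auto simp: S1_def S_def\<close>)
      hence "real (card S1) \<le> real (card U) * real T" by (metis of_nat_le_iff of_nat_mult)
      moreover have "0 \<le> T * (72 * real_of_int H ^ 3 / p)" using H p2 by simp
      ultimately show ?thesis by (simp add: algebra_simps)
    qed
  qed
  have "card S \<le> card S0 + card S1" unfolding SU by (rule card_Un_le)
  hence "real (card S) \<le> real (card S0) + real (card S1)" by linarith
  with S0 S1 show ?thesis unfolding S_def[symmetric] by linarith
qed

lemma card_sigma_le:
  fixes B :: real
  assumes "finite U" "\<And>s. s \<in> U \<Longrightarrow> finite (F s)" "\<And>s. s \<in> U \<Longrightarrow> real (card (F s)) \<le> B"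
  shows "real (card (Sigma U F)) \<le> real (card U) * B"
proof -
  have "real (card (Sigma U F)) = (\<Sum>s\<in>U. real (card (F s)))"
    using assms by (subst card_SigmaI) auto
  also have "\<dots> \<le> (\<Sum>s\<in>U. B)" using assms by (intro sum_mono)
  finally show ?thesis by simp
qed

lemma energy2_le:
  fixes p H :: int and U :: "int set" and T :: nat
  assumes p: "prime p" and U: "finite U" "\<And>u. u \<in> U \<Longrightarrow> \<not> p dvd u"
    and H: "0 < H" "H \<le> p" "\<And>u u'. u \<in> U \<Longrightarrow> u' \<in> U \<Longrightarrow> \<bar>u - u'\<bar> < H"
    and T: "\<And>n::int. n \<noteq> 0 \<Longrightarrow> \<bar>n\<bar> \<le> p ^ 20 \<Longrightarrow> card {d. d dvd n} \<le> T"
  shows "real (energy2 p U)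
    \<le> real (card U) * (2 * real (card U) + T * (real (card U) + 72 * real_of_int H ^ 3 / p))"
proof -
  let ?F = "\<lambda>s. {(b, c, d). b \<in> U \<and> c \<in> U \<and> d \<in> U \<and> p dvd s * b - c * d}"
  have fin: "finite (?F s)" for s
    by (rule finite_subset[of _ "U \<times> U \<times> U"]) (use U in auto)
  have "{(a, b, c, d). a \<in> U \<and> b \<in> U \<and> c \<in> U \<and> d \<in> U \<and> p dvd a * b - c * d} = Sigma U ?F" by auto
  hence "energy2 p U = card (Sigma U ?F)" unfolding energy2_def by simp
  thus ?thesis using card_sigma_le[OF U(1) fin products_eq_fixed_count[OF p U _ H T]] by simp
qed

section \<open>Congruences between products of three residues\<close>

text \<open>The tag \<open>h\<close> with its eight values settles the finite ambiguities that three
  divisors leave open, such as the choice between two roots or the order of a pair.\<close>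

lemma card_le_divisor_triples:
  fixes g1 g2 g3 :: "'a \<Rightarrow> int" and h :: "'a \<Rightarrow> bool \<times> bool \<times> bool"
  assumes "n \<noteq> 0" "\<bar>n\<bar> \<le> M"
    and "\<And>x. x \<in> F \<Longrightarrow> g1 x dvd n" "\<And>x. x \<in> F \<Longrightarrow> g2 x dvd n" "\<And>x. x \<in> F \<Longrightarrow> g3 x dvd n"
    and "inj_on (\<lambda>x. (g1 x, g2 x, g3 x, h x)) F"
    and "\<And>n::int. n \<noteq> 0 \<Longrightarrow> \<bar>n\<bar> \<le> M \<Longrightarrow> card {d. d dvd n} \<le> T"
  shows "card F \<le> 8 * T ^ 3"
proof -
  let ?D = "{d. d dvd n}"
  have fin: "finite ?D" using assms(1) by simp
  have "card F \<le> card (?D \<times> ?D \<times> ?D \<times> (UNIV :: (bool \<times> bool \<times> bool) set))"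
    using assms fin by (intro card_inj_on_le[OF assms(6)]) auto
  also have "\<dots> = card ?D * (card ?D * (card ?D * 8))"
    by (simp only: card_cartesian_product) (simp add: card_UNIV_bool flip: UNIV_Times_UNIV)
  also have "\<dots> \<le> T * (T * (T * 8))"
    using assms(7)[OF assms(1,2)] by (intro mult_le_mono) auto
  finally show ?thesis by (simp add: power3_eq_cube mult_ac)
qed

text \<open>The hypothesis on \<open>S\<close> says that all coefficient polynomials vanish at
  \<open>- e / f\<close>. Evaluating both cubic products there turns the congruence into an equation
  of integers, and for fixed \<open>y2\<close>, \<open>y3\<close> the factors on the left divide a
  fixed nonzero \<open>n\<close>.\<close>

lemma linear_root_count:
  fixes p H s e f E F :: int and V :: "int set" and T :: nat
  assumes p: "prime p" and V: "finite V" "\<And>x. x \<in> V \<Longrightarrow> \<not> p dvd s + x" "\<And>x. x \<in> V \<Longrightarrow> \<bar>x\<bar> \<le> H" "0 \<in> V"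
    and S: "finite S" "\<And>x1 x2 x3 y2 y3. (x1, x2, x3, y2, y3) \<in> S \<Longrightarrow> y2 \<in> V \<and> y3 \<in> V \<and>
      (x1 * x2 * x3) * f\<^sup>2 - (x1 * x2 + x1 * x3 + x2 * x3 - y2 * y3) * e * f
        + (x1 + x2 + x3 - y2 - y3) * e\<^sup>2 = 0"
    and ef: "\<not> p dvd f" "p dvd e + f * s"
    and bounds: "\<bar>e\<bar> \<le> E" "\<bar>f\<bar> \<le> F" "E * ((F * H + E) * (F * H + E)) \<le> M"
    and T: "\<And>n::int. n \<noteq> 0 \<Longrightarrow> \<bar>n\<bar> \<le> M \<Longrightarrow> card {d. d dvd n} \<le> T"
  shows "card S \<le> (card V)\<^sup>2 * (8 * T ^ 3)"
proof -
  have f0: "f \<noteq> 0" using ef by auto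
  \<comment> \<open>Since \<open>e\<close> is congruent to \<open>- f * s\<close>, the factor
    \<open>f * x - e\<close> is congruent to \<open>f * (s + x)\<close>.\<close>
  have nd: "\<not> p dvd f * x - e" if "x \<in> V" for x
  proof
    assume "p dvd f * x - e"
    from dvd_add[OF ef(2) this]
    have "p dvd f * (s + x)" by (simp add: algebra_simps)
    with p ef(1) V(2)[OF that] show False by (simp add: prime_dvd_mult_iff)
  qed
  have e0: "\<not> p dvd e" using nd[OF V(4)] by simp
  have "card S \<le> card (V \<times> V) * (8 * T ^ 3)"
  proof (rule card_le_fiber_bound[of S "V \<times> V" "\<lambda>(x1, x2, x3, y2, y3). (y2, y3)"])
    fix y assume y: "y \<in> V \<times> V"
    obtain y2 y3 where y_eq: "y = (y2, y3)" "y2 \<in> V" "y3 \<in> V" using y by auto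
    let ?F = "{x \<in> S. (case x of (x1, x2, x3, y2, y3) \<Rightarrow> (y2, y3)) = y}"
    define n where "n = (- e) * ((f * y2 - e) * (f * y3 - e))"
    have n0: "n \<noteq> 0" unfolding n_def using nd[OF y_eq(2)] nd[OF y_eq(3)] e0 by auto
    have id: "(f * x1 - e) * (f * x2 - e) * (f * x3 - e) = n" if "(x1, x2, x3, y2, y3) \<in> S" for x1 x2 x3
    proof -
      have "(f * x1 - e) * (f * x2 - e) * (f * x3 - e) - n =
        f * ((x1 * x2 * x3) * f\<^sup>2 - (x1 * x2 + x1 * x3 + x2 * x3 - y2 * y3) * e * f
        + (x1 + x2 + x3 - y2 - y3) * e\<^sup>2)"
        unfolding n_def by (simp add: algebra_simps power2_eq_square)
      thus ?thesis using S(2)[OF that] by simp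
    qed
    have b: "\<bar>f * x - e\<bar> \<le> F * H + E" if "x \<in> V" for x
      using abs_mult_le[OF bounds(2) V(3)[OF that]] bounds(1) by linarith
    have nb: "\<bar>n\<bar> \<le> M"
    proof -
      have "\<bar>n\<bar> \<le> E * ((F * H + E) * (F * H + E))"
        unfolding n_def using b[OF y_eq(2)] b[OF y_eq(3)] bounds(1) by (intro abs_mult_le) auto
      with bounds(3) show ?thesis by linarith
    qed
    show "card ?F \<le> 8 * T ^ 3"
    proof (rule card_le_divisor_triples[where n = n and M = M and h = "\<lambda>_. (True, True, True)" and
        ?g1.0 = "\<lambda>(x1, x2, x3, y2, y3). f * x1 - e" and ?g2.0 = "\<lambda>(x1, x2, x3, y2, y3). f * x2 - e" and
        ?g3.0 = "\<lambda>(x1, x2, x3, y2, y3). f * x3 - e"])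
      fix x assume "x \<in> ?F"
      then obtain x1 x2 x3 where x: "x = (x1, x2, x3, y2, y3)" "(x1, x2, x3, y2, y3) \<in> S"
        unfolding y_eq by (cases x) auto
      have n: "n = (f * x1 - e) * ((f * x2 - e) * (f * x3 - e))" using id[OF x(2)] by (simp add: mult_ac)
      show "(case x of (x1, x2, x3, y2, y3) \<Rightarrow> f * x1 - e) dvd n"
        "(case x of (x1, x2, x3, y2, y3) \<Rightarrow> f * x2 - e) dvd n"
        "(case x of (x1, x2, x3, y2, y3) \<Rightarrow> f * x3 - e) dvd n"
        unfolding n x prod.case by (meson dvd_triv_left dvd_triv_right dvd_mult)+
    next
      show "inj_on (\<lambda>x. ((case x of (x1, x2, x3, y2, y3) \<Rightarrow> f * x1 - e),
        (case x of (x1, x2, x3, y2, y3) \<Rightarrow> f * x2 - e),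
        (case x of (x1, x2, x3, y2, y3) \<Rightarrow> f * x3 - e), True, True, True)) ?F"
        unfolding y_eq using f0 by (auto simp: inj_on_def)
    qed (use n0 nb T in auto)
  qed (use S V in \<open>auto\<close>)
  thus ?thesis by (simp add: card_cartesian_product power2_eq_square)
qed

text \<open>Both complex roots of \<open>a + b X + c X\<^sup>2\<close> are roots of
  \<open>(X + x1) (X + x2) (X + x3) - X (X + y2) (X + y3)\<close>; multiply the two resulting equations.\<close>

lemma quadratic_norm_identity:
  fixes a b c x1 x2 x3 y2 y3 :: int
  assumes c: "c \<noteq> 0"
    and A: "a * (x1 + x2 + x3 - y2 - y3) = (x1 * x2 * x3) * c"
    and B: "b * (x1 + x2 + x3 - y2 - y3) = (x1 * x2 + x1 * x3 + x2 * x3 - y2 * y3) * c"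
  defines "q \<equiv> \<lambda>x. c * x\<^sup>2 - b * x + a"
  shows "q x1 * q x2 * q x3 = q 0 * q y2 * q y3"
proof -
  \<comment> \<open>A complex square root provides both roots whatever the sign of the
    discriminant.\<close>
  define d where "d = csqrt ((of_int b)\<^sup>2 - 4 * of_int a * of_int c)"
  have d: "d\<^sup>2 = (of_int b)\<^sup>2 - 4 * of_int a * of_int c" unfolding d_def by simp
  define z where "z = (- of_int b + d) / (2 * of_int c)"
  define w where "w = (- of_int b - d) / (2 * of_int c)"
  have c': "(of_int c :: complex) \<noteq> 0" using c by simp
  have sum: "of_int c * (z + w) = - of_int b"
    unfolding z_def w_def using c' by (simp add: field_simps)
  have prod: "of_int c * (z * w) = of_int a"
  proof -
    have "4 * of_int c * (of_int c * (z * w)) = (2 * of_int c * z) * (2 * of_int c * w)" by (simp add: mult_ac)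
    also have "\<dots> = (- of_int b + d) * (- of_int b - d)" unfolding z_def w_def using c' by simp
    also have "\<dots> = 4 * of_int c * of_int a" using d by (simp add: algebra_simps power2_eq_square)
    finally show ?thesis using c' by simp
  qed
  have root: "(t + of_int x1) * (t + of_int x2) * (t + of_int x3) = t * (t + of_int y2) * (t + of_int y3)"
    if t: "of_int a + of_int b * t + of_int c * t\<^sup>2 = 0" for t :: complex
  proof -
    have A': "of_int a * (of_int x1 + of_int x2 + of_int x3 - of_int y2 - of_int y3)
        = (of_int x1 * of_int x2 * of_int x3) * (of_int c :: complex)"
      using arg_cong[OF A, of "of_int :: int \<Rightarrow> complex"] by simp
    have B': "of_int b * (of_int x1 + of_int x2 + of_int x3 - of_int y2 - of_int y3)
        = (of_int x1 * of_int x2 + of_int x1 * of_int x3 + of_int x2 * of_int x3 - of_int y2 * of_int y3) * (of_int c :: complex)"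
      using arg_cong[OF B, of "of_int :: int \<Rightarrow> complex"] by simp
    have "of_int c * ((t + of_int x1) * (t + of_int x2) * (t + of_int x3) - t * (t + of_int y2) * (t + of_int y3))
      = (of_int x1 + of_int x2 + of_int x3 - of_int y2 - of_int y3) * (of_int a + of_int b * t + of_int c * t\<^sup>2)"
      using A' B' by algebra
    hence "of_int c * ((t + of_int x1) * (t + of_int x2) * (t + of_int x3) - t * (t + of_int y2) * (t + of_int y3)) = 0"
      unfolding t by simp
    thus ?thesis using c' by simp
  qed
  have "of_int a + of_int b * z + of_int c * z\<^sup>2 = 0" "of_int a + of_int b * w + of_int c * w\<^sup>2 = 0"
    using sum prod by algebra+
  note roots = this[THEN root]
  have q: "of_int (q x) = of_int c * ((z + of_int x) * (w + of_int x))" for x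
  proof -
    have "of_int c * ((z + of_int x) * (w + of_int x))
      = of_int c * (z * w) + (of_int c * (z + w)) * of_int x + of_int c * (of_int x)\<^sup>2"
      by (simp add: algebra_simps power2_eq_square)
    thus ?thesis unfolding sum prod q_def by simp
  qed
  have "(of_int (q x1 * q x2 * q x3) :: complex) = of_int c ^ 3 *
    (((z + of_int x1) * (z + of_int x2) * (z + of_int x3)) * ((w + of_int x1) * (w + of_int x2) * (w + of_int x3)))"
    unfolding of_int_mult q by (simp add: power3_eq_cube mult_ac)
  also have "\<dots> = of_int c ^ 3 * ((z * (z + of_int y2) * (z + of_int y3)) * (w * (w + of_int y2) * (w + of_int y3)))"
    unfolding roots ..
  also have "\<dots> = of_int (q 0 * q y2 * q y3)"
    unfolding of_int_mult q by (simp add: power3_eq_cube mult_ac)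
  finally show ?thesis by (simp only: of_int_eq_iff)
qed

text \<open>Here all coefficient vectors are proportional to \<open>(a, b, c)\<close>, and the norm
  identity replaces evaluation at a rational root. For fixed \<open>y2\<close>, \<open>y3\<close>
  each \<open>q xi\<close> divides a nonzero integer, and it determines \<open>xi\<close> up to a
  reflection.\<close>

lemma quadratic_count:
  fixes H a b c Q M :: int and V :: "int set" and T :: nat
  defines "q \<equiv> \<lambda>x. c * x\<^sup>2 - b * x + a"
  assumes V: "finite V" "\<And>x. x \<in> V \<Longrightarrow> q x \<noteq> 0" "\<And>x. x \<in> V \<Longrightarrow> \<bar>q x\<bar> \<le> Q" "0 \<in> V"
    and S: "finite S" "\<And>x1 x2 x3 y2 y3. (x1, x2, x3, y2, y3) \<in> S \<Longrightarrow> y2 \<in> V \<and> y3 \<in> V \<and>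
      a * (x1 + x2 + x3 - y2 - y3) = (x1 * x2 * x3) * c \<and>
      b * (x1 + x2 + x3 - y2 - y3) = (x1 * x2 + x1 * x3 + x2 * x3 - y2 * y3) * c"
    and c: "c \<noteq> 0" and M: "Q * Q * Q \<le> M"
    and T: "\<And>n::int. n \<noteq> 0 \<Longrightarrow> \<bar>n\<bar> \<le> M \<Longrightarrow> card {d. d dvd n} \<le> T"
  shows "card S \<le> (card V)\<^sup>2 * (8 * T ^ 3)"
proof -
  have "card S \<le> card (V \<times> V) * (8 * T ^ 3)"
  proof (rule card_le_fiber_bound[of S "V \<times> V" "\<lambda>(x1, x2, x3, y2, y3). (y2, y3)"])
    fix y assume y: "y \<in> V \<times> V"
    obtain y2 y3 where y_eq: "y = (y2, y3)" "y2 \<in> V" "y3 \<in> V" using y by auto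
    let ?F = "{x \<in> S. (case x of (x1, x2, x3, y2, y3) \<Rightarrow> (y2, y3)) = y}"
    define n where "n = q 0 * q y2 * q y3"
    have n0: "n \<noteq> 0" unfolding n_def using V y_eq by auto
    have id: "q x1 * q x2 * q x3 = n" if "(x1, x2, x3, y2, y3) \<in> S" for x1 x2 x3
      unfolding n_def q_def using S(2)[OF that] c by (intro quadratic_norm_identity) auto
    have "\<bar>n\<bar> \<le> Q * Q * Q" unfolding n_def by (intro abs_mult_le V y_eq)
    hence nb: "\<bar>n\<bar> \<le> M" using M by linarith
    \<comment> \<open>Two different points with the same value of \<open>q\<close> have sum
      \<open>b / c\<close>, so they lie on opposite sides of \<open>b / (2 * c)\<close>; the tag
      records the side.\<close>
    have q_inj: "x = x'" if "q x = q x'" "(2 * c * x \<le> b) = (2 * c * x' \<le> b)" for x x'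
    proof (rule ccontr)
      assume ne: "x \<noteq> x'"
      have "(x - x') * (c * (x + x') - b) = 0" using that(1) unfolding q_def by (simp add: algebra_simps power2_eq_square)
      hence "c * (x + x') = b" using ne by (metis mult_eq_0_iff right_minus_eq)
      moreover have "2 * c * x + 2 * c * x' = 2 * (c * (x + x'))" by (simp add: algebra_simps)
      ultimately have "2 * c * x = 2 * c * x'" using that(2) by linarith
      thus False using ne c by simp
    qed
    show "card ?F \<le> 8 * T ^ 3"
    proof (rule card_le_divisor_triples[where n = n and M = M and
        h = "\<lambda>(x1, x2, x3, y2, y3). (2 * c * x1 \<le> b, 2 * c * x2 \<le> b, 2 * c * x3 \<le> b)" and
        ?g1.0 = "\<lambda>(x1, x2, x3, y2, y3). q x1" and ?g2.0 = "\<lambda>(x1, x2, x3, y2, y3). q x2" and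
        ?g3.0 = "\<lambda>(x1, x2, x3, y2, y3). q x3"])
      fix x assume "x \<in> ?F"
      then obtain x1 x2 x3 where x: "x = (x1, x2, x3, y2, y3)" "(x1, x2, x3, y2, y3) \<in> S"
        unfolding y_eq by (cases x) auto
      have n: "n = q x1 * (q x2 * q x3)" using id[OF x(2)] by (simp add: mult_ac)
      show "(case x of (x1, x2, x3, y2, y3) \<Rightarrow> q x1) dvd n"
        "(case x of (x1, x2, x3, y2, y3) \<Rightarrow> q x2) dvd n"
        "(case x of (x1, x2, x3, y2, y3) \<Rightarrow> q x3) dvd n"
        unfolding n x prod.case by (meson dvd_triv_left dvd_triv_right dvd_mult)+
    next
      show "inj_on (\<lambda>x. ((case x of (x1, x2, x3, y2, y3) \<Rightarrow> q x1),
        (case x of (x1, x2, x3, y2, y3) \<Rightarrow> q x2),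
        (case x of (x1, x2, x3, y2, y3) \<Rightarrow> q x3),
        case x of (x1, x2, x3, y2, y3) \<Rightarrow> (2 * c * x1 \<le> b, 2 * c * x2 \<le> b, 2 * c * x3 \<le> b))) ?F"
        unfolding y_eq by (rule inj_onI) (clarsimp, blast intro: q_inj)
    qed (use n0 nb T in auto)
  qed (use S V in \<open>auto\<close>)
  thus ?thesis by (simp add: card_cartesian_product power2_eq_square)
qed

text \<open>The tuple begins with \<open>d\<close>, a factor of the right-hand product, so that the
  set is literally a \<open>Sigma\<close> over the variable that is held fixed.\<close>

definition energy3 :: "int \<Rightarrow> int set \<Rightarrow> nat" where
  "energy3 p U = card {(d, a, b, c, e, f). d \<in> U \<and> a \<in> U \<and> b \<in> U \<and> c \<in> U \<and> e \<in> U \<and> f \<in> U \<and>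
     p dvd a * b * c - d * e * f}"

text \<open>Expanding in powers of \<open>s\<close> cancels the cube and leaves a quadratic
  polynomial in the box with sides \<open>H ^ 3\<close>, \<open>4 * H\<^sup>2\<close>,
  \<open>5 * H\<close>; the determinant condition for this box is \<open>120 * H ^ 6 < p\<close>. As
  no \<open>xi\<close> is zero, the constant coefficient is nonzero and its divisors can be
  counted.\<close>

lemma nondegenerate_triples_count:
  fixes p H s :: int and V :: "int set" and T :: nat
  assumes p: "prime p" and V: "finite V" "\<And>x. x \<in> V \<Longrightarrow> \<not> p dvd s + x" "\<And>x. x \<in> V \<Longrightarrow> \<bar>x\<bar> \<le> H" "0 \<in> V"
    and H: "0 < H" "120 * H ^ 6 < p"
    and T: "\<And>n::int. n \<noteq> 0 \<Longrightarrow> \<bar>n\<bar> \<le> p ^ 20 \<Longrightarrow> card {d. d dvd n} \<le> T"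
  defines "S \<equiv> {(x1, x2, x3, y2, y3). x1 \<in> V \<and> x2 \<in> V \<and> x3 \<in> V \<and> y2 \<in> V \<and> y3 \<in> V \<and>
      x1 \<noteq> 0 \<and> x2 \<noteq> 0 \<and> x3 \<noteq> 0 \<and> p dvd (s + x1) * (s + x2) * (s + x3) - s * (s + y2) * (s + y3)}"
  shows "real (card S) \<le> 8 * real T ^ 3 * ((real (card V))\<^sup>2 + 252 * real_of_int H ^ 4 / sqrt p)"
proof -
  define G where "G = {(a, b, c). \<bar>a\<bar> \<le> H ^ 3 \<and> \<bar>b\<bar> \<le> 4 * H\<^sup>2 \<and> \<bar>c\<bar> \<le> 5 * H \<and> p dvd a + b * s + c * s\<^sup>2}"
  define f where "f x = (case x of (x1, x2, x3, y2, y3) \<Rightarrow>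
    (x1 * x2 * x3, x1 * x2 + x1 * x3 + x2 * x3 - y2 * y3, x1 + x2 + x3 - y2 - y3))"
    for x :: "int \<times> int \<times> int \<times> int \<times> int"
  have Hp: "H ^ i \<le> H ^ j" if "i \<le> j" for i j using that H(1) by (intro power_increasing) auto
  have H1: "1 \<le> H" using H(1) by simp
  have H6: "1 \<le> H ^ 6" using H1 by (rule one_le_power)
  have p120: "120 < p" using H(2) H6 by linarith
  have pp: "p ^ i \<le> p ^ j" if "i \<le> j" for i j using that p120 by (intro power_increasing) auto
  have nd: "\<not> p dvd x" if "x \<noteq> 0" "\<bar>x\<bar> \<le> 120 * H ^ 6" for x
    using that dvd_small_zero[of p x] H(2) by linarith
  have pos: "0 < H ^ 3" "0 < 4 * H\<^sup>2" "0 < 5 * H" using H(1) by simp_all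
  have small: "6 * H ^ 3 * (4 * H\<^sup>2) * (5 * H) < p"
  proof -
    have "6 * H ^ 3 * (4 * H\<^sup>2) * (5 * H) = 120 * H ^ 6" by (simp add: power_numeral_reduce)
    thus ?thesis using H(2) by simp
  qed
  have "S \<subseteq> V \<times> V \<times> V \<times> V \<times> V" unfolding S_def by auto
  hence finS: "finite S" using V(1) by (meson finite_SigmaI finite_subset)
  have fS: "f (x1, x2, x3, y2, y3) \<in> G" "x1 * x2 * x3 \<noteq> 0" "y2 \<in> V" "y3 \<in> V"
    if x: "(x1, x2, x3, y2, y3) \<in> S" for x1 x2 x3 y2 y3
  proof -
    have e: "x1 \<in> V" "x2 \<in> V" "x3 \<in> V" "y2 \<in> V" "y3 \<in> V" "x1 \<noteq> 0" "x2 \<noteq> 0" "x3 \<noteq> 0"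
      "p dvd (s + x1) * (s + x2) * (s + x3) - s * (s + y2) * (s + y3)"
      using x unfolding S_def by auto
    note b = V(3)[OF e(1)] V(3)[OF e(2)] V(3)[OF e(3)] V(3)[OF e(4)] V(3)[OF e(5)]
    have "\<bar>x1 * x2 * x3\<bar> \<le> H * H * H" by (intro abs_mult_le b)
    moreover have "\<bar>x1 * x2 + x1 * x3 + x2 * x3 - y2 * y3\<bar> \<le> 4 * (H * H)"
      using abs_mult_le[OF b(1,2)] abs_mult_le[OF b(1,3)] abs_mult_le[OF b(2,3)] abs_mult_le[OF b(4,5)]
      by linarith
    moreover have "\<bar>x1 + x2 + x3 - y2 - y3\<bar> \<le> 5 * H" using b by linarith
    moreover have "(x1 * x2 * x3) + (x1 * x2 + x1 * x3 + x2 * x3 - y2 * y3) * s + (x1 + x2 + x3 - y2 - y3) * s\<^sup>2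
      = (s + x1) * (s + x2) * (s + x3) - s * (s + y2) * (s + y3)"
      by (simp add: algebra_simps power2_eq_square)
    ultimately show "f (x1, x2, x3, y2, y3) \<in> G"
      unfolding G_def f_def using e(9) by (simp add: power2_eq_square power3_eq_cube)
    show "x1 * x2 * x3 \<noteq> 0" "y2 \<in> V" "y3 \<in> V" using e by auto
  qed
  have "G \<subseteq> {-(H^3)..H^3} \<times> {-(4*H\<^sup>2)..4*H\<^sup>2} \<times> {-(5*H)..5*H}" unfolding G_def by auto
  hence finG: "finite G" by (rule finite_subset) auto
  have H12: "H ^ 12 \<le> p\<^sup>2"
  proof -
    have "(H ^ 6)\<^sup>2 \<le> p\<^sup>2" using H(2) H6 by (intro power_mono) auto
    thus ?thesis by (simp flip: power_mult)
  qed
  \<comment> \<open>The constant is \<open>10 * (40 + 10)\<^sup>2\<close>, from the sizes of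
    \<open>e\<close> and \<open>h\<close> in the case of a common rational root.\<close>
  have H12': "25000 * H ^ 12 \<le> p ^ 20"
  proof -
    have "120 ^ 3 \<le> p ^ 3" using p120 by (intro power_mono) auto
    hence "25000 * H ^ 12 \<le> p ^ 3 * p\<^sup>2" using H12 H1 p120 by (intro mult_mono) auto
    also have "\<dots> \<le> p ^ 20" using pp[of 5 20] by (simp flip: power_add)
    finally show ?thesis .
  qed
  have goal_line: ?thesis if "card S \<le> (card V)\<^sup>2 * (8 * T ^ 3)"
  proof -
    have "real (card S) \<le> real ((card V)\<^sup>2 * (8 * T ^ 3))" using that by (simp only: of_nat_le_iff)
    moreover have "0 \<le> 8 * real T ^ 3 * (252 * real_of_int H ^ 4 / sqrt p)" using H1 p120 by simp
    ultimately show ?thesis by (simp add: algebra_simps)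
  qed
  \<comment> \<open>Shared by three cases below: all lattice polynomials have the common root
    \<open>- e / h\<close>, which reduces to \<open>s\<close> modulo \<open>p\<close>.\<close>
  have linear: ?thesis if ef: "h \<noteq> 0" "\<bar>h\<bar> \<le> 40 * H ^ 3" "\<bar>e\<bar> \<le> 10 * H ^ 4" "p dvd e + h * s"
    "\<And>a b c. (a, b, c) \<in> G \<Longrightarrow> a * h\<^sup>2 - b * e * h + c * e\<^sup>2 = 0" for e h
  proof (rule goal_line, rule linear_root_count[where f = h and e = e and H = H and
      E = "10 * H ^ 4" and F = "40 * H ^ 3" and M = "p ^ 20", OF p V finS])
    fix x1 x2 x3 y2 y3 assume "(x1, x2, x3, y2, y3) \<in> S"
    from fS[OF this] ef(5) show "y2 \<in> V \<and> y3 \<in> V \<and>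
      (x1 * x2 * x3) * h\<^sup>2 - (x1 * x2 + x1 * x3 + x2 * x3 - y2 * y3) * e * h
        + (x1 + x2 + x3 - y2 - y3) * e\<^sup>2 = 0"
      unfolding f_def by auto
  next
    show "\<not> p dvd h" using ef(1,2) Hp[of 3 6] H6 by (intro nd) auto
    have "10 * H ^ 4 * ((40 * H ^ 3 * H + 10 * H ^ 4) * (40 * H ^ 3 * H + 10 * H ^ 4)) = 25000 * H ^ 12"
      by (simp add: power_numeral_reduce)
    thus "10 * H ^ 4 * ((40 * H ^ 3 * H + 10 * H ^ 4) * (40 * H ^ 3 * H + 10 * H ^ 4)) \<le> p ^ 20"
      using H12' by simp
  qed (use ef T in auto)
  show ?thesis
  proof (cases "G - {(0, 0, 0)} = {}")
    case True
    have "S = {}"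
    proof (rule ccontr)
      assume "S \<noteq> {}"
      then obtain x1 x2 x3 y2 y3 where x: "(x1, x2, x3, y2, y3) \<in> S" by auto
      from fS(1,2)[OF this] True show False unfolding f_def by auto
    qed
    thus ?thesis by (intro goal_line) simp
  next
    case False
    show ?thesis
    proof (rule lattice_points_cases_3d[OF pos small, of s, folded G_def, OF False])
      fix a b c assume v: "(a, b, c) \<in> G" "(a, b, c) \<noteq> (0, 0, 0)"
        and line: "\<And>a' b' c'. (a', b', c') \<in> G \<Longrightarrow> a * b' = a' * b \<and> a * c' = a' * c \<and> b * c' = b' * c"
      have vb: "\<bar>a\<bar> \<le> H ^ 3" "\<bar>b\<bar> \<le> 4 * H\<^sup>2" "\<bar>c\<bar> \<le> 5 * H" "p dvd a + b * s + c * s\<^sup>2"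
        using v(1) unfolding G_def by auto
      show ?thesis
      proof (cases "c = 0")
        case c: True
        have b0: "b \<noteq> 0"
        proof
          assume "b = 0"
          hence "p dvd a" "a \<noteq> 0" using vb c v(2) by auto
          moreover have "\<bar>a\<bar> \<le> 120 * H ^ 6" using vb(1) Hp[of 3 6] H6 by linarith
          ultimately show False using nd by blast
        qed
        show ?thesis
        proof (rule linear[of b a])
          show "\<bar>b\<bar> \<le> 40 * H ^ 3" using vb(2) Hp[of 2 3] pos by linarith
          show "\<bar>a\<bar> \<le> 10 * H ^ 4" using vb(1) Hp[of 3 4] pos by linarith
          fix a' b' c' assume "(a', b', c') \<in> G"
          from line[OF this] c b0 have "a * b' = a' * b" "c' = 0" by auto
          thus "a' * b\<^sup>2 - b' * a * b + c' * a\<^sup>2 = 0" by algebra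
        qed (use vb c b0 in auto)
      next
        case c: False
        show ?thesis
        proof (cases "\<exists>r\<in>V. c * r\<^sup>2 - b * r + a = 0")
          case True
          \<comment> \<open>The polynomial factors as
            \<open>(X + r) * (c * X + (b - c * r))\<close>. The first factor does not vanish at
            \<open>s\<close> modulo \<open>p\<close>, so the second one does and provides the common
            root.\<close>
          then obtain r where r: "r \<in> V" "c * r\<^sup>2 - b * r + a = 0" by blast
          show ?thesis
          proof (rule linear[of c "b - c * r"])
            show "\<bar>c\<bar> \<le> 40 * H ^ 3" using vb(3) Hp[of 1 3] pos by simp
            have "\<bar>c * r\<bar> \<le> 5 * H * H" by (intro abs_mult_le vb V r)
            hence "\<bar>b - c * r\<bar> \<le> 9 * H\<^sup>2" using vb(2) unfolding power2_eq_square by linarith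
            thus "\<bar>b - c * r\<bar> \<le> 10 * H ^ 4" using Hp[of 2 4] pos by linarith
            have "(s + r) * ((b - c * r) + c * s) = a + b * s + c * s\<^sup>2 - (c * r\<^sup>2 - b * r + a)"
              by (simp add: algebra_simps power2_eq_square)
            hence "p dvd (s + r) * ((b - c * r) + c * s)" using vb(4) r(2) by simp
            thus "p dvd (b - c * r) + c * s" using p V(2)[OF r(1)] by (simp add: prime_dvd_mult_iff)
            fix a' b' c' assume "(a', b', c') \<in> G"
            from line[OF this] r(2) show "a' * c\<^sup>2 - b' * (b - c * r) * c + c' * (b - c * r)\<^sup>2 = 0"
              by algebra
          qed (use c in auto)
        next
          case nr: False
          show ?thesis
          proof (rule goal_line, rule quadratic_count[where a = a and b = b and c = c and Q = "10 * H ^ 3" and M = "p ^ 20"])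
            fix x assume x: "x \<in> V"
            show "c * x\<^sup>2 - b * x + a \<noteq> 0" using nr x by blast
            have "\<bar>b * x\<bar> \<le> 4 * H\<^sup>2 * H" "\<bar>c * (x * x)\<bar> \<le> 5 * H * (H * H)"
              by (intro abs_mult_le vb V x)+
            thus "\<bar>c * x\<^sup>2 - b * x + a\<bar> \<le> 10 * H ^ 3"
              using vb(1) unfolding power2_eq_square power3_eq_cube by linarith
          next
            fix x1 x2 x3 y2 y3 assume xS: "(x1, x2, x3, y2, y3) \<in> S"
            from fS(3,4)[OF xS] line[OF fS(1)[OF xS, unfolded f_def prod.case]] show "y2 \<in> V \<and> y3 \<in> V \<and>
              a * (x1 + x2 + x3 - y2 - y3) = (x1 * x2 * x3) * c \<and>
              b * (x1 + x2 + x3 - y2 - y3) = (x1 * x2 + x1 * x3 + x2 * x3 - y2 * y3) * c"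
              by blast
          next
            have "10 * H ^ 3 * (10 * H ^ 3) * (10 * H ^ 3) = 1000 * H ^ 9" by (simp add: power_numeral_reduce)
            also have "\<dots> \<le> 25000 * H ^ 12" using Hp[of 9 12] H1 by (intro mult_mono) auto
            finally show "10 * H ^ 3 * (10 * H ^ 3) * (10 * H ^ 3) \<le> p ^ 20" using H12' by linarith
          qed (use V finS c T in auto)
        qed
      qed
    next
      fix v1 v2 v3 w1 w2 w3
      assume v: "(v1, v2, v3) \<in> G" and w: "(w1, w2, w3) \<in> G"
        and ind: "\<not> (v1 * w2 = w1 * v2 \<and> v1 * w3 = w1 * v3 \<and> v2 * w3 = w2 * v3)"
        and res: "(v1 * w3 - w1 * v3)\<^sup>2 = (v1 * w2 - w1 * v2) * (v2 * w3 - w2 * v3)"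
      have vb: "\<bar>v1\<bar> \<le> H ^ 3" "\<bar>v2\<bar> \<le> 4 * H\<^sup>2" "\<bar>v3\<bar> \<le> 5 * H" "p dvd v1 + v2 * s + v3 * s\<^sup>2"
        using v unfolding G_def by auto
      have wb: "\<bar>w1\<bar> \<le> H ^ 3" "\<bar>w2\<bar> \<le> 4 * H\<^sup>2" "\<bar>w3\<bar> \<le> 5 * H" "p dvd w1 + w2 * s + w3 * s\<^sup>2"
        using w unfolding G_def by auto
      note cong = lattice_minors_cong[OF vb(4) wb(4)]
      define m12 where "m12 = v1 * w2 - w1 * v2"
      define m13 where "m13 = v1 * w3 - w1 * v3"
      define m23 where "m23 = v2 * w3 - w2 * v3"
      have "\<bar>v1 * w2\<bar> \<le> H ^ 3 * (4 * H\<^sup>2)" "\<bar>w1 * v2\<bar> \<le> H ^ 3 * (4 * H\<^sup>2)" by (intro abs_mult_le vb wb)+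
      hence b12: "\<bar>m12\<bar> \<le> 8 * H ^ 5" unfolding m12_def by (simp add: power_numeral_reduce)
      have "\<bar>v1 * w3\<bar> \<le> H ^ 3 * (5 * H)" "\<bar>w1 * v3\<bar> \<le> H ^ 3 * (5 * H)" by (intro abs_mult_le vb wb)+
      hence b13: "\<bar>m13\<bar> \<le> 10 * H ^ 4" unfolding m13_def by (simp add: power_numeral_reduce)
      have "\<bar>v2 * w3\<bar> \<le> 4 * H\<^sup>2 * (5 * H)" "\<bar>w2 * v3\<bar> \<le> 4 * H\<^sup>2 * (5 * H)" by (intro abs_mult_le vb wb)+
      hence b23: "\<bar>m23\<bar> \<le> 40 * H ^ 3" unfolding m23_def by (simp add: power_numeral_reduce)
      have res': "m13\<^sup>2 = m12 * m23" using res unfolding m12_def m13_def m23_def .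
      have ndvd_s: "\<not> p dvd s" using V(2)[OF V(4)] by simp
      \<comment> \<open>If \<open>m23\<close> were zero, then so would be \<open>m13\<close>, and
        \<open>m12\<close> would be a nonzero multiple of \<open>p\<close> that is too
        small.\<close>
      have "m23 \<noteq> 0"
      proof
        assume 0: "m23 = 0"
        hence 1: "m13 = 0" using res' by simp
        hence "p dvd m12 * s" using cong(2) unfolding m13_def m12_def by simp
        hence "p dvd m12" using p ndvd_s by (simp add: prime_dvd_mult_iff)
        moreover have "m12 \<noteq> 0" using ind 0 1 unfolding m12_def m13_def m23_def by auto
        moreover have "\<bar>m12\<bar> \<le> 120 * H ^ 6" using b12 Hp[of 5 6] H6 by linarith
        ultimately show False using nd by blast
      qed
      thus ?thesis
      proof (rule linear[of m23 m13, OF _ b23 b13])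
        show "p dvd m13 + m23 * s" using cong(1) unfolding m13_def m23_def .
        fix a b c assume "(a, b, c) \<in> G"
        hence "\<bar>a\<bar> \<le> H ^ 3" "\<bar>b\<bar> \<le> 4 * H\<^sup>2" "\<bar>c\<bar> \<le> 5 * H" "p dvd a + b * s + c * s\<^sup>2"
          unfolding G_def by auto
        \<comment> \<open>Coplanarity multiplied by \<open>m23\<close>, together with the zero
          resultant, shows that every lattice polynomial of the box vanishes at
          \<open>- m13 / m23\<close>.\<close>
        from lattice_det_zero[OF pos small this vb wb]
        have "a * m23 - b * m13 + c * m12 = 0" unfolding m12_def m13_def m23_def .
        with res' show "a * m23\<^sup>2 - b * m13 * m23 + c * m13\<^sup>2 = 0" by algebra
      qed
    next
      assume few: "real (card G) \<le> 12 * sqrt (real_of_int (4 * (H ^ 3)\<^sup>2 * (5 * H)\<^sup>2 + 4 * H ^ 3 * (4 * H\<^sup>2)\<^sup>2 * (5 * H)) / real_of_int p)"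
      \<comment> \<open>Here 420 is at most the square of 21, and 252 below is 12 times 21.\<close>
      have "4 * (H ^ 3)\<^sup>2 * (5 * H)\<^sup>2 + 4 * H ^ 3 * (4 * H\<^sup>2)\<^sup>2 * (5 * H) = 420 * H ^ 8"
        by (simp add: power_numeral_reduce)
      also have "\<dots> \<le> (21 * H ^ 4)\<^sup>2" using H1 by (simp add: power_mult_distrib flip: power_mult)
      finally have "real_of_int (4 * (H ^ 3)\<^sup>2 * (5 * H)\<^sup>2 + 4 * H ^ 3 * (4 * H\<^sup>2)\<^sup>2 * (5 * H))
        \<le> real_of_int ((21 * H ^ 4)\<^sup>2)" by (simp only: of_int_le_iff)
      hence "sqrt (real_of_int (4 * (H ^ 3)\<^sup>2 * (5 * H)\<^sup>2 + 4 * H ^ 3 * (4 * H\<^sup>2)\<^sup>2 * (5 * H)) / real_of_int p)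
        \<le> sqrt ((21 * real_of_int H ^ 4)\<^sup>2 / p)"
        using p120 by (intro real_sqrt_le_mono divide_right_mono) auto
      also have "\<dots> = 21 * real_of_int H ^ 4 / sqrt p"
        using H1 by (simp only: real_sqrt_divide real_sqrt_abs) simp
      finally have cG: "real (card G) \<le> 252 * real_of_int H ^ 4 / sqrt p" using few by simp
      \<comment> \<open>A lattice point fixes \<open>x1 * x2 * x3\<close>, hence the
        \<open>xi\<close> up to divisors. Then the sum and the product of \<open>y2\<close>,
        \<open>y3\<close> are known, and the tag \<open>y2 \<le> y3\<close> orders them.\<close>
      have "card S \<le> card G * (8 * T ^ 3)"
      proof (rule card_le_fiber_bound[of S G f])
        show "f ` S \<subseteq> G" using fS(1) by auto
        fix y assume "y \<in> G"
        obtain A B C where y: "y = (A, B, C)" "\<bar>A\<bar> \<le> H ^ 3" using \<open>y \<in> G\<close> unfolding G_def by auto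
        let ?F = "{x \<in> S. f x = y}"
        have F: "\<exists>x1 x2 x3 y2 y3. x = (x1, x2, x3, y2, y3) \<and> A = x1 * x2 * x3 \<and> A \<noteq> 0 \<and>
          B = x1 * x2 + x1 * x3 + x2 * x3 - y2 * y3 \<and> C = x1 + x2 + x3 - y2 - y3" if "x \<in> ?F" for x
        proof -
          obtain x1 x2 x3 y2 y3 where x: "x = (x1, x2, x3, y2, y3)" by (cases x)
          show ?thesis using that fS(2)[of x1 x2 x3 y2 y3] unfolding x f_def y by auto
        qed
        show "card ?F \<le> 8 * T ^ 3"
        proof (cases "?F = {}")
          case True
          thus ?thesis by (metis card.empty le0)
        next
          case False
          hence A0: "A \<noteq> 0" using F by blast
          show ?thesis
          proof (rule card_le_divisor_triples[where n = A and M = "p ^ 20" and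
              h = "\<lambda>(x1, x2, x3, y2, y3). (y2 \<le> y3, True, True)" and
              ?g1.0 = "\<lambda>(x1, x2, x3, y2, y3). x1" and ?g2.0 = "\<lambda>(x1, x2, x3, y2, y3). x2" and
              ?g3.0 = "\<lambda>(x1, x2, x3, y2, y3). x3"])
            have "H ^ 3 \<le> 25000 * H ^ 12" using Hp[of 3 12] pos by linarith
            thus "\<bar>A\<bar> \<le> p ^ 20" using y(2) H12' by linarith
          next
            fix x assume "x \<in> ?F"
            from F[OF this] show "(case x of (x1, x2, x3, y2, y3) \<Rightarrow> x1) dvd A"
              "(case x of (x1, x2, x3, y2, y3) \<Rightarrow> x2) dvd A"
              "(case x of (x1, x2, x3, y2, y3) \<Rightarrow> x3) dvd A" by auto
          next
            show "inj_on (\<lambda>x. ((case x of (x1, x2, x3, y2, y3) \<Rightarrow> x1),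
              (case x of (x1, x2, x3, y2, y3) \<Rightarrow> x2), (case x of (x1, x2, x3, y2, y3) \<Rightarrow> x3),
              case x of (x1, x2, x3, y2, y3) \<Rightarrow> (y2 \<le> y3, True, True))) ?F"
            proof (rule inj_onI)
              fix x x' assume x: "x \<in> ?F" "x' \<in> ?F" and eq: "((case x of (x1, x2, x3, y2, y3) \<Rightarrow> x1),
                (case x of (x1, x2, x3, y2, y3) \<Rightarrow> x2), (case x of (x1, x2, x3, y2, y3) \<Rightarrow> x3),
                case x of (x1, x2, x3, y2, y3) \<Rightarrow> (y2 \<le> y3, True, True)) =
                ((case x' of (x1, x2, x3, y2, y3) \<Rightarrow> x1),
                (case x' of (x1, x2, x3, y2, y3) \<Rightarrow> x2), (case x' of (x1, x2, x3, y2, y3) \<Rightarrow> x3),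
                case x' of (x1, x2, x3, y2, y3) \<Rightarrow> (y2 \<le> y3, True, True))"
              obtain x1 x2 x3 y2 y3 where e: "x = (x1, x2, x3, y2, y3)"
                "B = x1 * x2 + x1 * x3 + x2 * x3 - y2 * y3" "C = x1 + x2 + x3 - y2 - y3"
                using F[OF x(1)] by auto
              obtain z1 z2 z3 w2 w3 where e': "x' = (z1, z2, z3, w2, w3)"
                "B = z1 * z2 + z1 * z3 + z2 * z3 - w2 * w3" "C = z1 + z2 + z3 - w2 - w3"
                using F[OF x(2)] by auto
              have z: "z1 = x1" "z2 = x2" "z3 = x3" "(y2 \<le> y3) = (w2 \<le> w3)" using eq unfolding e(1) e'(1) by auto
              have sum: "w2 + w3 = y2 + y3" and prod: "w2 * w3 = y2 * y3" using e(2,3) e'(2,3) unfolding z by auto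
              have "(w2 - y2) * (w2 - y3) = 0" using sum prod by algebra
              hence "w2 = y2 \<or> w2 = y3" by auto
              hence "w2 = y2 \<and> w3 = y3" using sum z(4) by auto
              thus "x = x'" unfolding e(1) e'(1) z by simp
            qed
          qed (use A0 T in auto)
        qed
      qed (use finS finG in auto)
      hence "real (card S) \<le> real (card G * (8 * T ^ 3))" by (simp only: of_nat_le_iff)
      also have "\<dots> = 8 * real T ^ 3 * real (card G)" by simp
      also have "\<dots> \<le> 8 * real T ^ 3 * ((real (card V))\<^sup>2 + 252 * real_of_int H ^ 4 / sqrt p)"
        using cG by (intro mult_left_mono) (auto intro: order.trans)
      finally show ?thesis .
    qed
  qed
qed

text \<open>Solutions with a left factor equal to the fixed \<open>s\<close> reduce to products of
  two. This happens in three positions, each contributing at most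
  \<open>4 * T * (card U)\<^sup>2\<close>, hence 20 = 8 + 12; and 2016 = 8 * 252.\<close>

lemma energy3_le:
  fixes p H :: int and U :: "int set" and T :: nat
  assumes p: "prime p" and U: "finite U" "\<And>u. u \<in> U \<Longrightarrow> \<not> p dvd u"
    and H: "0 < H" "120 * H ^ 6 < p" "\<And>u u'. u \<in> U \<Longrightarrow> u' \<in> U \<Longrightarrow> \<bar>u - u'\<bar> < H"
    and T: "\<And>n::int. n \<noteq> 0 \<Longrightarrow> \<bar>n\<bar> \<le> p ^ 20 \<Longrightarrow> card {d. d dvd n} \<le> T"
  shows "real (energy3 p U)
    \<le> real (card U) * (real T ^ 3 * (20 * (real (card U))\<^sup>2 + 2016 * real_of_int H ^ 4 / sqrt p))"
proof -
  let ?F = "\<lambda>s. {(a, b, c, e, f). a \<in> U \<and> b \<in> U \<and> c \<in> U \<and> e \<in> U \<and> f \<in> U \<and> p dvd a * b * c - s * e * f}"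
  have fin: "finite (?F s)" for s
    by (rule finite_subset[of _ "U \<times> U \<times> U \<times> U \<times> U"]) (use U in auto)
  have H1: "1 \<le> H" using H(1) by simp
  have H6: "1 \<le> H ^ 6" "H ^ 1 \<le> H ^ 6" "H ^ 3 \<le> H ^ 6"
    using one_le_power[OF H1] power_increasing[OF _ H1, of 1 6] power_increasing[OF _ H1, of 3 6] by auto
  have p120: "120 < p" using H(2) H6 by linarith
  have T1: "1 \<le> T"
  proof -
    have "card {1::int} \<le> card {d::int. d dvd 1}" by (intro card_mono finite_divisors_int) auto
    also have "\<dots> \<le> T" using p120 one_le_power[of p 20] by (intro T) auto
    finally show ?thesis by simp
  qed
  \<comment> \<open>For intervals this short the term \<open>H ^ 3 / p\<close> of the two-factor
    bound is negligible.\<close>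
  have E2: "real (energy2 p U) \<le> 4 * real T * (real (card U))\<^sup>2"
  proof (cases "U = {}")
    case True
    thus ?thesis unfolding energy2_def by (simp add: split_def)
  next
    case False
    hence U1: "1 \<le> real (card U)" using U(1) by (simp add: Suc_le_eq card_gt_0_iff)
    have "72 * H ^ 3 \<le> p" using H(2) H6 by linarith
    hence "72 * real_of_int H ^ 3 \<le> real_of_int p" by (metis of_int_le_iff of_int_mult of_int_numeral of_int_power)
    hence "72 * real_of_int H ^ 3 / p \<le> 1" using p120 by simp
    hence h: "real (card U) + 72 * real_of_int H ^ 3 / p \<le> 2 * real (card U)" using U1 by linarith
    have "H \<le> p" using H(2) H6 by simp
    hence "real (energy2 p U) \<le> real (card U) * (2 * real (card U) + T * (real (card U) + 72 * real_of_int H ^ 3 / p))"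
      using energy2_le[OF p U H(1) _ H(3) T] by blast
    also have "\<dots> \<le> real (card U) * (2 * T * real (card U) + T * (2 * real (card U)))"
      using h T1 U1 by (intro mult_left_mono add_mono) auto
    finally show ?thesis by (simp add: power2_eq_square algebra_simps)
  qed
  let ?E = "{(a, b, c, d). a \<in> U \<and> b \<in> U \<and> c \<in> U \<and> d \<in> U \<and> p dvd a * b - c * d}"
  have finE: "finite ?E" by (rule finite_subset[of _ "U \<times> U \<times> U \<times> U"]) (use U in auto)
  have fixed: "real (card (?F s)) \<le> real T ^ 3 * (20 * (real (card U))\<^sup>2 + 2016 * real_of_int H ^ 4 / sqrt p)"
    if s: "s \<in> U" for s
  proof -
    define V where "V = (\<lambda>u. u - s) ` U"
    define S where "S = {(x1, x2, x3, y2, y3). x1 \<in> V \<and> x2 \<in> V \<and> x3 \<in> V \<and> y2 \<in> V \<and> y3 \<in> V \<and>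
      x1 \<noteq> 0 \<and> x2 \<noteq> 0 \<and> x3 \<noteq> 0 \<and> p dvd (s + x1) * (s + x2) * (s + x3) - s * (s + y2) * (s + y3)}"
    have cV: "card V = card U" unfolding V_def by (intro card_image) (auto simp: inj_on_def)
    have "finite V" "\<And>x. x \<in> V \<Longrightarrow> \<not> p dvd s + x" "\<And>x. x \<in> V \<Longrightarrow> \<bar>x\<bar> \<le> H" "0 \<in> V"
      unfolding V_def using U s H(3)[OF _ s] by (auto intro: less_imp_le)
    from nondegenerate_triples_count[OF p this H(1,2) T]
    have S: "real (card S) \<le> 8 * real T ^ 3 * ((real (card U))\<^sup>2 + 252 * real_of_int H ^ 4 / sqrt p)"
      unfolding S_def cV .
    have "S \<subseteq> V \<times> V \<times> V \<times> V \<times> V" unfolding S_def by auto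
    moreover have "finite V" unfolding V_def using U by simp
    ultimately have finS: "finite S" by (meson finite_SigmaI finite_subset)
    \<comment> \<open>The map \<open>g\<close> undoes the shift by \<open>s\<close>, and
      \<open>h1\<close>, \<open>h2\<close>, \<open>h3\<close> insert \<open>s\<close> at the first,
      second and third position.\<close>
    define g :: "int \<times> int \<times> int \<times> int \<times> int \<Rightarrow> int \<times> int \<times> int \<times> int \<times> int"
      where "g = (\<lambda>(x1, x2, x3, y2, y3). (s + x1, s + x2, s + x3, s + y2, s + y3))"
    define h1 :: "int \<times> int \<times> int \<times> int \<Rightarrow> int \<times> int \<times> int \<times> int \<times> int"
      where "h1 = (\<lambda>(a, b, c, d). (s, a, b, c, d))"
    define h2 :: "int \<times> int \<times> int \<times> int \<Rightarrow> int \<times> int \<times> int \<times> int \<times> int"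
      where "h2 = (\<lambda>(a, b, c, d). (a, s, b, c, d))"
    define h3 :: "int \<times> int \<times> int \<times> int \<Rightarrow> int \<times> int \<times> int \<times> int \<times> int"
      where "h3 = (\<lambda>(a, b, c, d). (a, b, s, c, d))"
    have "?F s \<subseteq> g ` S \<union> (h1 ` ?E \<union> (h2 ` ?E \<union> h3 ` ?E))"
    proof
      fix x assume "x \<in> ?F s"
      then obtain a b c e f where x: "x = (a, b, c, e, f)" "a \<in> U" "b \<in> U" "c \<in> U" "e \<in> U" "f \<in> U"
        "p dvd a * b * c - s * e * f" by auto
      have cancel: "p dvd u * v - e * f" if "a * b * c = s * (u * v)" for u v
      proof -
        have "p dvd s * (u * v - e * f)" using x(7) that by (simp add: algebra_simps)
        thus ?thesis using p U(2)[OF s] by (simp add: prime_dvd_mult_iff)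
      qed
      consider "a = s" | "b = s" | "c = s" | "a \<noteq> s" "b \<noteq> s" "c \<noteq> s" by blast
      thus "x \<in> g ` S \<union> (h1 ` ?E \<union> (h2 ` ?E \<union> h3 ` ?E))"
      proof cases
        case 1
        have "(b, c, e, f) \<in> ?E" using cancel[of b c] 1 x by simp
        hence "h1 (b, c, e, f) \<in> h1 ` ?E" by (rule imageI)
        moreover have "h1 (b, c, e, f) = x" unfolding h1_def x 1 by simp
        ultimately show ?thesis by simp
      next
        case 2
        have "(a, c, e, f) \<in> ?E" using cancel[of a c] 2 x by simp
        hence "h2 (a, c, e, f) \<in> h2 ` ?E" by (rule imageI)
        moreover have "h2 (a, c, e, f) = x" unfolding h2_def x 2 by simp
        ultimately show ?thesis by simp
      next
        case 3
        have "(a, b, e, f) \<in> ?E" using cancel[of a b] 3 x by simp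
        hence "h3 (a, b, e, f) \<in> h3 ` ?E" by (rule imageI)
        moreover have "h3 (a, b, e, f) = x" unfolding h3_def x 3 by simp
        ultimately show ?thesis by simp
      next
        case 4
        have "(a - s, b - s, c - s, e - s, f - s) \<in> S"
          unfolding S_def V_def using 4 x by auto
        hence "g (a - s, b - s, c - s, e - s, f - s) \<in> g ` S" by (rule imageI)
        moreover have "g (a - s, b - s, c - s, e - s, f - s) = x" unfolding g_def x by simp
        ultimately show ?thesis by simp
      qed
    qed
    hence "card (?F s) \<le> card (g ` S \<union> (h1 ` ?E \<union> (h2 ` ?E \<union> h3 ` ?E)))"
      using finS finE by (intro card_mono) auto
    also have "\<dots> \<le> card (g ` S) + (card (h1 ` ?E) + (card (h2 ` ?E) + card (h3 ` ?E)))"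
      by (meson add_mono card_Un_le le_refl order.trans)
    also have "\<dots> \<le> card S + (energy2 p U + (energy2 p U + energy2 p U))"
      unfolding energy2_def using finS finE by (intro add_mono card_image_le)
    finally have "real (card (?F s)) \<le> real (card S) + 3 * real (energy2 p U)" by linarith
    also have "\<dots> \<le> 8 * real T ^ 3 * ((real (card U))\<^sup>2 + 252 * real_of_int H ^ 4 / sqrt p)
        + 12 * (real T * (real (card U))\<^sup>2)"
      using S E2 by linarith
    also have "\<dots> \<le> 8 * real T ^ 3 * ((real (card U))\<^sup>2 + 252 * real_of_int H ^ 4 / sqrt p)
        + 12 * (real T ^ 3 * (real (card U))\<^sup>2)"
    proof -
      have "real T ^ 1 \<le> real T ^ 3" using T1 by (intro power_increasing) auto
      thus ?thesis by (intro add_left_mono mult_left_mono mult_right_mono) auto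
    qed
    finally show ?thesis by (simp add: algebra_simps)
  qed
  have "{(d, a, b, c, e, f). d \<in> U \<and> a \<in> U \<and> b \<in> U \<and> c \<in> U \<and> e \<in> U \<and> f \<in> U \<and>
     p dvd a * b * c - d * e * f} = Sigma U ?F" by auto
  hence "energy3 p U = card (Sigma U ?F)" unfolding energy3_def by simp
  thus ?thesis using card_sigma_le[OF U(1) fin fixed] by simp
qed

subsection \<open>Points on exponential curves\<close>

text \<open>Sums of two abscissae take fewer than \<open>2 * X\<close> values, and pairs with equal
  sums have congruent products of ordinates, so Cauchy--Schwarz applies.\<close>

lemma card4_le_energy2:
  fixes w :: "'i \<Rightarrow> int" and x :: "'i \<Rightarrow> nat"
  assumes S: "finite S" "inj_on w S" "\<And>i. i \<in> S \<Longrightarrow> x i < X"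
    and coll: "\<And>i j k l. i \<in> S \<Longrightarrow> j \<in> S \<Longrightarrow> k \<in> S \<Longrightarrow> l \<in> S \<Longrightarrow> x i + x j = x k + x l \<Longrightarrow>
      p dvd w i * w j - w k * w l"
  shows "card S ^ 4 \<le> 2 * X * energy2 p (w ` S)"
proof -
  let ?f = "\<lambda>(i, j). x i + x j" and ?A = "S \<times> S" and ?U = "w ` S"
  have "?f ` ?A \<subseteq> {..<2 * X}" using S(3) by (auto simp: add_strict_mono mult_2)
  hence im: "card (?f ` ?A) \<le> 2 * X" using card_mono[of "{..<2 * X}"] by fastforce
  let ?E = "{(a, b, c, d). a \<in> ?U \<and> b \<in> ?U \<and> c \<in> ?U \<and> d \<in> ?U \<and> p dvd a * b - c * d}"
  have "finite ?E" by (rule finite_subset[of _ "?U \<times> ?U \<times> ?U \<times> ?U"]) (use S in auto)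
  hence "card {(y, z) \<in> ?A \<times> ?A. ?f y = ?f z} \<le> card ?E"
    using S(2) coll
    by (intro card_inj_on_le[of "\<lambda>((i, j), (k, l)). (w i, w j, w k, w l)"]) (auto simp: inj_on_def)
  hence "card ?A ^ 2 \<le> 2 * X * energy2 p ?U"
    using card_squared_le_collisions[of ?A ?f] S(1) mult_le_mono[OF im] unfolding energy2_def
    by (meson finite_SigmaI order.trans)
  thus ?thesis by (simp add: card_cartesian_product power2_eq_square power_numeral_reduce mult_ac)
qed

lemma card6_le_energy3:
  fixes w :: "'i \<Rightarrow> int" and x :: "'i \<Rightarrow> nat"
  assumes S: "finite S" "inj_on w S" "\<And>i. i \<in> S \<Longrightarrow> x i < X"
    and coll: "\<And>i j k l m n. i \<in> S \<Longrightarrow> j \<in> S \<Longrightarrow> k \<in> S \<Longrightarrow> l \<in> S \<Longrightarrow> m \<in> S \<Longrightarrow> n \<in> S \<Longrightarrow>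
      x i + x j + x k = x l + x m + x n \<Longrightarrow> p dvd w i * w j * w k - w l * w m * w n"
  shows "card S ^ 6 \<le> 3 * X * energy3 p (w ` S)"
proof -
  let ?f = "\<lambda>(i, j, k). x i + x j + x k" and ?A = "S \<times> S \<times> S" and ?U = "w ` S"
  have "?f ` ?A \<subseteq> {..<3 * X}"
  proof
    fix y assume "y \<in> ?f ` ?A"
    then obtain i j k where "i \<in> S" "j \<in> S" "k \<in> S" "y = x i + x j + x k" by auto
    thus "y \<in> {..<3 * X}" using S(3)[of i] S(3)[of j] S(3)[of k] by simp
  qed
  hence im: "card (?f ` ?A) \<le> 3 * X" using card_mono[of "{..<3 * X}"] by fastforce
  let ?E = "{(d, a, b, c, e, f). d \<in> ?U \<and> a \<in> ?U \<and> b \<in> ?U \<and> c \<in> ?U \<and> e \<in> ?U \<and> f \<in> ?U \<and>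
     p dvd a * b * c - d * e * f}"
  have "finite ?E" by (rule finite_subset[of _ "?U \<times> ?U \<times> ?U \<times> ?U \<times> ?U \<times> ?U"]) (use S in auto)
  hence "card {(y, z) \<in> ?A \<times> ?A. ?f y = ?f z} \<le> card ?E"
    using S(2) coll
    by (intro card_inj_on_le[of "\<lambda>((i, j, k), (l, m, n)). (w l, w i, w j, w k, w m, w n)"])
      (auto simp: inj_on_def)
  hence "card ?A ^ 2 \<le> 3 * X * energy3 p ?U"
    using card_squared_le_collisions[of ?A ?f] S(1) mult_le_mono[OF im] unfolding energy3_def
    by (meson finite_SigmaI order.trans)
  thus ?thesis by (simp add: card_cartesian_product power2_eq_square power_numeral_reduce mult_ac)
qed

text \<open>The shift of the ordinate is part of \<open>w\<close>: for an ordinate \<open>y\<close>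
  with residue \<open>b\<close>, \<open>w\<close> represents \<open>y + b / q\<close> modulo
  \<open>p\<close>, which turns the curve into a pure exponential. The last assumption provides the
  divisor bound.\<close>

locale exponential_curve =
  fixes p q g :: int and a c :: nat and S :: "'i set" and w :: "'i \<Rightarrow> int" and x :: "'i \<Rightarrow> nat"
    and X T :: nat
  assumes p: "prime p" and q: "\<not> p dvd q" and g: "\<not> p dvd g"
    and S: "finite S" "inj_on w S" "\<And>i. i \<in> S \<Longrightarrow> x i < X"
    and curve: "\<And>i. i \<in> S \<Longrightarrow> [q * w i = g ^ (c * x i + a)] (mod p)"
    and T: "\<And>n::int. n \<noteq> 0 \<Longrightarrow> \<bar>n\<bar> \<le> p ^ 20 \<Longrightarrow> card {d. d dvd n} \<le> T" "1 \<le> T"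
begin

lemma not_dvd_w: "i \<in> S \<Longrightarrow> \<not> p dvd w i"
proof
  assume i: "i \<in> S" and "p dvd w i"
  hence "p dvd q * w i" by simp
  hence "p dvd g ^ (c * x i + a)" using curve[OF i] by (simp add: cong_dvd_iff)
  thus False using g p prime_dvd_power by blast
qed

lemma collision2:
  assumes "i \<in> S" "j \<in> S" "k \<in> S" "l \<in> S" "x i + x j = x k + x l"
  shows "p dvd w i * w j - w k * w l"
proof -
  have mult: "[q\<^sup>2 * (w i * w j) = g ^ (c * (x i + x j) + 2 * a)] (mod p)" if "i \<in> S" "j \<in> S" for i j
  proof -
    have "q\<^sup>2 * (w i * w j) = (q * w i) * (q * w j)" by (simp add: power2_eq_square)
    moreover have "g ^ (c * (x i + x j) + 2 * a) = g ^ (c * x i + a) * g ^ (c * x j + a)"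
      unfolding power_add[symmetric] by (rule arg_cong[where f = "power g"]) (simp add: algebra_simps)
    ultimately show ?thesis using cong_mult[OF curve[OF that(1)] curve[OF that(2)]] by (simp only:)
  qed
  have "[q\<^sup>2 * (w i * w j) = q\<^sup>2 * (w k * w l)] (mod p)"
    using mult[OF assms(1,2)] mult[OF assms(3,4)] assms(5) by (metis cong_sym cong_trans)
  hence "p dvd q\<^sup>2 * (w i * w j - w k * w l)" by (simp add: cong_iff_dvd_diff right_diff_distrib)
  thus ?thesis using p q by (auto simp: prime_dvd_mult_iff power2_eq_square)
qed

lemma collision3:
  assumes "i \<in> S" "j \<in> S" "k \<in> S" "l \<in> S" "m \<in> S" "n \<in> S" "x i + x j + x k = x l + x m + x n"
  shows "p dvd w i * w j * w k - w l * w m * w n"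
proof -
  have mult: "[q ^ 3 * (w i * w j * w k) = g ^ (c * (x i + x j + x k) + 3 * a)] (mod p)"
    if "i \<in> S" "j \<in> S" "k \<in> S" for i j k
  proof -
    have "q ^ 3 * (w i * w j * w k) = (q * w i) * (q * w j) * (q * w k)" by (simp add: power3_eq_cube)
    moreover have "g ^ (c * (x i + x j + x k) + 3 * a) = g ^ (c * x i + a) * g ^ (c * x j + a) * g ^ (c * x k + a)"
      unfolding power_add[symmetric] by (rule arg_cong[where f = "power g"]) (simp add: algebra_simps)
    ultimately show ?thesis
      using cong_mult[OF cong_mult[OF curve[OF that(1)] curve[OF that(2)]] curve[OF that(3)]] by (simp only:)
  qed
  have "[q ^ 3 * (w i * w j * w k) = q ^ 3 * (w l * w m * w n)] (mod p)"
    using mult[OF assms(1-3)] mult[OF assms(4-6)] assms(7) by (metis cong_sym cong_trans)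
  hence "p dvd q ^ 3 * (w i * w j * w k - w l * w m * w n)" by (simp add: cong_iff_dvd_diff right_diff_distrib)
  thus ?thesis using p q by (auto simp: prime_dvd_mult_iff power3_eq_cube)
qed

text \<open>The energy bound carries a factor \<open>card S\<close>, which is cancelled against one
  of the four on the left.\<close>

lemma curve_points2:
  assumes H: "0 < H" "H \<le> p" "\<And>i j. i \<in> S \<Longrightarrow> j \<in> S \<Longrightarrow> \<bar>w i - w j\<bar> < H" and "S \<noteq> {}"
  shows "real (card S) ^ 3 \<le> 150 * real T * real X * (real (card S) + real_of_int H ^ 3 / p)"
proof -
  let ?R = "real (card S)" and ?h = "real_of_int H ^ 3 / p"
  have p0: "0 < p" using p prime_gt_0_int by blast
  have R: "0 < ?R" using S(1) \<open>S \<noteq> {}\<close> by (simp add: card_gt_0_iff)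
  have h: "0 \<le> ?h" using H p0 by simp
  have "card S ^ 4 \<le> 2 * X * energy2 p (w ` S)"
    by (rule card4_le_energy2[OF S collision2])
  hence "?R ^ 4 \<le> 2 * real X * real (energy2 p (w ` S))"
    by (metis of_nat_le_iff of_nat_mult of_nat_numeral of_nat_power)
  also have "\<dots> \<le> 2 * real X * (?R * (2 * ?R + T * (?R + 72 * real_of_int H ^ 3 / p)))"
    using energy2_le[OF p, of "w ` S" H T] S(1,2) not_dvd_w H T
    by (intro mult_left_mono) (auto simp: card_image)
  also have "\<dots> \<le> 2 * real X * (?R * (2 * T * ?R + T * (?R + 72 * ?h)))"
    using R T(2) by (intro mult_left_mono add_mono) auto
  also have "\<dots> = ?R * (2 * real T * real X * (3 * ?R + 72 * ?h))" by (simp add: algebra_simps)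
  also have "\<dots> \<le> ?R * (2 * real T * real X * (75 * ?R + 75 * ?h))"
    using R h by (intro mult_left_mono add_mono) auto
  finally have "?R * ?R ^ 3 \<le> ?R * (150 * real T * real X * (?R + ?h))"
    by (simp add: power_numeral_reduce algebra_simps)
  thus ?thesis using R by (rule mult_left_le_imp_le)
qed

lemma curve_points3:
  assumes H: "0 < H" "120 * H ^ 6 < p" "\<And>i j. i \<in> S \<Longrightarrow> j \<in> S \<Longrightarrow> \<bar>w i - w j\<bar> < H" and "S \<noteq> {}"
  shows "real (card S) ^ 5 \<le> 6048 * real T ^ 3 * real X * ((real (card S))\<^sup>2 + real_of_int H ^ 4 / sqrt p)"
proof -
  let ?R = "real (card S)" and ?h = "real_of_int H ^ 4 / sqrt p"
  have p0: "0 < p" using p prime_gt_0_int by blast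
  have R: "0 < ?R" using S(1) \<open>S \<noteq> {}\<close> by (simp add: card_gt_0_iff)
  have h: "0 \<le> ?h" using H p0 by simp
  have "card S ^ 6 \<le> 3 * X * energy3 p (w ` S)"
    by (rule card6_le_energy3[OF S collision3])
  hence "?R ^ 6 \<le> 3 * real X * real (energy3 p (w ` S))"
    by (metis of_nat_le_iff of_nat_mult of_nat_numeral of_nat_power)
  also have "\<dots> \<le> 3 * real X * (?R * (real T ^ 3 * (20 * ?R\<^sup>2 + 2016 * real_of_int H ^ 4 / sqrt p)))"
    using energy3_le[OF p, of "w ` S" H T] S(1,2) not_dvd_w H T
    by (intro mult_left_mono) (auto simp: card_image)
  also have "\<dots> \<le> 3 * real X * (?R * (real T ^ 3 * (2016 * ?R\<^sup>2 + 2016 * ?h)))"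
    using R by (intro mult_left_mono add_mono) auto
  finally have "?R * ?R ^ 5 \<le> ?R * (6048 * real T ^ 3 * real X * (?R\<^sup>2 + ?h))"
    by (simp add: power_numeral_reduce algebra_simps)
  thus ?thesis using R by (rule mult_left_le_imp_le)
qed

lemma exponential_curve_subset:
  assumes "S' \<subseteq> S"
  shows "exponential_curve p q g a c S' w x X T"
  using assms p q g S curve T by unfold_locales (auto intro: finite_subset inj_on_subset)

end

subsection \<open>Trajectories\<close>

text \<open>A coincidence \<open>u i = u j\<close> with \<open>i < j\<close> makes the sequence
  periodic from \<open>i\<close> on with period \<open>j - i\<close>. By minimality the period is at
  most \<open>j - i\<close> and the preperiod at most \<open>i\<close>, so \<open>j\<close> lies
  outside the trajectory.\<close>

lemma inj_on_trajectory:
  fixes u :: "nat \<Rightarrow> 'a"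
  assumes det: "\<And>m n. u m = u n \<Longrightarrow> u (Suc m) = u (Suc n)"
  shows "inj_on u {..<trajectory_length u}"
proof (rule linorder_inj_onI)
  fix i j assume ij: "i < j" "i \<in> {..<trajectory_length u}" "j \<in> {..<trajectory_length u}"
  let ?P = "\<lambda>t. 1 \<le> t \<and> (\<exists>s. \<forall>n\<ge>s. u n = u (n + t))"
  define t where "t = seq_period u"
  define s where "s = seq_preperiod u"
  have j: "j < s + t" using ij(3) unfolding trajectory_length_def t_def s_def by simp
  show "u i \<noteq> u j"
  proof
    assume eq: "u i = u j"
    have shift: "u (i + d) = u (j + d)" for d
    proof (induction d)
      case (Suc d)
      show ?case using det[OF Suc] by simp
    qed (use eq in simp)
    have per: "u n = u (n + (j - i))" if "i \<le> n" for n
      using shift[of "n - i"] that ij(1) by (simp add: add.commute)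
    have iter: "u n = u (n + m * (j - i))" if "i \<le> n" for n m
    proof (induction m)
      case (Suc m)
      have "u (n + m * (j - i)) = u (n + m * (j - i) + (j - i))" using that by (intro per) simp
      with Suc show ?case by (simp add: ac_simps)
    qed simp
    have "?P (j - i)" using per ij(1) by auto
    hence "?P t" "t \<le> j - i"
      unfolding t_def seq_period_def by (rule LeastI, rule Least_le)
    then obtain s' where "\<forall>n\<ge>s'. u n = u (n + t)" by blast
    hence s: "\<forall>n\<ge>s. u n = u (n + t)"
      unfolding s_def seq_preperiod_def t_def[symmetric] by (rule LeastI)
    have "\<forall>n\<ge>i. u n = u (n + t)"
    proof (intro allI impI)
      \<comment> \<open>Moving ahead by \<open>s\<close> copies of \<open>j - i\<close> reaches
        indices where the period \<open>t\<close> is already known.\<close>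
      fix n assume n: "i \<le> n"
      have "s * 1 \<le> s * (j - i)" using ij(1) by (intro mult_le_mono2) simp
      hence "s \<le> n + s * (j - i)" by linarith
      hence "u (n + s * (j - i)) = u (n + s * (j - i) + t)" using s by blast
      also have "\<dots> = u (n + t + s * (j - i))" by (simp add: ac_simps)
      also have "\<dots> = u (n + t)" using iter[of "n + t" s] n by simp
      finally show "u n = u (n + t)" using iter[of n s] n by simp
    qed
    hence "s \<le> i" unfolding s_def seq_preperiod_def t_def[symmetric] by (rule Least_le)
    with \<open>t \<le> j - i\<close> j ij(1) show False by linarith
  qed
qed auto

section \<open>Pigeonhole over consecutive pairs and basic facts on the sequence\<close>

lemma pigeonhole_consecutive:
  fixes \<xi> :: "nat \<Rightarrow> 'a"
  assumes "1 \<le> N" and R: "\<And>a b. card {n. n < N - 1 \<and> \<xi> n = a \<and> \<xi> (Suc n) = b} \<le> R"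
  shows "N - 1 \<le> (card (\<xi> ` {..<N}))\<^sup>2 * R"
proof -
  let ?B = "\<xi> ` {..<N} \<times> \<xi> ` {..<N}"
  have "card {..<N - 1} \<le> card ?B * R"
  proof (rule card_le_fiber_bound[of _ ?B "\<lambda>n. (\<xi> n, \<xi> (Suc n))"])
    fix y :: "'a \<times> 'a"
    obtain a b where y: "y = (a, b)" by (cases y)
    have "{n \<in> {..<N - 1}. (\<xi> n, \<xi> (Suc n)) = y} = {n. n < N - 1 \<and> \<xi> n = a \<and> \<xi> (Suc n) = b}"
      unfolding y by auto
    thus "card {n \<in> {..<N - 1}. (\<xi> n, \<xi> (Suc n)) = y} \<le> R" using R by simp
  qed auto
  thus ?thesis by (simp add: card_cartesian_product power2_eq_square)
qed

lemma exp_seq_range: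
  assumes "prime p" "\<not> int p dvd g" "u0 \<in> {1..p - 1}"
  shows "exp_seq p g u0 n < p"
proof (cases n)
  case 0
  thus ?thesis using assms(3) by auto
next
  case (Suc m)
  have "0 < p" using assms(1) prime_gt_0_nat by blast
  thus ?thesis unfolding Suc by (simp add: nat_less_iff)
qed

lemma exp_seq_cong:
  assumes "prime p"
  shows "[int (exp_seq p g u0 (Suc n)) = g ^ exp_seq p g u0 n] (mod int p)"
proof -
  have "0 < p" using assms(1) prime_gt_0_nat by blast
  thus ?thesis by (simp add: cong_def)
qed

section \<open>Point counts in logarithmic form\<close>

lemma ln_le_of_power_le:
  fixes R B D :: real
  assumes "0 < R" "R ^ n \<le> B" "ln B \<le> D"
  shows "real n * ln R \<le> D"
proof -
  have "0 < R ^ n" using assms(1) by simp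
  hence "ln (R ^ n) \<le> ln B" using assms(2) by (subst ln_le_cancel_iff) linarith+
  thus ?thesis using assms by (simp add: ln_realpow)
qed

text \<open>The two alternatives correspond to the dominating summand of the bracket; doubling it
  turns 150 into 300.\<close>

lemma curve_points2_ln:
  fixes R T M p :: real
  assumes "1 \<le> R" "1 \<le> T" "1 \<le> M" "1 \<le> p" and "R ^ 3 \<le> 150 * T * M * (R + M ^ 3 / p)"
  shows "2 * ln R \<le> ln 300 + ln T + ln M \<or> 3 * ln R \<le> ln 300 + ln T + 4 * ln M - ln p"
proof (cases "M ^ 3 / p \<le> R")
  case True
  have "150 * T * M * (R + M ^ 3 / p) \<le> 150 * T * M * (R + R)"
    using assms True by (intro mult_left_mono) auto
  hence "R * R\<^sup>2 \<le> R * (300 * T * M)"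
    using assms(5) by (simp add: power2_eq_square power3_eq_cube algebra_simps)
  hence "R\<^sup>2 \<le> 300 * T * M" using assms(1) by simp
  moreover have "ln (300 * T * M) \<le> ln 300 + ln T + ln M" using assms by (simp add: ln_mult)
  ultimately show ?thesis using ln_le_of_power_le[of R 2 "300 * T * M"] assms(1) by simp
next
  case False
  have "150 * T * M * (R + M ^ 3 / p) \<le> 150 * T * M * (M ^ 3 / p + M ^ 3 / p)"
    using assms False by (intro mult_left_mono) auto
  hence "R ^ 3 \<le> 300 * T * M ^ 4 / p"
    using assms(5) by (simp add: power_numeral_reduce algebra_simps)
  moreover have "ln (300 * T * M ^ 4 / p) \<le> ln 300 + ln T + 4 * ln M - ln p"
    using assms by (simp add: ln_mult ln_div ln_realpow)
  ultimately show ?thesis using ln_le_of_power_le[of R 3 "300 * T * M ^ 4 / p"] assms(1) by simp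
qed

lemma curve_points3_ln:
  fixes R T M H p :: real
  assumes "1 \<le> R" "1 \<le> T" "1 \<le> M" "1 \<le> H" "1 \<le> p"
    and "R ^ 5 \<le> 6048 * T ^ 3 * M * (R\<^sup>2 + H ^ 4 / sqrt p)"
  shows "3 * ln R \<le> ln 12096 + 3 * ln T + ln M \<or>
    5 * ln R \<le> ln 12096 + 3 * ln T + ln M + 4 * ln H - ln p / 2"
proof (cases "H ^ 4 / sqrt p \<le> R\<^sup>2")
  case True
  have "6048 * T ^ 3 * M * (R\<^sup>2 + H ^ 4 / sqrt p) \<le> 6048 * T ^ 3 * M * (R\<^sup>2 + R\<^sup>2)"
    using assms True by (intro mult_left_mono) auto
  hence "R ^ 5 \<le> R\<^sup>2 * (12096 * T ^ 3 * M)" using assms(6) by (simp add: algebra_simps)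
  moreover have "R ^ 5 = R\<^sup>2 * R ^ 3" by (simp flip: power_add)
  moreover have "0 < R\<^sup>2" using assms(1) by simp
  ultimately have "R ^ 3 \<le> 12096 * T ^ 3 * M" by (metis mult_left_le_imp_le)
  moreover have "ln (12096 * T ^ 3 * M) \<le> ln 12096 + 3 * ln T + ln M"
    using assms by (simp add: ln_mult ln_realpow)
  ultimately show ?thesis using ln_le_of_power_le[of R 3 "12096 * T ^ 3 * M"] assms(1) by simp
next
  case False
  have "6048 * T ^ 3 * M * (R\<^sup>2 + H ^ 4 / sqrt p) \<le> 6048 * T ^ 3 * M * (H ^ 4 / sqrt p + H ^ 4 / sqrt p)"
    using assms False by (intro mult_left_mono) auto
  hence "R ^ 5 \<le> 12096 * T ^ 3 * M * H ^ 4 / sqrt p"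
    using assms(6) by (simp add: power_numeral_reduce algebra_simps)
  moreover have "ln (12096 * T ^ 3 * M * H ^ 4 / sqrt p)
      \<le> ln 12096 + 3 * ln T + ln M + 4 * ln H - ln p / 2"
    using assms by (simp add: ln_mult ln_div ln_realpow ln_sqrt)
  ultimately show ?thesis
    using ln_le_of_power_le[of R 5 "12096 * T ^ 3 * M * H ^ 4 / sqrt p"] assms(1) by simp
qed

text \<open>The first claim uses one ordinate interval of length \<open>M\<close>. For the second
  the ordinates are cut into \<open>2 ^ (r - k - j)\<close> intervals of length \<open>H\<close>,
  and \<open>y\<close> is the logarithm of the number of points in the fullest one.\<close>

lemma low_bits_pair_count:
  fixes p r k N a b T u0 :: nat and g :: int
  defines "u \<equiv> exp_seq p g u0"
  defines "S \<equiv> {n. n < N - 1 \<and> low_bits k u n = a \<and> low_bits k u (Suc n) = b}"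
  assumes bp: "bit_prime r p" "5 \<le> p" and g: "\<not> int p dvd g" and u0: "u0 \<in> {1..p - 1}"
    and k: "1 \<le> k" "k \<le> r" and N: "N \<le> trajectory_length u" and r: "12 \<le> r"
    and T: "\<forall>n::int. n \<noteq> 0 \<longrightarrow> \<bar>n\<bar> \<le> int p ^ 20 \<longrightarrow> card {d. d dvd n} \<le> T" "1 \<le> T"
    and ne: "S \<noteq> {}"
  defines "x \<equiv> ln (real (card S))" and "m \<equiv> real (r - k) * ln 2"
    and "h \<equiv> real (min (r - k) (r div 6 - 2)) * ln 2"
  shows "2 * x \<le> ln 300 + ln T + m \<or> 3 * x \<le> ln 300 + ln T + 4 * m - ln p"
    and "\<exists>y. x \<le> m - h + y \<and> (3 * y \<le> ln 12096 + 3 * ln T + m \<or>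
      5 * y \<le> ln 12096 + 3 * ln T + m + 4 * h - ln p / 2)"
proof -
  have p: "prime p" "2 ^ (r - 1) \<le> p" "p < 2 ^ r" using bp unfolding bit_prime_def by auto
  have ip: "prime (int p)" using p(1) by simp
  define q where "q = (2::nat) ^ k"
  define M where "M = (2::nat) ^ (r - k)"
  \<comment> \<open>Subtracting 2 gives \<open>H ^ 6 \<le> 2 ^ (r - 12)\<close>, and 120 is below
    \<open>2 ^ 11\<close>, so that \<open>120 * H ^ 6 < 2 ^ (r - 1) \<le> p\<close>.\<close>
  define j where "j = min (r - k) (r div 6 - 2)"
  define H where "H = (2::nat) ^ j"
  have q0: "0 < q" unfolding q_def by simp
  have qM: "2 ^ r = M * q" unfolding q_def M_def using k by (simp flip: power_add)
  have qp: "\<not> int p dvd int q"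
  proof
    assume "int p dvd int q"
    hence "p dvd 2 ^ k" unfolding q_def by (simp only: of_nat_dvd_iff)
    hence "p dvd 2" using p(1) prime_dvd_power by blast
    thus False using bp(2) by (auto dest: dvd_imp_le)
  qed
  hence "coprime (int q) (int p)" using ip by (metis coprime_commute prime_imp_coprime)
  then obtain v where v: "[int q * v = 1] (mod int p)" using cong_solve_coprime_int by blast
  have u_lt: "u n < 2 ^ r" for n
    using exp_seq_range[OF p(1) g u0, of n] p(3) unfolding u_def by linarith
  have u_div: "u n div q < M" for n
    using u_lt[of n] unfolding qM by (simp add: less_mult_imp_div_less)
  have "u (Suc m) = u (Suc n)" if "u m = u n" for m n
    using that unfolding u_def by simp
  hence inj: "inj_on u {..<N}" using inj_on_subset[OF inj_on_trajectory] N by (metis lessThan_subset_iff)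
  define w where "w n = int (u (Suc n) div q) + int b * v" for n
  have inS: "n < N - 1" "u n mod q = a" "u (Suc n) mod q = b" if "n \<in> S" for n
    using that unfolding S_def low_bits_def q_def by auto
  have finS: "finite S" unfolding S_def by simp
  have curve: "exponential_curve (int p) (int q) g a q S w (\<lambda>n. u n div q) M T"
  proof unfold_locales
    show "inj_on w S"
    proof (rule inj_onI)
      fix i l assume il: "i \<in> S" "l \<in> S" "w i = w l"
      hence "u (Suc i) div q = u (Suc l) div q" unfolding w_def by simp
      hence "u (Suc i) = u (Suc l)" using inS(3)[OF il(1)] inS(3)[OF il(2)] by (metis div_mult_mod_eq)
      moreover have "Suc i < N" "Suc l < N" using inS(1)[OF il(1)] inS(1)[OF il(2)] by linarith+
      ultimately show "i = l" using inj by (auto dest: inj_onD)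
    qed
    fix i assume i: "i \<in> S"
    have "[int q * w i = int q * int (u (Suc i) div q) + int b] (mod int p)"
    proof -
      have "[int q * int (u (Suc i) div q) + int b * (int q * v) = int q * int (u (Suc i) div q) + int b * 1] (mod int p)"
        by (intro cong_add cong_mult cong_refl v)
      thus ?thesis unfolding w_def by (simp add: algebra_simps)
    qed
    also have "int q * int (u (Suc i) div q) + int b = int (u (Suc i))"
      using inS(3)[OF i] by (metis mult_div_mod_eq of_nat_add of_nat_mult)
    also have "[int (u (Suc i)) = g ^ u i] (mod int p)" unfolding u_def by (rule exp_seq_cong[OF p(1)])
    also have "u i = q * (u i div q) + a" using inS(2)[OF i] by (metis mult_div_mod_eq)
    finally show "[int q * w i = g ^ (q * (u i div q) + a)] (mod int p)" .
  qed (use ip qp g finS u_div T in auto)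
  have M1: "1 \<le> real M" "1 \<le> real H" "1 \<le> real p" "1 \<le> real T"
    using T(2) bp(2) unfolding M_def H_def by auto
  have lnM: "ln (real M) = m" "ln (real H) = h"
    unfolding M_def H_def m_def h_def j_def by (simp_all add: ln_realpow)
  have R1: "1 \<le> real (card S)" using finS ne by (simp add: Suc_le_eq card_gt_0_iff)
  have "M \<le> 2 ^ (r - 1)" unfolding M_def using k by (intro power_increasing) auto
  hence Mp: "int M \<le> int p" using p(2) by linarith
  have "real (card S) ^ 3 \<le> 150 * real T * real M * (real (card S) + real_of_int (int M) ^ 3 / real_of_int (int p))"
  proof (rule exponential_curve.curve_points2[OF curve _ Mp _ ne])
    show "0 < int M" unfolding M_def by simp
    fix i l
    show "\<bar>w i - w l\<bar> < int M" using u_div[of "Suc i"] u_div[of "Suc l"] unfolding w_def by simp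
  qed
  thus "2 * x \<le> ln 300 + ln T + m \<or> 3 * x \<le> ln 300 + ln T + 4 * m - ln p"
    using curve_points2_ln[OF R1 M1(4,1,3)] unfolding x_def lnM by simp
  define f where "f n = (u (Suc n) div q) div H" for n
  define F where "F y = {n \<in> S. f n = y}" for y
  have finF: "finite (F y)" for y unfolding F_def using finS by simp
  have jle: "j \<le> r - k" unfolding j_def by simp
  have MH: "M = 2 ^ (r - k - j) * H" unfolding M_def H_def using jle by (simp flip: power_add)
  have f_lt: "f n < 2 ^ (r - k - j)" for n
    unfolding f_def by (rule less_mult_imp_div_less) (use u_div[of "Suc n"] MH in simp)
  \<comment> \<open>The block index of a fullest interval.\<close>
  obtain y where y: "y \<in> f ` S" "\<And>z. z \<in> f ` S \<Longrightarrow> card (F z) \<le> card (F y)"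
  proof -
    have "Max ((\<lambda>z. card (F z)) ` f ` S) \<in> (\<lambda>z. card (F z)) ` f ` S" using finS ne by (intro Max_in) auto
    then obtain y where "Max ((\<lambda>z. card (F z)) ` f ` S) = card (F y)" "y \<in> f ` S"
      by (rule imageE) blast
    moreover have "card (F z) \<le> Max ((\<lambda>z. card (F z)) ` f ` S)" if "z \<in> f ` S" for z
      using finS that by (intro Max_ge) auto
    ultimately show ?thesis by (intro that[of y]) auto
  qed
  have "card S \<le> card (f ` S) * card (F y)"
    using y finS unfolding F_def by (intro card_le_image_times_fiber) auto
  also have "\<dots> \<le> 2 ^ (r - k - j) * card (F y)"
    using card_mono[of "{..<2 ^ (r - k - j)}" "f ` S"] f_lt by (intro mult_right_mono) auto
  finally have SF: "card S \<le> 2 ^ (r - k - j) * card (F y)" .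
  have Fne: "F y \<noteq> {}" using y(1) unfolding F_def by auto
  have F1: "1 \<le> real (card (F y))" using finF Fne by (simp add: Suc_le_eq card_gt_0_iff)
  have Fcurve: "exponential_curve (int p) (int q) g a q (F y) w (\<lambda>n. u n div q) M T"
    by (rule exponential_curve.exponential_curve_subset[OF curve]) (auto simp: F_def)
  have "real (card (F y)) ^ 5 \<le> 6048 * real T ^ 3 * real M * ((real (card (F y)))\<^sup>2 + real_of_int (int H) ^ 4 / sqrt (real_of_int (int p)))"
  proof (rule exponential_curve.curve_points3[OF Fcurve _ _ _ Fne])
    show "0 < int H" unfolding H_def by simp
    have "H ^ 6 \<le> 2 ^ (r - 12)"
    proof -
      have "j * 6 \<le> r - 12" unfolding j_def by linarith
      thus ?thesis unfolding H_def by (simp flip: power_mult)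
    qed
    moreover have "(0::nat) < 2 ^ (r - 12)" by simp
    ultimately have "120 * H ^ 6 < 2048 * 2 ^ (r - 12)" by linarith
    also have "(2048::nat) * 2 ^ (r - 12) = 2 ^ (r - 1)"
    proof -
      have "r - 1 = 11 + (r - 12)" using r by linarith
      hence "(2::nat) ^ (r - 1) = 2 ^ 11 * 2 ^ (r - 12)" by (simp only: power_add)
      thus ?thesis by simp
    qed
    finally have "120 * H ^ 6 < p" using p(2) by linarith
    thus "120 * int H ^ 6 < int p" by (metis of_nat_less_iff of_nat_mult of_nat_numeral of_nat_power)
    fix i l assume "i \<in> F y" "l \<in> F y"
    hence e: "(u (Suc i) div q) div H = (u (Suc l) div q) div H" unfolding F_def f_def by auto
    have H0: "0 < H" unfolding H_def by simp
    define A where "A = u (Suc i) div q"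
    define B where "B = u (Suc l) div q"
    have "A = H * (A div H) + A mod H" "B = H * (A div H) + B mod H"
      using e unfolding A_def B_def by (metis mult_div_mod_eq)+
    hence "\<bar>int A - int B\<bar> < int H" using mod_less_divisor[OF H0, of A] mod_less_divisor[OF H0, of B] by linarith
    thus "\<bar>w i - w l\<bar> < int H" unfolding w_def A_def B_def by simp
  qed
  hence yb: "3 * ln (card (F y)) \<le> ln 12096 + 3 * ln T + m \<or>
      5 * ln (card (F y)) \<le> ln 12096 + 3 * ln T + m + 4 * h - ln p / 2"
    using curve_points3_ln[OF F1 M1(4,1,2,3)] unfolding lnM by simp
  have "real (card S) \<le> 2 ^ (r - k - j) * real (card (F y))"
    using SF by (metis of_nat_le_iff of_nat_mult of_nat_numeral of_nat_power)
  hence "x \<le> ln (2 ^ (r - k - j) * real (card (F y)))" unfolding x_def using R1 F1 by (subst ln_le_cancel_iff) auto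
  also have "\<dots> = real (r - k - j) * ln 2 + ln (card (F y))" using F1 by (simp add: ln_mult ln_realpow)
  also have "real (r - k - j) * ln 2 = m - h"
    unfolding m_def h_def j_def[symmetric] by (simp only: of_nat_diff[OF jle] left_diff_distrib)
  finally show "\<exists>y. x \<le> m - h + y \<and> (3 * y \<le> ln 12096 + 3 * ln T + m \<or>
      5 * y \<le> ln 12096 + 3 * ln T + m + 4 * h - ln p / 2)" using yb by blast
qed

text \<open>In this lemma \<open>\<kappa>\<close>, \<open>\<rho>\<close>, \<open>P\<close> and \<open>t\<close> are the logarithms of \<open>2 ^ k\<close>, \<open>2 ^ r\<close>, \<open>p\<close> and of the
  bound for the number of divisors, and \<open>x\<close> is that of the number of points on the curve.\<close>

lemma regime_inequality:
  fixes \<kappa> \<rho> P t x y h L c e :: real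
  assumes P: "\<rho> - L \<le> P" "P \<le> \<rho>" and L: "0 < L" "1000 * L \<le> \<rho>"
    and \<kappa>: "0 \<le> \<kappa>" "\<kappa> \<le> \<rho>"
    and c: "0 \<le> c" "t \<le> c + e" "20 * (L + c) \<le> e"
    and h: "h \<le> \<rho> - \<kappa>" "h = \<rho> - \<kappa> \<or> \<rho> / 6 - 3 * L \<le> h \<and> h \<le> \<rho> / 6"
    and x: "2 * x \<le> c + t + (\<rho> - \<kappa>) \<or> 3 * x \<le> c + t + 4 * (\<rho> - \<kappa>) - P"
    and y: "x \<le> (\<rho> - \<kappa>) - h + y"
      "3 * y \<le> c + 3 * t + (\<rho> - \<kappa>) \<or> 5 * y \<le> c + 3 * t + (\<rho> - \<kappa>) + 4 * h - P / 2"
  shows "x \<le> 2 * e - L - 2 *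
    (if 17/20 * \<rho> \<le> \<kappa> then (\<kappa> - P) / 6
     else if 13/16 * \<rho> \<le> \<kappa> then 7/12 * \<kappa> - 25/48 * P
     else if 3/5 * \<rho> \<le> \<kappa> then (\<kappa> - P) / 4
     else 2/3 * \<kappa> - P / 2)"
proof -
  consider "17/20 * \<rho> \<le> \<kappa>" | "\<kappa> < 17/20 * \<rho>" "13/16 * \<rho> \<le> \<kappa>"
    | "\<kappa> < 13/16 * \<rho>" "3/5 * \<rho> \<le> \<kappa>" | "\<kappa> < 3/5 * \<rho>" by linarith
  moreover have c': "20 * L + 20 * c \<le> e" using c(3) by (simp add: distrib_left)
  moreover from x have x': "2 * x \<le> c + t + \<rho> - \<kappa> \<or> 3 * x \<le> c + t + 4 * \<rho> - 4 * \<kappa> - P"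
    by (simp add: algebra_simps)
  ultimately show ?thesis
  proof cases
    case 1
    \<comment> \<open>The box side is here at most \<open>2 ^ (3 * r / 20)\<close>, below the cutoff
      near \<open>2 ^ (r / 6)\<close>, so nothing is cut.\<close>
    hence hm: "h = \<rho> - \<kappa>" using h L by linarith
    from y(2) have "x \<le> 2 * e - L - \<kappa> / 3 + P / 3"
      by (rule disjE) (use hm y(1) 1 P L \<kappa> c(1,2) c' in linarith)+
    thus ?thesis using 1 by (simp add: field_simps)
  next
    case 2
    from h(2) y(2) have "x \<le> 2 * e - L - 7/6 * \<kappa> + 25/24 * P"
      by (elim disjE) (use y(1) h(1) 2 P L \<kappa> c(1,2) c' in linarith)+
    thus ?thesis using 2 by (simp add: field_simps)
  next
    case 3
    \<comment> \<open>Up to lower-order terms the two alternatives for \<open>x\<close> agree at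
      \<open>\<kappa> = 3/5 * \<rho>\<close>; above this point the first one is the larger bound,
      below it the second.\<close>
    from x' have "x \<le> 2 * e - L - \<kappa> / 2 + P / 2"
      by (rule disjE) (use 3 P L \<kappa> c(1,2) c' in linarith)+
    thus ?thesis using 3 L by (simp add: field_simps)
  next
    case 4
    from x' have "x \<le> 2 * e - L - 4/3 * \<kappa> + P"
      by (rule disjE) (use 4 P L \<kappa> c(1,2) c' in linarith)+
    thus ?thesis using 4 L by (simp add: field_simps)
  qed
qed

text \<open>Since \<open>\<kappa> \<le> \<rho> \<le> P + L\<close>, every branch is at most a small
  multiple of \<open>L\<close>. This makes the final bound for the number of points at least
  1.\<close>

lemma regime_small:
  fixes \<kappa> \<rho> P L e :: real
  assumes "\<rho> - L \<le> P" "P \<le> \<rho>" "0 < L" "0 \<le> \<kappa>" "\<kappa> \<le> \<rho>" "20 * L \<le> e"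
  shows "(if 17/20 * \<rho> \<le> \<kappa> then (\<kappa> - P) / 6
     else if 13/16 * \<rho> \<le> \<kappa> then 7/12 * \<kappa> - 25/48 * P
     else if 3/5 * \<rho> \<le> \<kappa> then (\<kappa> - P) / 4
     else 2/3 * \<kappa> - P / 2) \<le> e"
  using assms by auto


section \<open>Choice of constants and comparison of exponents\<close>

theorem theorem6:
  "\<forall>\<epsilon>::real. \<epsilon> > 0 \<longrightarrow> (\<exists>p0::nat. \<forall>(p::nat) (r::nat) (g::int) (u0::nat) (k::nat) (N::nat).
     p \<ge> p0 \<longrightarrow> bit_prime r p \<longrightarrow> \<not> int p dvd g \<longrightarrow> u0 \<in> {1..p - 1} \<longrightarrow>
     1 \<le> k \<longrightarrow> k \<le> r \<longrightarrow>
     1 \<le> N \<longrightarrow> N \<le> trajectory_length (exp_seq p g u0) \<longrightarrow>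
     real (num_low_bits k (exp_seq p g u0) N) \<ge>
       real N powr (1/2) * real p powr (- \<epsilon>) *
       (if real k / real r \<ge> 17/20 then (2 ^ k / real p) powr (1/6)
        else if real k / real r \<ge> 13/16 then 2 powr (7 * real k / 12) * real p powr (- 25/48)
        else if real k / real r \<ge> 3/5 then (2 ^ k / real p) powr (1/4)
        else 2 powr (2 * real k / 3) * real p powr (- 1/2)))"
proof (intro allI impI)
  fix \<epsilon> :: real assume \<epsilon>: "0 < \<epsilon>"
  \<comment> \<open>With exponent \<open>\<epsilon> / 20\<close> an integer of size up to
    \<open>p ^ 20\<close> has at most \<open>C0 * p powr \<epsilon>\<close> divisors.\<close>
  obtain C0 where C0: "0 < C0"
    "\<And>n::int. n \<noteq> 0 \<Longrightarrow> real (card {d. d dvd n}) \<le> C0 * \<bar>real_of_int n\<bar> powr (\<epsilon> / 20)"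
    using divisor_bound_int[of "\<epsilon> / 20"] \<epsilon> by auto
  define C where "C = max 1 C0"
  \<comment> \<open>Dominates both numerical constants 300 and 12096 as well as the constant of the
    divisor bound.\<close>
  define c where "c = ln 12096 + ln C"
  define L :: real where "L = ln 2"
  \<comment> \<open>Ensures \<open>1000 * L \<le> P\<close> and
    \<open>20 * (L + c) \<le> \<epsilon> * P\<close>, the slack required when the exponents are
    compared.\<close>
  define p0 where "p0 = nat \<lceil>exp (1000 * L + 20 * (L + c) / \<epsilon>)\<rceil>"
  have C1: "1 \<le> C" unfolding C_def by simp
  have L0: "0 < L" unfolding L_def by simp
  have c_ge: "ln 12096 \<le> c" unfolding c_def using C1 by simp
  have "ln 300 \<le> ln (12096::real)" "ln 2 \<le> ln (12096::real)" by simp_all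
  hence c_ge': "ln 300 \<le> c" "L \<le> c" using c_ge unfolding L_def by linarith+
  hence c0: "0 \<le> c" using L0 by linarith
  show "\<exists>p0::nat. \<forall>(p::nat) (r::nat) (g::int) (u0::nat) (k::nat) (N::nat).
     p \<ge> p0 \<longrightarrow> bit_prime r p \<longrightarrow> \<not> int p dvd g \<longrightarrow> u0 \<in> {1..p - 1} \<longrightarrow>
     1 \<le> k \<longrightarrow> k \<le> r \<longrightarrow>
     1 \<le> N \<longrightarrow> N \<le> trajectory_length (exp_seq p g u0) \<longrightarrow>
     real (num_low_bits k (exp_seq p g u0) N) \<ge>
       real N powr (1/2) * real p powr (- \<epsilon>) *
       (if real k / real r \<ge> 17/20 then (2 ^ k / real p) powr (1/6)
        else if real k / real r \<ge> 13/16 then 2 powr (7 * real k / 12) * real p powr (- 25/48)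
        else if real k / real r \<ge> 3/5 then (2 ^ k / real p) powr (1/4)
        else 2 powr (2 * real k / 3) * real p powr (- 1/2))"
  proof (rule exI[of _ p0], intro allI impI)
    fix p r :: nat and g :: int and u0 k N :: nat
    assume p_ge: "p0 \<le> p" and bp: "bit_prime r p" and g: "\<not> int p dvd g" and u0: "u0 \<in> {1..p - 1}"
      and k: "1 \<le> k" "k \<le> r" and N: "1 \<le> N" "N \<le> trajectory_length (exp_seq p g u0)"
    define P where "P = ln (real p)"
    define e where "e = \<epsilon> * P"
    define \<kappa> where "\<kappa> = real k * L"
    define \<rho> where "\<rho> = real r * L"
    have p_exp: "exp (1000 * L + 20 * (L + c) / \<epsilon>) \<le> real p" using p_ge unfolding p0_def by linarith
    have p_pos: "0 < real p" using p_exp exp_gt_zero less_le_trans by blast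
    have "1000 * L + 20 * (L + c) / \<epsilon> \<le> P"
      unfolding P_def using p_exp p_pos by (simp add: ln_ge_iff)
    moreover have "0 \<le> 20 * (L + c) / \<epsilon>" using L0 c0 \<epsilon> by simp
    ultimately have P_ge: "1000 * L \<le> P" "20 * (L + c) / \<epsilon> \<le> P" using L0 by linarith+
    have e_ge: "20 * (L + c) \<le> e" using P_ge(2) \<epsilon> unfolding e_def by (simp add: field_simps)
    have r_pow: "2 ^ (r - 1) \<le> p" "p < 2 ^ r" using bp unfolding bit_prime_def by auto
    have P_le: "P \<le> \<rho>"
    proof -
      have "real p \<le> 2 ^ r" using r_pow(2) by (metis less_imp_le of_nat_le_iff of_nat_numeral of_nat_power)
      hence "P \<le> ln (2 ^ r)" unfolding P_def using p_pos by (subst ln_le_cancel_iff) auto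
      thus ?thesis unfolding \<rho>_def L_def by (simp add: ln_realpow)
    qed
    have r1: "1000 \<le> r"
    proof -
      have "1000 * L \<le> real r * L" using P_ge(1) P_le unfolding \<rho>_def by linarith
      thus ?thesis using L0 by simp
    qed
    have P_lower: "\<rho> - L \<le> P"
    proof -
      have "2 ^ (r - 1) \<le> real p" using r_pow(1) by (metis of_nat_le_iff of_nat_numeral of_nat_power)
      hence "ln (2 ^ (r - 1)) \<le> P" unfolding P_def using p_pos by (subst ln_le_cancel_iff) auto
      thus ?thesis using r1 unfolding \<rho>_def L_def by (simp add: ln_realpow of_nat_diff left_diff_distrib)
    qed
    have p5: "5 \<le> p"
    proof -
      have "(2::nat) ^ 3 \<le> 2 ^ (r - 1)" using r1 by (intro power_increasing) auto
      thus ?thesis using r_pow(1) by simp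
    qed
    have \<kappa>: "0 \<le> \<kappa>" "\<kappa> \<le> \<rho>" unfolding \<kappa>_def \<rho>_def using L0 k by auto
    define T where "T = nat \<lfloor>C * real p powr \<epsilon>\<rfloor>"
    have "1 \<le> real p powr \<epsilon>" using p5 \<epsilon> by (intro ge_one_powr_ge_zero) auto
    hence "1 * 1 \<le> C * real p powr \<epsilon>" using C1 by (intro mult_mono) auto
    hence T1: "1 \<le> T" unfolding T_def by linarith
    have T: "card {d. d dvd n} \<le> T" if n: "n \<noteq> 0" "\<bar>n\<bar> \<le> int p ^ 20" for n :: int
    proof -
      have "\<bar>real_of_int n\<bar> \<le> real p ^ 20"
        using n(2) by (metis of_int_abs of_int_le_iff of_int_of_nat_eq of_int_power)
      hence "\<bar>real_of_int n\<bar> powr (\<epsilon> / 20) \<le> (real p ^ 20) powr (\<epsilon> / 20)"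
        using \<epsilon> by (intro powr_mono2) auto
      also have "real p ^ 20 = real p powr 20" using p_pos by simp
      also have "(real p powr 20) powr (\<epsilon> / 20) = real p powr \<epsilon>" unfolding powr_powr by simp
      finally have "C0 * \<bar>real_of_int n\<bar> powr (\<epsilon> / 20) \<le> C * real p powr \<epsilon>"
        using C0(1) unfolding C_def by (intro mult_mono) auto
      with C0(2)[OF n(1)] show ?thesis unfolding T_def by linarith
    qed
    have "real T \<le> C * real p powr \<epsilon>" using T1 unfolding T_def by linarith
    hence "ln (real T) \<le> ln (C * real p powr \<epsilon>)" using T1 by (subst ln_le_cancel_iff) auto
    also have "\<dots> = ln C + e" unfolding e_def P_def using C1 p_pos by (simp add: ln_mult ln_powr)
    also have "\<dots> \<le> c + e" unfolding c_def by simp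
    finally have lnT: "ln (real T) \<le> c + e" .
    define lE where "lE = (if 17/20 * \<rho> \<le> \<kappa> then (\<kappa> - P) / 6
     else if 13/16 * \<rho> \<le> \<kappa> then 7/12 * \<kappa> - 25/48 * P
     else if 3/5 * \<rho> \<le> \<kappa> then (\<kappa> - P) / 4
     else 2/3 * \<kappa> - P / 2)"
    have ratio: "(q \<le> real k / real r) \<longleftrightarrow> q * \<rho> \<le> \<kappa>" for q
      unfolding \<rho>_def \<kappa>_def using r1 L0 by (simp add: pos_le_divide_eq flip: mult.assoc)
    have exp_k: "2 ^ k = exp \<kappa>" unfolding \<kappa>_def L_def by (simp add: exp_of_nat_mult)
    have exp_P: "real p = exp P" unfolding P_def using p_pos by simp
    have E: "(if real k / real r \<ge> 17/20 then (2 ^ k / real p) powr (1/6)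
        else if real k / real r \<ge> 13/16 then 2 powr (7 * real k / 12) * real p powr (- 25/48)
        else if real k / real r \<ge> 3/5 then (2 ^ k / real p) powr (1/4)
        else 2 powr (2 * real k / 3) * real p powr (- 1/2)) = exp lE"
    proof -
      have two: "(2::real) powr (7 * real k / 12) = exp (7/12 * \<kappa>)" "(2::real) powr (2 * real k / 3) = exp (2/3 * \<kappa>)"
        unfolding powr_def \<kappa>_def L_def by simp_all
      have "(exp \<kappa> / exp P) powr (1/6) = exp ((\<kappa> - P) / 6)" "(exp \<kappa> / exp P) powr (1/4) = exp ((\<kappa> - P) / 4)"
        unfolding exp_diff[symmetric] powr_def by simp_all
      moreover have "2 powr (7 * real k / 12) * exp P powr (- 25/48) = exp (7/12 * \<kappa> - 25/48 * P)"
        "2 powr (2 * real k / 3) * exp P powr (- 1/2) = exp (2/3 * \<kappa> - P / 2)"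
        unfolding two unfolding powr_def by (simp_all flip: exp_add)
      ultimately show ?thesis unfolding ratio lE_def exp_k exp_P by simp
    qed
    \<comment> \<open>The bound for the number of points per pair of residues; the spare
      \<open>- L\<close> pays for a later factor 2.\<close>
    define X where "X = exp (2 * e - L - 2 * lE)"
    have lE_small: "lE \<le> e - L"
      unfolding lE_def
    proof (rule regime_small[OF P_lower P_le L0 \<kappa>])
      show "20 * L \<le> e - L" using e_ge c_ge'(2) L0 by (simp add: distrib_left)
    qed
    hence X1: "1 \<le> X" unfolding X_def using L0 by simp
    define u where "u = exp_seq p g u0"
    have count: "real (card {n. n < N - 1 \<and> low_bits k u n = a \<and> low_bits k u (Suc n) = b}) \<le> X" for a b
    proof (cases "{n. n < N - 1 \<and> low_bits k u n = a \<and> low_bits k u (Suc n) = b} = {}")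
      case True
      show ?thesis unfolding True using X1 by simp
    next
      case False
      let ?S = "{n. n < N - 1 \<and> low_bits k u n = a \<and> low_bits k u (Suc n) = b}"
      have r12: "12 \<le> r" using r1 by simp
      have m: "real (r - k) * ln 2 = \<rho> - \<kappa>"
        using k unfolding \<rho>_def \<kappa>_def L_def by (simp add: of_nat_diff left_diff_distrib)
      define h where "h = real (min (r - k) (r div 6 - 2)) * ln 2"
      have T': "\<forall>n::int. n \<noteq> 0 \<longrightarrow> \<bar>n\<bar> \<le> int p ^ 20 \<longrightarrow> card {d. d dvd n} \<le> T"
        using T by blast
      note b = low_bits_pair_count[OF bp p5 g u0 k N(2) r12 T' T1, of a b, folded u_def, OF False, unfolded m,
        folded h_def P_def]
      obtain y where y: "ln (real (card ?S)) \<le> \<rho> - \<kappa> - h + y"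
        "3 * y \<le> ln 12096 + 3 * ln T + (\<rho> - \<kappa>) \<or> 5 * y \<le> ln 12096 + 3 * ln T + (\<rho> - \<kappa>) + 4 * h - P / 2"
        using b(2) by blast
      have "real (min (r - k) (r div 6 - 2)) \<le> real (r - k)" by simp
      hence "real (min (r - k) (r div 6 - 2)) * ln 2 \<le> real (r - k) * ln 2" by (intro mult_right_mono) auto
      hence h1: "h \<le> \<rho> - \<kappa>" unfolding m h_def .
      have h2: "h = \<rho> - \<kappa> \<or> \<rho> / 6 - 3 * L \<le> h \<and> h \<le> \<rho> / 6"
      proof (cases "r - k \<le> r div 6 - 2")
        case True
        thus ?thesis unfolding m[symmetric] h_def by (simp add: min_def)
      next
        case False
        hence "h = real (r div 6 - 2) * L" unfolding h_def L_def by (simp add: min_def)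
        \<comment> \<open>The loss of 3 consists of the 2 in the cutoff and at most 1 from rounding
          in \<open>r div 6\<close>.\<close>
        moreover have "(real r / 6 - 3) * L \<le> real (r div 6 - 2) * L" "real (r div 6 - 2) * L \<le> (real r / 6) * L"
          using L0 r12 by (intro mult_right_mono; linarith)+
        ultimately show ?thesis unfolding \<rho>_def by (simp add: left_diff_distrib)
      qed
      have ln_S: "ln (real (card ?S)) \<le> 2 * e - L - 2 * lE"
        unfolding lE_def
      proof (rule regime_inequality[OF P_lower P_le L0 _ \<kappa> c0 lnT e_ge h1 h2 _ y(1)])
        show "1000 * L \<le> \<rho>" using P_ge(1) P_le by linarith
        show "2 * ln (real (card ?S)) \<le> c + ln (real T) + (\<rho> - \<kappa>) \<or>
          3 * ln (real (card ?S)) \<le> c + ln (real T) + 4 * (\<rho> - \<kappa>) - P"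
          using b(1) c_ge'(1) by linarith
        show "3 * y \<le> c + 3 * ln (real T) + (\<rho> - \<kappa>) \<or> 5 * y \<le> c + 3 * ln (real T) + (\<rho> - \<kappa>) + 4 * h - P / 2"
          using y(2) c_ge by linarith
      qed
      have "exp (ln (real (card ?S))) \<le> X" unfolding X_def exp_le_cancel_iff by (rule ln_S)
      moreover have "0 < real (card ?S)" using False by (simp add: card_gt_0_iff)
      ultimately show ?thesis by simp
    qed
    define \<nu> where "\<nu> = num_low_bits k u N"
    have "N - 1 \<le> \<nu>\<^sup>2 * nat \<lfloor>X\<rfloor>"
      unfolding \<nu>_def num_low_bits_def
    proof (rule pigeonhole_consecutive[OF N(1)])
      show "card {n. n < N - 1 \<and> low_bits k u n = a \<and> low_bits k u (Suc n) = b} \<le> nat \<lfloor>X\<rfloor>" for a b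
        using count[of a b] by linarith
    qed
    hence "real (N - 1) \<le> real (\<nu>\<^sup>2 * nat \<lfloor>X\<rfloor>)" by (simp only: of_nat_le_iff)
    also have "\<dots> \<le> (real \<nu>)\<^sup>2 * X" using X1 by (auto intro!: mult_left_mono)
    finally have NX: "real N - 1 \<le> (real \<nu>)\<^sup>2 * X" using N(1) by simp
    have "0 \<in> {..<N}" using N(1) by simp
    hence "0 < \<nu>" unfolding \<nu>_def num_low_bits_def by (auto simp: card_gt_0_iff)
    hence \<nu>1: "1 \<le> real \<nu>" by simp
    hence "1 \<le> (real \<nu>)\<^sup>2" by (rule one_le_power)
    hence "1 * 1 \<le> (real \<nu>)\<^sup>2 * X" using X1 by (intro mult_mono) linarith+
    \<comment> \<open>Both 1 and \<open>N - 1\<close> are at most \<open>\<nu>\<^sup>2 * X\<close>,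
      so passing from \<open>N - 1\<close> to \<open>N\<close> costs a factor 2, which the
      \<open>- L\<close> in \<open>X\<close> compensates.\<close>
    hence "real N \<le> 2 * ((real \<nu>)\<^sup>2 * X)" using NX by linarith
    moreover have "0 < real N" using N(1) by simp
    ultimately have "ln (real N) \<le> ln (2 * ((real \<nu>)\<^sup>2 * X))" by (subst ln_le_cancel_iff) linarith+
    also have "\<dots> = ln 2 + ln X + 2 * ln (real \<nu>)"
      using \<nu>1 X1 by (simp add: ln_mult ln_realpow)
    also have "\<dots> = 2 * e - 2 * lE + 2 * ln (real \<nu>)" unfolding X_def L_def ln_exp by simp
    finally have "ln (real N) / 2 - e + lE \<le> ln (real \<nu>)" by linarith
    hence "exp (ln (real N) / 2 - e + lE) \<le> exp (ln (real \<nu>))" by (simp only: exp_le_cancel_iff)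
    hence "exp (ln (real N) / 2 - e + lE) \<le> real \<nu>" using \<nu>1 by simp
    moreover have "exp (ln (real N) / 2 - e + lE) = real N powr (1/2) * real p powr (- \<epsilon>) * exp lE"
    proof -
      have "ln (real N) / 2 - e + lE = 1/2 * ln (real N) + (- \<epsilon>) * ln (real p) + lE"
        unfolding e_def P_def by simp
      thus ?thesis unfolding powr_def using N(1) p_pos by (simp only: exp_add) simp
    qed
    ultimately show "real (num_low_bits k (exp_seq p g u0) N) \<ge>
       real N powr (1/2) * real p powr (- \<epsilon>) *
       (if real k / real r \<ge> 17/20 then (2 ^ k / real p) powr (1/6)
        else if real k / real r \<ge> 13/16 then 2 powr (7 * real k / 12) * real p powr (- 25/48)
        else if real k / real r \<ge> 3/5 then (2 ^ k / real p) powr (1/4)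
        else 2 powr (2 * real k / 3) * real p powr (- 1/2))"
      unfolding E \<nu>_def u_def by (simp only:)
  qed
qed

end
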